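(* Let $P \subset \mathbb{R}^3$ be a $3$-polytope, $F$ a facet of $P$, $V$ a triangular cone such that $F \cap V$ is a triangle contained in the relative interior of $F$, and $m$ a positive integer. Then there is an $m$-cupola $C$ lying beyond $F$ of $P$ such that $P$ is beyond the facet $(A_1,A_2,A_3)$ of $C$ and such that $V$ is the visibility cone of $C$. Moreover, the binary encoding length of (the vertex coordinates of) $C$ is polynomial in the encoding lengths of $P$, $V$ and $m$.
   Context: Beyond: for a polytope $P$ and a face $G$ of $P$, a point $p$ is beyond $G$ if it strictly violates every facet-defining inequality of $P$ whose facet contains $G$ and strictly satisfies every other facet-defining inequality of $P$; $P_{\text{beyond } G}$ is the closure of the set of points beyond $G$, and a set is said to be beyond $G$ if it is contained in $P_{\text{beyond } G}$. Schönhardt position: six points $A_1,A_2,A_3,B_1,B_2,B_3$ are in Schönhardt position if they are the vertices of a non-convex polytope (a Schönhardt polytope) with facets $(A_1,A_2,A_3)$, $(B_1,B_2,B_3)$, $(A_1,B_1,A_2)$, $(B_1,A_2,B_2)$, $(A_2,B_2,A_3)$, $(B_2,A_3,B_3)$, $(A_3,B_3,B_1)$, $(B_3,B_1,A_1)$, whose interior dihedral angle exceeds $\pi$ exactly at the edges $(B_1,A_2)$, $(B_2,A_3)$, $(B_3,A_1)$ (the diagonals). The triangle $(B_1,B_2,B_3)$ is the skylight. The visibility cone is the triangular cone consisting of the points lying on the same (closed) side as $B_3$ of the plane $B_1B_2A_2$, on the same side as $B_1$ of the plane $B_2B_3A_3$, and on the same side as $B_2$ of the plane $B_3B_1A_1$.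 An $m$-cupola is a convex polytope $C$ with vertices $A_1,A_2,A_3,B_1,B_2,B_3$ and $q_k^{i,j}$ ($k=0,\dots,m+1$, $(i,j)\in\{(1,2),(2,3),(3,1)\}$), where $q_0^{i,j}=A_i$ and $q_{m+1}^{i,j}=B_j$, such that: $A_1,\dots,B_3$ are in Schönhardt position; $(A_1,A_2,A_3)$ (the bottom facet) and $(B_1,B_2,B_3)$ (the skylight) are facets of $C$; the other facets are the triangles $(B_i,q_k^{i,j},q_{k+1}^{i,j})$ and $(A_j,q_k^{i,j},q_{k+1}^{i,j})$ for $k=0,\dots,m$ and $(i,j)\in\{(1,2),(2,3),(3,1)\}$; and the vertices $q_k^{1,2}$ ($1\le k\le m$) lie on the side of the plane $B_1A_2B_3$ opposite to $B_2$, the $q_k^{2,3}$ on the side of the plane $B_2A_3B_1$ opposite to $B_3$, and the $q_k^{3,1}$ on the side of the plane $B_3A_1B_2$ opposite to $B_1$. The visibility cone of $C$ is the visibility cone of its six points $A_1,\dots,B_3$. A triangular cone is the intersection of three closed halfspaces whose boundary planes meet in a single point.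
   Formalization: The encoding length of m is taken as m itself (unary), since C has 3m+6 vertices and a bound polynomial in log m fails; the last two Schönhardt facets are read as (A_3,B_3,A_1), (B_3,A_1,B_1), since the printed list bounds no polytope. *)

theory Defs
  imports
    "HOL-Analysis.Analysis"
    "HOL-Computational_Algebra.Polynomial"
    "HOL-Library.Log_Nat"
begin

type_synonym point = "real^3"

text \<open>
  The indices 1, 2, 3 of the points are elements of the type \<open>3\<close>, whose arithmetic is
  modulo 3 (so \<open>3 = 0\<close>).  Thus the pairs (1,2), (2,3), (3,1) are exactly the pairs
  \<open>(i, i + 1)\<close>, and \<open>i + 2\<close> is the remaining index.
\<close>

definition vertices :: "point set \<Rightarrow> point set" where
  "vertices P = {v. v extreme_point_of P}"

definition three_polytope :: "point set \<Rightarrow> bool" where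
  "three_polytope P \<longleftrightarrow> polytope P \<and> aff_dim P = 3"

definition is_triangle :: "point set \<Rightarrow> bool" where
  "is_triangle T \<longleftrightarrow> (\<exists>a b c. \<not> collinear {a, b, c} \<and> T = convex hull {a, b, c})"


subsection \<open>Beyond\<close>

definition facet_inequality :: "point set \<Rightarrow> point set \<Rightarrow> point \<Rightarrow> real \<Rightarrow> bool" where
  "facet_inequality P F a b \<longleftrightarrow>
     F facet_of P \<and> P \<subseteq> {x. a \<bullet> x \<le> b} \<and> F = P \<inter> {x. a \<bullet> x = b}"

definition point_beyond :: "point set \<Rightarrow> point set \<Rightarrow> point \<Rightarrow> bool" where
  "point_beyond P G p \<longleftrightarrow>
     (\<forall>F a b. facet_inequality P F a b \<longrightarrow> (if G \<subseteq> F then a \<bullet> p > b else a \<bullet> p < b))"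

definition beyond_region :: "point set \<Rightarrow> point set \<Rightarrow> point set" where
  "beyond_region P G = closure {p. point_beyond P G p}"

definition set_beyond :: "point set \<Rightarrow> point set \<Rightarrow> point set \<Rightarrow> bool" where
  "set_beyond S P G \<longleftrightarrow> S \<subseteq> beyond_region P G"


subsection \<open>Triangular cones\<close>

definition cone_description :: "point set \<Rightarrow> (3 \<Rightarrow> point) \<Rightarrow> (3 \<Rightarrow> real) \<Rightarrow> bool" where
  "cone_description V a b \<longleftrightarrow>
     V = {x. \<forall>i. a i \<bullet> x \<le> b i} \<and> (\<exists>!x. \<forall>i. a i \<bullet> x = b i)"

definition triangular_cone :: "point set \<Rightarrow> bool" where
  "triangular_cone V \<longleftrightarrow> (\<exists>a b. cone_description V a b)"


subsection \<open>Schoenhardt position\<close>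

text \<open>
  \<open>polytope_bounded_by Q T\<close>: the possibly non-convex polytope \<open>Q\<close> has as its boundary
  the embedded simplicial surface whose triangles have the vertex sets in \<open>T\<close>.
\<close>

definition polytope_bounded_by :: "point set \<Rightarrow> point set set \<Rightarrow> bool" where
  "polytope_bounded_by Q T \<longleftrightarrow>
     compact Q \<and> closure (interior Q) = Q \<and>
     (\<forall>t\<in>T. card t = 3 \<and> \<not> affine_dependent t) \<and>
     (\<forall>s\<in>T. \<forall>t\<in>T. convex hull s \<inter> convex hull t = convex hull (s \<inter> t)) \<and>
     frontier Q = (\<Union>t\<in>T. convex hull t)"

text \<open>
  The angle, measured through \<open>Q\<close>, at the edge \<open>u v\<close> of \<open>Q\<close> whose two facets are the
  triangles \<open>u v w\<close> and \<open>u v x\<close>.  The vectors \<open>p\<close> and \<open>q\<close> are orthogonal to the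
  edge and point along these facets.  The half-planes spanned by them enclose a convex wedge of
  angle \<open>\<alpha>\<close>, and near the midpoint of the edge \<open>Q\<close> is either this wedge or the closure of its
  complement; the bisector of the wedge tells which.
\<close>

definition orth_part :: "point \<Rightarrow> point \<Rightarrow> point" where
  "orth_part e y = y - ((y \<bullet> e) / (e \<bullet> e)) *\<^sub>R e"

definition interior_dihedral_angle ::
    "point set \<Rightarrow> point \<Rightarrow> point \<Rightarrow> point \<Rightarrow> point \<Rightarrow> real" where
  "interior_dihedral_angle Q u v w x =
     (let p = orth_part (v - u) (w - u); q = orth_part (v - u) (x - u);
          \<alpha> = arccos ((p \<bullet> q) / (norm p * norm q));
          d = p /\<^sub>R norm p + q /\<^sub>R norm q
      in if \<forall>\<^sub>F t in at_right 0. midpoint u v + t *\<^sub>R d \<in> Q then \<alpha> else 2 * pi - \<alpha>)"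

definition schoenhardt_triangles :: "(3 \<Rightarrow> point) \<Rightarrow> (3 \<Rightarrow> point) \<Rightarrow> point set set" where
  "schoenhardt_triangles A B =
     {range A, range B} \<union>
     (\<Union>i. {{A i, B i, A (i + 1)}, {B i, A (i + 1), B (i + 1)}})"

text \<open>
  The angle at the nine edges other than the diagonals is required to be strictly less than
  \<open>pi\<close>, as triangles meeting at an angle \<open>pi\<close> would be coplanar and hence not be facets.
\<close>

definition schoenhardt_polytope ::
    "point set \<Rightarrow> (3 \<Rightarrow> point) \<Rightarrow> (3 \<Rightarrow> point) \<Rightarrow> bool" where
  "schoenhardt_polytope Q A B \<longleftrightarrow>
     inj A \<and> inj B \<and> range A \<inter> range B = {} \<and>
     polytope_bounded_by Q (schoenhardt_triangles A B) \<and> \<not> convex Q \<and>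
     (\<forall>i. interior_dihedral_angle Q (B i) (A (i + 1)) (A i) (B (i + 1)) > pi \<and>
          interior_dihedral_angle Q (A i) (A (i + 1)) (A (i + 2)) (B i) < pi \<and>
          interior_dihedral_angle Q (B i) (B (i + 1)) (B (i + 2)) (A (i + 1)) < pi \<and>
          interior_dihedral_angle Q (A i) (B i) (A (i + 1)) (B (i + 2)) < pi)"

definition schoenhardt_position :: "(3 \<Rightarrow> point) \<Rightarrow> (3 \<Rightarrow> point) \<Rightarrow> bool" where
  "schoenhardt_position A B \<longleftrightarrow> (\<exists>Q. schoenhardt_polytope Q A B)"


subsection \<open>Visibility cone and cupolas\<close>

text \<open>The sign of \<open>plane_side a b c x\<close> tells on which side of the plane \<open>a b c\<close> the point \<open>x\<close> lies.\<close>

definition plane_side :: "point \<Rightarrow> point \<Rightarrow> point \<Rightarrow> point \<Rightarrow> real" where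
  "plane_side a b c x = cross3 (b - a) (c - a) \<bullet> (x - a)"

definition same_closed_side :: "point \<Rightarrow> point \<Rightarrow> point \<Rightarrow> point \<Rightarrow> point \<Rightarrow> bool" where
  "same_closed_side a b c x y \<longleftrightarrow> plane_side a b c x * plane_side a b c y \<ge> 0"

definition opposite_side :: "point \<Rightarrow> point \<Rightarrow> point \<Rightarrow> point \<Rightarrow> point \<Rightarrow> bool" where
  "opposite_side a b c x y \<longleftrightarrow> plane_side a b c x * plane_side a b c y < 0"

definition visibility_cone :: "(3 \<Rightarrow> point) \<Rightarrow> (3 \<Rightarrow> point) \<Rightarrow> point set" where
  "visibility_cone A B =
     {x. \<forall>i. same_closed_side (B i) (B (i + 1)) (A (i + 1)) x (B (i + 2))}"

text \<open>Here \<open>q i k\<close> is the point \<open>q\<^sub>k\<close> belonging to the pair \<open>(i, i + 1)\<close>.\<close>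

definition cupola ::
    "nat \<Rightarrow> point set \<Rightarrow> (3 \<Rightarrow> point) \<Rightarrow> (3 \<Rightarrow> point) \<Rightarrow> (3 \<Rightarrow> nat \<Rightarrow> point) \<Rightarrow> bool" where
  "cupola m C A B q \<longleftrightarrow>
     three_polytope C \<and>
     (\<forall>i. q i 0 = A i \<and> q i (m + 1) = B (i + 1)) \<and>
     vertices C = range A \<union> range B \<union> (\<Union>i. q i ` {1..m}) \<and>
     card (vertices C) = 3 * m + 6 \<and>
     schoenhardt_position A B \<and>
     {G. G facet_of C} =
       {convex hull (range A), convex hull (range B)} \<union>
       (\<Union>i. \<Union>k\<in>{0..m}. {convex hull {B i, q i k, q i (k + 1)},
                           convex hull {A (i + 1), q i k, q i (k + 1)}}) \<and>
     (\<forall>i. \<forall>k\<in>{1..m}. opposite_side (B i) (A (i + 1)) (B (i + 2)) (q i k) (B (i + 1)))"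


subsection \<open>Binary encoding length\<close>

definition int_length :: "int \<Rightarrow> nat" where
  "int_length z = 1 + floorlog 2 (nat \<bar>z\<bar>)"

definition rat_length :: "rat \<Rightarrow> nat" where
  "rat_length r = (let (n, d) = quotient_of r in int_length n + int_length d)"

text \<open>The lengths below are meaningful only for rational arguments.\<close>

definition real_length :: "real \<Rightarrow> nat" where
  "real_length x = rat_length (inv of_rat x)"

definition rational_point :: "point \<Rightarrow> bool" where
  "rational_point v \<longleftrightarrow> (\<forall>i. v $ i \<in> \<rat>)"

definition point_length :: "point \<Rightarrow> nat" where
  "point_length v = (\<Sum>i\<in>UNIV. real_length (v $ i))"

definition rational_polytope :: "point set \<Rightarrow> bool" where
  "rational_polytope P \<longleftrightarrow> polytope P \<and> (\<forall>v\<in>vertices P. rational_point v)"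

definition polytope_length :: "point set \<Rightarrow> nat" where
  "polytope_length P = (\<Sum>v\<in>vertices P. point_length v)"

definition rational_cone_description ::
    "point set \<Rightarrow> (3 \<Rightarrow> point) \<Rightarrow> (3 \<Rightarrow> real) \<Rightarrow> bool" where
  "rational_cone_description V a b \<longleftrightarrow>
     cone_description V a b \<and> (\<forall>i. rational_point (a i) \<and> b i \<in> \<rat>)"

definition rational_cone :: "point set \<Rightarrow> bool" where
  "rational_cone V \<longleftrightarrow> (\<exists>a b. rational_cone_description V a b)"

definition cone_length :: "point set \<Rightarrow> nat" where
  "cone_length V =
     (LEAST l. \<exists>a b. rational_cone_description V a b \<and>
        l = (\<Sum>i\<in>UNIV. point_length (a i) + real_length (b i)))"

end

theory Submission
  imports Defs
begin

section \<open>Construction of cupolas\<close>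

text \<open>
  Let \<open>v\<close> be the apex of \<open>V\<close> and \<open>w\<^sub>1, w\<^sub>2, w\<^sub>3\<close> the corners of \<open>F \<inter> V\<close>.  In the coordinates
  \<open>X\<close> with \<open>x = v + \<Sum> X\<^sub>j (w\<^sub>j - v)\<close> the cone \<open>V\<close> is the positive octant and \<open>F\<close> lies in the plane
  \<open>\<Sum> X\<^sub>j = 1\<close>.  The bottom facet and the skylight of the cupola are put into two parallel planes
  \<open>\<Sum> X\<^sub>j = a\<close> and \<open>\<Sum> X\<^sub>j = b\<close> very close to \<open>F\<close>, the second one much closer to the first than the
  first is to \<open>F\<close>.  The points \<open>B\<^sub>i\<close> are forced to lie on the edges of \<open>V\<close>, and \<open>A\<^sub>i\<close> is
  chosen slightly beyond the corner on the prolongation of an edge of the triangle cut out by \<open>V\<close>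
  (a pinwheel).  The points \<open>q\<^sub>k\<close> lie on a parabolic arc slightly above the edge
  \<open>A\<^sub>i B\<^sub>i\<^sub>+\<^sub>1\<close>.

  A projective map sending \<open>v\<close> to infinity turns this into a configuration that depends on one
  parameter \<open>\<kappa>\<close> only; it is the graph of a concave piecewise linear function over the
  bottom triangle.  Hence all facets other than the bottom are nearly parallel to \<open>F\<close>
  when \<open>b - a\<close> is small, and therefore do not cut \<open>P\<close>.  Every number involved is
  a fixed arithmetic expression in the input and in powers of two of linear bit length.
\<close>

subsection \<open>Affine functions and simplicial polytopes\<close>

text \<open>The apex of \<open>V\<close> can lie on either side of the plane of \<open>F\<close>, so
  the skylight can be larger or smaller than the section below it. Homogeneous vectors treat both
  cases at once: positive multiples give a linear form the same sign, so combinatorics and convexity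
  are checked without \<open>a\<close> and \<open>b\<close>, and only the sign \<open>sg\<close>
  remembers the side.

  The position must satisfy competing demands, and one number \<open>R\<close> settles them. It
  bounds the vertex coordinates of \<open>P\<close>, and the suitably scaled slacks of the corners
  of \<open>F \<inter> V\<close> in the other facet inequalities lie between \<open>1 / R\<close>
  and \<open>R\<close>. Then \<open>\<kappa> = 4 * R\<^sup>2\<close> keeps the overshoot of the
  pinwheel, and the distance \<open>1 / (16 * R\<^sup>2)\<close> the departure from the plane of
  \<open>F\<close>, below these slacks; \<open>b - a\<close> is chosen last, small enough against
  that distance for the roof to clear \<open>P\<close>.

  An \<open>R\<close> of linear bit length exists because a nonzero rational with small denominator
  is not close to 0. For real data some \<open>R\<close> exists by finiteness, so one construction
  serves both.\<close>

definition affine_fun :: "('a::euclidean_space \<Rightarrow> real) \<Rightarrow> bool" where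
  "affine_fun f \<longleftrightarrow> (\<exists>u c. \<forall>x. f x = u \<bullet> x + c)"

lemma affine_fun_const [simp, intro]: "affine_fun (\<lambda>x. c)"
  unfolding affine_fun_def by (rule exI[of _ 0]) auto

lemma affine_fun_inner [simp, intro]: "affine_fun (\<lambda>x. u \<bullet> x)"
  unfolding affine_fun_def by (rule exI[of _ u], rule exI[of _ 0]) auto

lemma affine_fun_add [intro]:
  assumes "affine_fun f" "affine_fun g" shows "affine_fun (\<lambda>x. f x + g x)"
proof -
  from assms obtain u c u' c' where "\<And>x. f x = u \<bullet> x + c" "\<And>x. g x = u' \<bullet> x + c'"
    unfolding affine_fun_def by metis
  then have "\<forall>x. f x + g x = (u + u') \<bullet> x + (c + c')"
    by (simp add: inner_add_left)
  then show ?thesis unfolding affine_fun_def by blast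
qed

lemma affine_fun_scale [intro]:
  assumes "affine_fun f" shows "affine_fun (\<lambda>x. r * f x)"
proof -
  from assms obtain u c where "\<And>x. f x = u \<bullet> x + c"
    unfolding affine_fun_def by metis
  then have "\<forall>x. r * f x = (r *\<^sub>R u) \<bullet> x + r * c"
    by (simp add: distrib_left)
  then show ?thesis unfolding affine_fun_def by blast
qed

lemma affine_fun_diff [intro]:
  assumes "affine_fun f" "affine_fun g" shows "affine_fun (\<lambda>x. f x - g x)"
  using affine_fun_add[OF assms(1) affine_fun_scale[OF assms(2), of "-1"]] by simp

lemma affine_fun_sum:
  assumes "affine_fun f" "sum r S = 1"
  shows "f (\<Sum>i\<in>S. r i *\<^sub>R y i) = (\<Sum>i\<in>S. r i * f (y i))"
proof -
  from assms obtain u c where f: "\<And>x. f x = u \<bullet> x + c"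
    unfolding affine_fun_def by metis
  show ?thesis
    by (simp add: f inner_sum_right distrib_left sum.distrib assms(2) flip: sum_distrib_right)
qed

lemma affine_fun_comb:
  assumes "affine_fun f" "r + s = 1"
  shows "f (r *\<^sub>R x + s *\<^sub>R y) = r * f x + s * f y"
proof -
  from assms obtain u c where f: "\<And>x. f x = u \<bullet> x + c"
    unfolding affine_fun_def by metis
  have "c = (r + s) * c" using assms(2) by simp
  then show ?thesis by (simp add: f inner_add_right algebra_simps)
qed

lemma affine_fun_continuous_on: "affine_fun f \<Longrightarrow> continuous_on S f"
proof -
  assume "affine_fun f"
  then obtain u c where "\<And>x. f x = u \<bullet> x + c" unfolding affine_fun_def by metis
  then have "f = (\<lambda>x. u \<bullet> x + c)" by auto
  then show ?thesis by (auto intro!: continuous_intros)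
qed

lemma open_affine_fun_pos: "affine_fun f \<Longrightarrow> open {x. f x > 0}"
  using open_Collect_less[OF continuous_on_const affine_fun_continuous_on] by blast

lemma affine_fun_hull_Collect:
  fixes I :: "real set"
  assumes "affine_fun f" "convex I" "\<And>w. w \<in> W \<Longrightarrow> f w \<in> I" "x \<in> convex hull W"
  shows "f x \<in> I"
proof -
  have "convex {x. f x \<in> I}"
    unfolding convex_def using assms(2)
    by (auto simp: affine_fun_comb[OF assms(1)] convex_def)
  then have "convex hull W \<subseteq> {x. f x \<in> I}"
    using assms(3) by (intro hull_minimal) auto
  then show ?thesis using assms(4) by auto
qed

lemma affine_fun_nonneg_hull:
  "\<lbrakk>affine_fun f; \<And>w. w \<in> W \<Longrightarrow> f w \<ge> 0; x \<in> convex hull W\<rbrakk> \<Longrightarrow> f x \<ge> 0"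
  using affine_fun_hull_Collect[of f "{0..}" W x] by auto

lemma affine_fun_pos_hull:
  "\<lbrakk>affine_fun f; \<And>w. w \<in> W \<Longrightarrow> f w > 0; x \<in> convex hull W\<rbrakk> \<Longrightarrow> f x > 0"
  using affine_fun_hull_Collect[of f "{0<..}" W x] by auto

lemma affine_fun_zero_affine_hull:
  assumes "affine_fun f" "\<And>w. w \<in> W \<Longrightarrow> f w = 0" "x \<in> affine hull W"
  shows "f x = 0"
proof -
  have "affine {x. f x = 0}"
    unfolding affine_def by (auto simp: affine_fun_comb[OF assms(1)])
  then have "affine hull W \<subseteq> {x. f x = 0}"
    using assms(2) by (intro hull_minimal) auto
  then show ?thesis using assms(3) by auto
qed

lemma zero_face_of:
  assumes "affine_fun f" "\<And>w. w \<in> W \<Longrightarrow> f w \<ge> 0"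
  shows "(convex hull W \<inter> {x. f x = 0}) face_of (convex hull W)"
proof -
  obtain u c where f: "\<And>x. f x = u \<bullet> x + c" using assms(1) unfolding affine_fun_def by metis
  have "{x. f x = 0} = {x. u \<bullet> x = - c}" using f by (auto simp: algebra_simps)
  moreover have "u \<bullet> x \<ge> - c" if "x \<in> convex hull W" for x
    using affine_fun_nonneg_hull[OF assms that] f[of x] by simp
  ultimately show ?thesis
    by (simp only: face_of_Int_supporting_hyperplane_ge[OF convex_convex_hull])
qed

text \<open>A face of the hull of a finite set is the hull of some of its points, and these points
  must be zeros of \<open>f\<close>.\<close>

lemma zero_face_eq:
  assumes "affine_fun f" "finite W" "\<And>w. w \<in> W \<Longrightarrow> f w \<ge> 0"
  shows "convex hull W \<inter> {x. f x = 0} = convex hull {w \<in> W. f w = 0}"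
proof
  have "(convex hull W \<inter> {x. f x = 0}) face_of (convex hull W)"
    using zero_face_of assms by blast
  then obtain S where S: "S \<subseteq> W" "convex hull W \<inter> {x. f x = 0} = convex hull S"
    using face_of_convex_hull_subset[OF finite_imp_compact[OF assms(2)]] by metis
  then have "S \<subseteq> {w \<in> W. f w = 0}"
    using hull_subset[of S convex] by auto
  then show "convex hull W \<inter> {x. f x = 0} \<subseteq> convex hull {w \<in> W. f w = 0}"
    using S by (simp add: hull_mono)
next
  have "f x = 0" if "x \<in> convex hull {w \<in> W. f w = 0}" for x
    using affine_fun_hull_Collect[OF assms(1), of "{0}" "{w \<in> W. f w = 0}" x] that by auto
  moreover have "convex hull {w \<in> W. f w = 0} \<subseteq> convex hull W" by (rule hull_mono) auto
  ultimately show "convex hull {w \<in> W. f w = 0} \<subseteq> convex hull W \<inter> {x. f x = 0}" by auto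
qed

text \<open>The plane \<open>f = 0\<close> weakly separates \<open>S\<close> from \<open>T\<close>,
  so a common point lies in the face of \<open>convex hull S\<close> on it. That face is spanned by
  the zeros of \<open>f\<close> in \<open>S\<close>, all of which belong to \<open>T\<close>. One
  such plane therefore settles how two triangles of a surface meet.\<close>

lemma hull_Int_separated:
  assumes "affine_fun f" "finite S" "\<And>x. x \<in> S \<Longrightarrow> f x \<ge> 0" "\<And>x. x \<in> T \<Longrightarrow> f x \<le> 0"
    "\<And>x. x \<in> S \<Longrightarrow> f x = 0 \<Longrightarrow> x \<in> T"
  shows "convex hull S \<inter> convex hull T = convex hull (S \<inter> T)"
proof
  show "convex hull (S \<inter> T) \<subseteq> convex hull S \<inter> convex hull T"
    by (simp add: hull_mono)
  show "convex hull S \<inter> convex hull T \<subseteq> convex hull (S \<inter> T)"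
  proof
    fix x assume x: "x \<in> convex hull S \<inter> convex hull T"
    then have "f x \<ge> 0" using affine_fun_nonneg_hull[OF assms(1,3)] by blast
    moreover have "f x \<le> 0"
      using affine_fun_hull_Collect[OF assms(1), of "{..0}" T x] assms(4) x by auto
    ultimately have "x \<in> convex hull {w \<in> S. f w = 0}"
      using zero_face_eq[OF assms(1,2,3)] x by auto
    moreover have "{w \<in> S. f w = 0} \<subseteq> S \<inter> T" using assms(5) by auto
    ultimately show "x \<in> convex hull (S \<inter> T)" using hull_mono by blast
  qed
qed

text \<open>The values of \<open>f\<close> and \<open>g\<close> at the three points form a
  triangular pattern with nonzero diagonal, which certifies independence without computing in
  coordinates.\<close>

lemma not_affine_dependent_triangular:
  assumes "affine_fun f" "affine_fun g"
    "f x \<noteq> 0" "f y = 0" "f z = 0" "g y \<noteq> 0" "g z = 0"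
  shows "\<not> affine_dependent {x, y, z}" "card {x, y, z} = 3"
proof -
  have ne: "x \<noteq> y" "x \<noteq> z" "y \<noteq> z" using assms by auto
  then show "card {x, y, z} = 3" by auto
  have y: "\<not> affine_dependent {y, z}" by (rule affine_independent_2)
  have "x \<notin> affine hull {y, z}"
    using affine_fun_zero_affine_hull[OF assms(1), of "{y,z}" x] assms by auto
  then show "\<not> affine_dependent {x, y, z}"
    using affine_independent_insert[OF y] by simp
qed

lemma affine_fun_eq_0_if_spanning:
  assumes "affine_fun f" "affine hull W = UNIV" "\<And>w. w \<in> W \<Longrightarrow> f w = 0"
  shows "f x = 0"
  using affine_fun_zero_affine_hull[OF assms(1,3)] assms(2) by auto

lemma triple_and_point_span:
  fixes T :: "point set"
  assumes "\<not> affine_dependent T" "card T = 3" "affine_fun f" "\<And>t. t \<in> T \<Longrightarrow> f t = 0" "f w \<noteq> 0"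
  shows "aff_dim (insert w T) = 3" "affine hull (insert w T) = UNIV"
proof -
  have "w \<notin> affine hull T" using affine_fun_zero_affine_hull[OF assms(3,4)] assms(5) by auto
  moreover have "aff_dim T = 2" using aff_dim_affine_independent[OF assms(1)] assms(2) by simp
  ultimately show "aff_dim (insert w T) = 3" by (simp add: aff_dim_insert)
  then show "affine hull (insert w T) = UNIV" using aff_dim_eq_full[of "insert w T"] by simp
qed

section \<open>Simplicial polytopes recognised from their facet inequalities\<close>

locale simplicial_description =
  fixes W :: "point set" and f :: "'g \<Rightarrow> point \<Rightarrow> real" and T :: "'g \<Rightarrow> point set" and J :: "'g set"
  assumes finite_W: "finite W" and finite_J: "finite J" and J_nonempty: "J \<noteq> {}"
    and affine_f: "\<And>g. g \<in> J \<Longrightarrow> affine_fun (f g)"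
    and T_subset: "\<And>g. g \<in> J \<Longrightarrow> T g \<subseteq> W"
    and T_card: "\<And>g. g \<in> J \<Longrightarrow> card (T g) = 3"
    and T_indep: "\<And>g. g \<in> J \<Longrightarrow> \<not> affine_dependent (T g)"
    and f_nonneg: "\<And>g w. g \<in> J \<Longrightarrow> w \<in> W \<Longrightarrow> f g w \<ge> 0"
    and f_zero_iff: "\<And>g w. g \<in> J \<Longrightarrow> w \<in> W \<Longrightarrow> f g w = 0 \<longleftrightarrow> w \<in> T g"
    and W_not_T: "\<And>g. g \<in> J \<Longrightarrow> \<not> W \<subseteq> T g"
    and complete: "\<And>x. (\<And>g. g \<in> J \<Longrightarrow> f g x \<ge> 0) \<Longrightarrow> x \<in> convex hull W"
    and W_covered: "W \<subseteq> (\<Union>g\<in>J. T g)"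
begin

lemma face_eq: "g \<in> J \<Longrightarrow> convex hull W \<inter> {x. f g x = 0} = convex hull (T g)"
proof -
  assume g: "g \<in> J"
  have "{w \<in> W. f g w = 0} = T g" using f_zero_iff[OF g] T_subset[OF g] by auto
  then show ?thesis using zero_face_eq[OF affine_f[OF g] finite_W f_nonneg[OF g]] by simp
qed

lemma off_facet:
  assumes "g \<in> J" obtains w where "w \<in> W" "f g w > 0"
proof -
  obtain w where "w \<in> W" "w \<notin> T g" using W_not_T[OF assms] by auto
  then show ?thesis using that f_nonneg[OF assms, of w] f_zero_iff[OF assms, of w] by fastforce
qed

lemma aff_dim_hull: "aff_dim (convex hull W) = 3"
proof -
  obtain g where g: "g \<in> J" using J_nonempty by auto
  obtain w where w: "w \<in> W" "f g w > 0" using off_facet[OF g] .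
  have z: "f g t = 0" if "t \<in> T g" for t using f_zero_iff[OF g] T_subset[OF g] that by auto
  have "aff_dim (insert w (T g)) = 3"
    by (rule triple_and_point_span(1)[OF T_indep[OF g] T_card[OF g] affine_f[OF g]])
      (use z w in auto)
  moreover have "aff_dim (insert w (T g)) \<le> aff_dim W"
    using w T_subset[OF g] by (intro aff_dim_subset) auto
  ultimately have "aff_dim W \<ge> 3" by simp
  then show ?thesis using aff_dim_le_DIM[of W] by (simp add: aff_dim_convex_hull)
qed

lemma three_polytope_hull: "three_polytope (convex hull W)"
  unfolding three_polytope_def polytope_def using aff_dim_hull finite_W by auto

lemma aff_dim_T: "g \<in> J \<Longrightarrow> aff_dim (convex hull (T g)) = 2"
  using aff_dim_affine_independent[OF T_indep[of g]] T_card[of g] by (simp add: aff_dim_convex_hull)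

lemma T_face: "g \<in> J \<Longrightarrow> convex hull (T g) face_of (convex hull W)"
  using zero_face_of[of "f g" W] affine_f[of g] f_nonneg[of g] face_eq[of g] by auto

lemma T_facet: "g \<in> J \<Longrightarrow> convex hull (T g) facet_of (convex hull W)"
  unfolding facet_of_def using T_face[of g] aff_dim_T[of g] aff_dim_hull by force

text \<open>If all \<open>f g\<close> were positive at a relative interior point of a facet,
  \<open>complete\<close> would make the point interior to the hull, which a proper face excludes.
  So some \<open>f g\<close> vanishes there, the whole facet lies in the triangle of
  \<open>g\<close>, and equal dimensions force equality.\<close>

lemma facets: "{G. G facet_of (convex hull W)} = (\<lambda>g. convex hull (T g)) ` J"
proof (intro equalityI subsetI)
  fix G assume "G \<in> (\<lambda>g. convex hull (T g)) ` J"
  then show "G \<in> {G. G facet_of (convex hull W)}" using T_facet by auto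
next
  fix G assume "G \<in> {G. G facet_of (convex hull W)}"
  then have G: "G face_of (convex hull W)" "G \<noteq> {}" "aff_dim G = 2"
    using aff_dim_hull by (auto simp: facet_of_def)
  have Gc: "convex G" using face_of_imp_convex[OF G(1)] .
  obtain x where x: "x \<in> rel_interior G" using Gc G(2) rel_interior_eq_empty by blast
  then have xG: "x \<in> G" using rel_interior_subset by auto
  then have xW: "x \<in> convex hull W" using face_of_imp_subset[OF G(1)] by auto
  have "\<exists>g\<in>J. f g x = 0"
  proof (rule ccontr)
    assume "\<not> (\<exists>g\<in>J. f g x = 0)"
    then have pos: "f g x > 0" if "g \<in> J" for g
      using affine_fun_nonneg_hull[OF affine_f[OF that] f_nonneg[OF that] xW] that by fastforce
    have "open (\<Inter>g\<in>J. {x. f g x > 0})"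
      using finite_J affine_f by (intro open_INT) (auto intro: open_affine_fun_pos)
    moreover have "(\<Inter>g\<in>J. {x. f g x > 0}) \<subseteq> convex hull W"
      using complete by (auto simp: less_imp_le)
    moreover have "x \<in> (\<Inter>g\<in>J. {x. f g x > 0})" using pos by auto
    ultimately have "x \<in> interior (convex hull W)" by (meson interiorI)
    moreover have "G \<noteq> convex hull W" using G(3) aff_dim_hull by auto
    ultimately show False using face_of_disjoint_interior[OF G(1)] xG by auto
  qed
  then obtain g where g: "g \<in> J" "f g x = 0" by auto
  have "x \<in> convex hull (T g)" using face_eq[OF g(1)] g(2) xW by auto
  then have sub: "G \<subseteq> convex hull (T g)"
    using subset_of_face_of[OF T_face[OF g(1)] face_of_imp_subset[OF G(1)]] x
    by (auto simp: disjnt_def)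
  then have "G face_of (convex hull (T g))"
    using G(1) T_face[OF g(1)] face_of_face by (metis inf.absorb_iff2 face_of_subset face_of_imp_subset)
  then have "G = convex hull (T g)"
    using face_of_aff_dim_lt[of "convex hull (T g)" G] aff_dim_T[OF g(1)] G(3) by fastforce
  then show "G \<in> (\<lambda>g. convex hull (T g)) ` J" using g by auto
qed

text \<open>Every point of \<open>W\<close> is a corner of some triangle, and extreme points of a
  face are extreme in the whole.\<close>

lemma vertices_hull: "vertices (convex hull W) = W"
proof
  show "vertices (convex hull W) \<subseteq> W"
    unfolding vertices_def by (auto dest: extreme_point_of_convex_hull)
  show "W \<subseteq> vertices (convex hull W)"
  proof
    fix w assume "w \<in> W"
    then obtain g where g: "g \<in> J" "w \<in> T g" using W_covered by auto
    then have "w extreme_point_of (convex hull (T g))"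
      using extreme_point_of_convex_hull_affine_independent[OF T_indep] by auto
    then show "w \<in> vertices (convex hull W)"
      using extreme_point_of_face[OF T_face[OF g(1)]] unfolding vertices_def by auto
  qed
qed

text \<open>\<open>point_beyond\<close> quantifies over all inequalities that define a facet, so
  these have to be known up to a positive factor.\<close>

lemma facet_inequality_positive_multiple:
  assumes "facet_inequality (convex hull W) G c e"
  obtains g l where "g \<in> J" "G = convex hull (T g)" "l > 0" "\<forall>x. e - c \<bullet> x = l * f g x"
proof -
  have *: "G facet_of (convex hull W)" "convex hull W \<subseteq> {x. c \<bullet> x \<le> e}"
    "G = convex hull W \<inter> {x. c \<bullet> x = e}"
    using assms unfolding facet_inequality_def by auto
  obtain g where g: "g \<in> J" "G = convex hull (T g)" using facets *(1) by blast
  obtain w where w: "w \<in> W" "f g w > 0" using off_facet[OF g(1)] .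
  define h where "h x = e - c \<bullet> x" for x
  have h: "affine_fun h" unfolding h_def by (intro affine_fun_diff affine_fun_const affine_fun_inner)
  have z: "f g t = 0" if "t \<in> T g" for t using f_zero_iff[OF g(1)] T_subset[OF g(1)] that by auto
  have hz: "h t = 0" if "t \<in> T g" for t
    using hull_inc[OF that, of convex] g(2) *(3) unfolding h_def by auto
  have wW: "w \<in> convex hull W" using w(1) by (simp add: hull_inc)
  have "w \<notin> G" unfolding g(2) face_eq[OF g(1), symmetric] using w(2) by auto
  then have "c \<bullet> w \<noteq> e" "c \<bullet> w \<le> e" using *(2,3) wW by auto
  then have hw: "h w > 0" unfolding h_def by simp
  have sp: "affine hull (insert w (T g)) = UNIV"
    by (rule triple_and_point_span(2)[OF T_indep[OF g(1)] T_card[OF g(1)] affine_f[OF g(1)]])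
      (use z w in auto)
  \<comment> \<open>This combination vanishes on \<open>T g\<close> and at \<open>w\<close>, four
    points that affinely span the space.\<close>
  have "f g w * h x - h w * f g x = 0" for x
    by (rule affine_fun_eq_0_if_spanning[OF _ sp])
      (auto simp: z hz intro!: affine_fun_diff affine_fun_scale h affine_f[OF g(1)])
  then have "h x = (h w / f g w) * f g x" for x using w(2) by (simp add: field_simps)
  then have "\<forall>x. e - c \<bullet> x = (h w / f g w) * f g x" unfolding h_def by blast
  moreover have "h w / f g w > 0" using hw w(2) by simp
  ultimately show ?thesis using that[OF g] by blast
qed

end

subsection \<open>Sides of planes and dihedral angles\<close>

text \<open>Both gradients are orthogonal to \<open>b - a\<close> and \<open>c - a\<close>, hence
  parallel. The form without division also covers collinear \<open>a\<close>, \<open>b\<close>,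
  \<open>c\<close>, where \<open>plane_side\<close> is identically zero.\<close>

lemma plane_side_proportional:
  assumes "affine_fun f" "f a = 0" "f b = 0" "f c = 0"
  shows "plane_side a b c x * f y = plane_side a b c y * f x"
proof -
  obtain u e where f: "\<And>x. f x = u \<bullet> x + e" using assms(1) unfolding affine_fun_def by metis
  have d: "f z = u \<bullet> (z - a)" for z using assms(2) f by (simp add: inner_diff_right)
  define n where "n = cross3 (b - a) (c - a)"
  have o: "u \<bullet> (b - a) = 0" "u \<bullet> (c - a) = 0" using assms d by auto
  have "cross3 u n = (u \<bullet> (c - a)) *\<^sub>R (b - a) - (u \<bullet> (b - a)) *\<^sub>R (c - a)"
    unfolding n_def by (rule Lagrange)
  then have "cross3 u n = 0" using o by simp
  then have "(u \<bullet> (x - a)) * (n \<bullet> (y - a)) - (u \<bullet> (y - a)) * (n \<bullet> (x - a)) = 0"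
    using dot_cross[of u n "x - a" "y - a"] by simp
  then show ?thesis unfolding plane_side_def d n_def[symmetric] by (simp add: algebra_simps)
qed

text \<open>The functions \<open>g\<close> and \<open>h\<close> certify that \<open>a\<close>,
  \<open>b\<close>, \<open>c\<close> are not collinear, and \<open>f\<close> that \<open>x\<close>
  is off their plane.\<close>

lemma plane_side_nonzero:
  assumes "affine_fun g" "affine_fun h" "g a = 0" "g b \<noteq> 0" "h a = 0" "h b = 0" "h c \<noteq> 0"
    "affine_fun f" "f a = 0" "f b = 0" "f c = 0" "f x \<noteq> 0"
  shows "plane_side a b c x \<noteq> 0"
proof
  assume "plane_side a b c x = 0"
  then have z: "plane_side a b c y = 0" for y
    using plane_side_proportional[OF assms(8-11), of x y] assms(12) by simp
  then have "cross3 (b - a) (c - a) \<bullet> cross3 (b - a) (c - a) = 0"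
    using z[of "a + cross3 (b - a) (c - a)"] by (simp add: plane_side_def)
  then have "cross3 (b - a) (c - a) = 0" by simp
  then have "collinear {0, b - a, c - a}" by (simp add: cross_eq_0)
  moreover have "c \<noteq> a" using assms by auto
  ultimately obtain k where "c - a = k *\<^sub>R (b - a) \<or> b = a"
    unfolding collinear_lemma by auto
  moreover have "b \<noteq> a" using assms by auto
  ultimately have "c = (1 - k) *\<^sub>R a + k *\<^sub>R b" by (simp add: algebra_simps)
  then have "h c = (1 - k) * h a + k * h b" using affine_fun_comb[OF assms(2)] by auto
  then show False using assms by simp
qed

lemma orth_part_eq: "\<exists>r. orth_part e y = y - r *\<^sub>R e"
  unfolding orth_part_def by blast

text \<open>\<open>d\<close> stands for the bisector of two half-planes on which \<open>f\<close>
  and \<open>g\<close> vanish. Its exact form never matters: it suffices that along \<open>d\<close>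
  each function moves towards the sign it has on the other half-plane, and \<open>r\<close> and
  \<open>s\<close> absorb the normalisation.\<close>

definition dihedral_direction :: "(point \<Rightarrow> real) \<Rightarrow> (point \<Rightarrow> real) \<Rightarrow> point \<Rightarrow> point \<Rightarrow> point \<Rightarrow> bool" where
  "dihedral_direction f g w x d \<longleftrightarrow> (\<exists>r>0. \<exists>s>0.
     (\<forall>y t. f (y + t *\<^sub>R d) = f y + t * (r * f x)) \<and>
     (\<forall>y t. g (y + t *\<^sub>R d) = g y + t * (s * g w)))"

context
  fixes f g :: "point \<Rightarrow> real" and u v w x :: point
  assumes f: "affine_fun f" "f u = 0" "f v = 0" "f w = 0" "f x \<noteq> 0"
    and g: "affine_fun g" "g u = 0" "g v = 0" "g x = 0" "g w \<noteq> 0"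
begin

text \<open>An angle of \<open>pi\<close> would make the unit vectors along \<open>p\<close> and
  \<open>q\<close> opposite and the bisector zero, but \<open>f\<close> is not constant along the
  bisector.\<close>

lemma dihedral_aux:
  defines "p \<equiv> orth_part (v - u) (w - u)" and "q \<equiv> orth_part (v - u) (x - u)"
  shows "dihedral_direction f g w x (p /\<^sub>R norm p + q /\<^sub>R norm q)"
    and "arccos ((p \<bullet> q) / (norm p * norm q)) < pi"
proof -
  obtain r where p: "p = (w - u) - r *\<^sub>R (v - u)" using orth_part_eq p_def by blast
  obtain r' where q: "q = (x - u) - r' *\<^sub>R (v - u)" using orth_part_eq q_def by blast
  obtain cf ef where cf: "\<And>z. f z = cf \<bullet> z + ef" using f(1) unfolding affine_fun_def by metis
  obtain cg eg where cg: "\<And>z. g z = cg \<bullet> z + eg" using g(1) unfolding affine_fun_def by metis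
  have fp: "cf \<bullet> p = 0" "cf \<bullet> q = f x"
  proof -
    have "cf \<bullet> u = - ef" "cf \<bullet> v = - ef" "cf \<bullet> w = - ef" using f(2,3,4) cf[of u] cf[of v] cf[of w] by linarith+
    then show "cf \<bullet> p = 0" "cf \<bullet> q = f x" unfolding p q cf[of x] by (simp_all add: inner_diff_right)
  qed
  have gp: "cg \<bullet> p = g w" "cg \<bullet> q = 0"
  proof -
    have "cg \<bullet> u = - eg" "cg \<bullet> v = - eg" "cg \<bullet> x = - eg" using g(2,3,4) cg[of u] cg[of v] cg[of x] by linarith+
    then show "cg \<bullet> p = g w" "cg \<bullet> q = 0" unfolding p q cg[of w] by (simp_all add: inner_diff_right)
  qed
  have pq: "norm p > 0" "norm q > 0" using fp gp f(5) g(5) by auto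
  define d where "d = p /\<^sub>R norm p + q /\<^sub>R norm q"
  have fd: "cf \<bullet> d = inverse (norm q) * f x" and gd: "cg \<bullet> d = inverse (norm p) * g w"
    unfolding d_def using fp gp by (simp_all add: inner_add_right)
  show "dihedral_direction f g w x d"
    unfolding dihedral_direction_def
  proof (intro exI conjI allI)
    show "inverse (norm q) > 0" "inverse (norm p) > 0" using pq by auto
    show "f (y + t *\<^sub>R d) = f y + t * (inverse (norm q) * f x)" for y t
      unfolding cf[of "y + t *\<^sub>R d"] cf[of y] inner_add_right inner_scaleR_right fd by simp
    show "g (y + t *\<^sub>R d) = g y + t * (inverse (norm p) * g w)" for y t
      unfolding cg[of "y + t *\<^sub>R d"] cg[of y] inner_add_right inner_scaleR_right gd by simp
  qed
  have "d \<noteq> 0" using fd f(5) pq by auto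
  have "p \<bullet> q \<noteq> - (norm p * norm q)"
  proof
    assume "p \<bullet> q = - (norm p * norm q)"
    then have "(p /\<^sub>R norm p) \<bullet> (q /\<^sub>R norm q) = - 1" using pq by (simp add: field_simps)
    then have "(q /\<^sub>R norm q) \<bullet> (p /\<^sub>R norm p) = - 1" "(p /\<^sub>R norm p) \<bullet> (q /\<^sub>R norm q) = - 1"
      by (simp_all only: inner_commute)
    moreover have "(p /\<^sub>R norm p) \<bullet> (p /\<^sub>R norm p) = 1" "(q /\<^sub>R norm q) \<bullet> (q /\<^sub>R norm q) = 1"
      using pq by (simp_all add: dot_square_norm power2_eq_square)
    ultimately have "d \<bullet> d = 0"
      unfolding d_def inner_add_left inner_add_right by linarith
    then show False using \<open>d \<noteq> 0\<close> by simp
  qed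
  moreover have "\<bar>p \<bullet> q\<bar> \<le> norm p * norm q" by (rule Cauchy_Schwarz_ineq2)
  ultimately have "p \<bullet> q > - (norm p * norm q)" "p \<bullet> q \<le> norm p * norm q" by auto
  then have "- 1 < (p \<bullet> q) / (norm p * norm q)" "(p \<bullet> q) / (norm p * norm q) \<le> 1"
    using pq by (auto simp: field_simps)
  then have "arccos ((p \<bullet> q) / (norm p * norm q)) < arccos (- 1)"
    by (intro arccos_less_arccos) auto
  then show "arccos ((p \<bullet> q) / (norm p * norm q)) < pi" by simp
qed

lemma interior_dihedral_angle_less_pi:
  assumes "\<And>d. dihedral_direction f g w x d \<Longrightarrow> \<forall>\<^sub>F t in at_right 0. midpoint u v + t *\<^sub>R d \<in> Q"
  shows "interior_dihedral_angle Q u v w x < pi"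
  unfolding interior_dihedral_angle_def Let_def using dihedral_aux(2)
  unfolding if_P[OF assms[OF dihedral_aux(1)]] .

text \<open>A direction that eventually avoids \<open>Q\<close> cannot eventually stay in it, so the
  definition takes its second branch, \<open>2 * pi\<close> minus an angle below
  \<open>pi\<close>.\<close>

lemma interior_dihedral_angle_greater_pi:
  assumes "\<And>d. dihedral_direction f g w x d \<Longrightarrow> \<forall>\<^sub>F t in at_right 0. midpoint u v + t *\<^sub>R d \<notin> Q"
  shows "interior_dihedral_angle Q u v w x > pi"
proof -
  let ?d = "orth_part (v - u) (w - u) /\<^sub>R norm (orth_part (v - u) (w - u)) +
    orth_part (v - u) (x - u) /\<^sub>R norm (orth_part (v - u) (x - u))"
  have "\<not> (\<forall>\<^sub>F t in at_right 0. midpoint u v + t *\<^sub>R ?d \<in> Q)"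
  proof
    assume "\<forall>\<^sub>F t in at_right 0. midpoint u v + t *\<^sub>R ?d \<in> Q"
    with assms[OF dihedral_aux(1)] have "\<forall>\<^sub>F t in at_right (0::real). False"
      by eventually_elim simp
    then show False by simp
  qed
  then show ?thesis
    unfolding interior_dihedral_angle_def Let_def using dihedral_aux(2) by simp
qed

end

lemma eventually_affine_fun_pos:
  assumes "affine_fun h" "h y > 0"
  shows "\<forall>\<^sub>F t in at_right 0. h (y + t *\<^sub>R d) > 0"
proof -
  obtain c e where h: "\<And>z. h z = c \<bullet> z + e" using assms(1) unfolding affine_fun_def by metis
  have "((\<lambda>t. h (y + t *\<^sub>R d)) \<longlongrightarrow> h (y + 0 *\<^sub>R d)) (at_right 0)"
    unfolding h by (intro tendsto_intros)
  from order_tendstoD(1)[OF this, of 0] show ?thesis using assms(2) by simp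
qed

subsection \<open>Rational numbers of bounded size\<close>

text \<open>The fraction need not be reduced, so the bounds propagate through plain integer
  arithmetic; reduction enters only in the comparison with \<open>real_length\<close>.\<close>

definition bounded_rat :: "nat \<Rightarrow> real \<Rightarrow> bool" where
  "bounded_rat n x \<longleftrightarrow> (\<exists>p q :: int. x = of_int p / of_int q \<and> \<bar>p\<bar> \<le> 2 ^ n \<and> 0 < q \<and> q \<le> 2 ^ n)"

lemma bounded_rat_mono: "bounded_rat n x \<Longrightarrow> n \<le> m \<Longrightarrow> bounded_rat m x"
proof -
  assume "bounded_rat n x" "n \<le> m"
  then obtain p q :: int where "x = of_int p / of_int q" "\<bar>p\<bar> \<le> 2 ^ n" "0 < q" "q \<le> 2 ^ n"
    unfolding bounded_rat_def by blast
  moreover have "(2 :: int) ^ n \<le> 2 ^ m" using \<open>n \<le> m\<close> by (intro power_increasing) auto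
  ultimately have "x = of_int p / of_int q \<and> \<bar>p\<bar> \<le> 2 ^ m \<and> 0 < q \<and> q \<le> 2 ^ m" by linarith
  then show ?thesis unfolding bounded_rat_def by blast
qed

lemma bounded_rat_minus: "bounded_rat n x \<Longrightarrow> bounded_rat n (- x)"
  unfolding bounded_rat_def by (metis abs_minus_cancel minus_divide_left of_int_minus)

lemma bounded_rat_mult:
  assumes "bounded_rat n x" "bounded_rat m y" shows "bounded_rat (n + m) (x * y)"
proof -
  obtain p q where 1: "x = of_int p / of_int q" "\<bar>p\<bar> \<le> 2 ^ n" "0 < q" "q \<le> 2 ^ n"
    using assms(1) unfolding bounded_rat_def by blast
  obtain p' q' where 2: "y = of_int p' / of_int q'" "\<bar>p'\<bar> \<le> 2 ^ m" "0 < q'" "q' \<le> 2 ^ m"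
    using assms(2) unfolding bounded_rat_def by blast
  have "x * y = of_int (p * p') / of_int (q * q')" using 1 2 by simp
  moreover have "\<bar>p * p'\<bar> \<le> 2 ^ (n + m)" unfolding abs_mult power_add using 1 2 by (intro mult_mono) auto
  moreover have "0 < q * q'" using 1 2 by simp
  moreover have "q * q' \<le> 2 ^ (n + m)" unfolding power_add using 1 2 by (intro mult_mono) auto
  ultimately show ?thesis unfolding bounded_rat_def by blast
qed

lemma bounded_rat_add:
  assumes "bounded_rat n x" "bounded_rat m y" shows "bounded_rat (n + m + 1) (x + y)"
proof -
  obtain p q where 1: "x = of_int p / of_int q" "\<bar>p\<bar> \<le> 2 ^ n" "0 < q" "q \<le> 2 ^ n"
    using assms(1) unfolding bounded_rat_def by blast
  obtain p' q' where 2: "y = of_int p' / of_int q'" "\<bar>p'\<bar> \<le> 2 ^ m" "0 < q'" "q' \<le> 2 ^ m"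
    using assms(2) unfolding bounded_rat_def by blast
  have "x + y = of_int (p * q' + p' * q) / of_int (q * q')" using 1 2 by (simp add: field_simps)
  moreover have "\<bar>p * q'\<bar> \<le> 2 ^ n * 2 ^ m" unfolding abs_mult using 1 2 by (intro mult_mono) auto
  moreover have "\<bar>p' * q\<bar> \<le> 2 ^ m * 2 ^ n" unfolding abs_mult using 1 2 by (intro mult_mono) auto
  ultimately have "\<bar>p * q' + p' * q\<bar> \<le> 2 ^ (n + m + 1)" by (simp add: power_add mult.commute)
  moreover have "0 < q * q'" using 1 2 by simp
  moreover have "q * q' \<le> 2 ^ n * 2 ^ m" using 1 2 by (intro mult_mono) auto
  then have "q * q' \<le> 2 ^ (n + m + 1)" by (simp add: power_add) (smt (verit) zero_less_power mult_pos_pos)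
  ultimately show ?thesis using \<open>x + y = _\<close> unfolding bounded_rat_def by blast
qed

lemma bounded_rat_inverse:
  assumes "bounded_rat n x" shows "bounded_rat n (inverse x)"
proof -
  obtain p q where 1: "x = of_int p / of_int q" "\<bar>p\<bar> \<le> 2 ^ n" "0 < q" "q \<le> 2 ^ n"
    using assms(1) unfolding bounded_rat_def by blast
  show ?thesis
  proof (cases "p = 0")
    case True
    \<comment> \<open>As \<open>inverse 0 = 0\<close>, the witness is 0 / 1.\<close>
    then show ?thesis using 1 unfolding bounded_rat_def by (intro exI[of _ 0] exI[of _ 1]) auto
  next
    case False
    then have "inverse x = of_int (sgn p * q) / of_int \<bar>p\<bar>"
      unfolding 1 by (cases "p > 0") (auto simp: sgn_if field_simps)
    moreover have "\<bar>sgn p * q\<bar> \<le> 2 ^ n" using 1 False by (simp add: abs_mult abs_sgn_eq)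
    ultimately show ?thesis using 1 False unfolding bounded_rat_def by (intro exI[of _ "sgn p * q"] exI[of _ "\<bar>p\<bar>"]) auto
  qed
qed

lemma bounded_rat_abs_le: "bounded_rat n x \<Longrightarrow> \<bar>x\<bar> \<le> 2 ^ n"
proof -
  assume "bounded_rat n x"
  then obtain p q :: int where 1: "x = of_int p / of_int q" "\<bar>p\<bar> \<le> 2 ^ n" "0 < q"
    unfolding bounded_rat_def by blast
  have "\<bar>x\<bar> = of_int \<bar>p\<bar> / of_int q" unfolding 1 using 1(3) by simp
  also have "\<dots> \<le> of_int \<bar>p\<bar> / 1" using 1 by (intro divide_left_mono) auto
  also have "\<dots> \<le> 2 ^ n" using 1(2) by (metis div_by_1 of_int_le_iff of_int_numeral of_int_power)
  finally show ?thesis .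
qed

text \<open>This converts bit lengths into lower bounds: the inverse of a nonzero bounded rational
  is bounded as well.\<close>

lemma bounded_rat_abs_ge: "bounded_rat n x \<Longrightarrow> x \<noteq> 0 \<Longrightarrow> 1 / 2 ^ n \<le> \<bar>x\<bar>"
  using bounded_rat_abs_le[OF bounded_rat_inverse, of n x] by (simp add: field_simps)

text \<open>The reduced numerator and denominator divide the given ones, so they are no larger. Each
  has at most \<open>n + 1\<close> binary digits and a sign bit, which gives twice
  \<open>n + 2\<close>.\<close>

lemma bounded_rat_real_length:
  assumes "bounded_rat n x" shows "x \<in> \<rat>" "real_length x \<le> 2 * n + 4"
proof -
  obtain p q :: int where 1: "x = of_int p / of_int q" "\<bar>p\<bar> \<le> 2 ^ n" "0 < q" "q \<le> 2 ^ n"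
    using assms(1) unfolding bounded_rat_def by blast
  define r where "r = Rat.Fract p q"
  have x: "x = of_rat r" unfolding r_def 1 using 1(3) by (simp add: of_rat_rat)
  then show "x \<in> \<rat>" by simp
  obtain p' q' where pq: "quotient_of r = (p', q')" by fastforce
  have q': "q' > 0" "coprime p' q'" using quotient_of_denom_pos[OF pq] quotient_of_coprime[OF pq] .
  have "r = Rat.Fract p' q'" using quotient_of_div[OF pq] by (simp add: Fract_of_int_quotient)
  then have eq: "p * q' = p' * q" unfolding r_def using 1(3) q' by (simp add: eq_rat)
  have "q' dvd q" using q'(2) eq by (metis coprime_commute coprime_dvd_mult_right_iff dvd_triv_right)
  then have "q' \<le> 2 ^ n" using 1 zdvd_imp_le[of q' q] by simp
  have "p' dvd p" using q'(2) eq by (metis coprime_dvd_mult_left_iff dvd_triv_left)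
  have "\<bar>p'\<bar> \<le> 2 ^ n"
  proof (cases "p = 0")
    case True
    then have "p' = 0" using eq 1(3) by simp
    then show ?thesis by simp
  next
    case False
    then have "\<bar>p'\<bar> \<le> \<bar>p\<bar>" using \<open>p' dvd p\<close> by (simp add: dvd_imp_le_int)
    then show ?thesis using 1 by simp
  qed
  have len: "int_length z \<le> n + 2" if "\<bar>z\<bar> \<le> 2 ^ n" for z
  proof -
    have "nat \<bar>z\<bar> \<le> 2 ^ n" using that by (simp add: nat_le_iff)
    also have "\<dots> < 2 ^ (n + 1)" by simp
    finally have "floorlog 2 (nat \<bar>z\<bar>) \<le> n + 1" by (intro floorlog_leI) auto
    then show ?thesis unfolding int_length_def by simp
  qed
  have "inv of_rat x = r" unfolding x by (rule inv_f_f) (simp add: inj_def)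
  then have "real_length x = int_length p' + int_length q'"
    unfolding real_length_def rat_length_def by (simp add: pq)
  also have "\<dots> \<le> (n + 2) + (n + 2)"
    using len[of p'] len[of q'] \<open>\<bar>p'\<bar> \<le> 2 ^ n\<close> \<open>q' \<le> 2 ^ n\<close> q' by (intro add_mono) auto
  finally show "real_length x \<le> 2 * n + 4" by simp
qed

lemma real_length_bounded_rat:
  assumes "x \<in> \<rat>" "real_length x \<le> n" shows "bounded_rat n x"
proof -
  obtain r where r: "x = of_rat r" using assms(1) by (elim Rats_cases)
  obtain p q where pq: "quotient_of r = (p, q)" by fastforce
  have "inv of_rat x = r" unfolding r by (rule inv_f_f) (simp add: inj_def)
  then have len: "int_length p + int_length q \<le> n"
    using assms(2) unfolding real_length_def rat_length_def by (simp add: pq)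
  have bound: "\<bar>z\<bar> \<le> 2 ^ n" if "int_length z \<le> n" for z
  proof -
    have "nat \<bar>z\<bar> < 2 ^ n"
      using that unfolding int_length_def by (intro floorlog_leD) auto
    then show ?thesis by (simp add: nat_less_iff)
  qed
  have q: "q > 0" using quotient_of_denom_pos[OF pq] .
  have "x = of_int p / of_int q" unfolding r quotient_of_div[OF pq] by (simp add: of_rat_divide)
  then show ?thesis unfolding bounded_rat_def using bound[of p] bound[of q] len q by auto
qed

lemma bounded_rat_of_nat: "k \<le> 2 ^ n \<Longrightarrow> bounded_rat n (real k)"
proof -
  assume "k \<le> 2 ^ n"
  then have "int k \<le> int (2 ^ n)" by (simp only: of_nat_le_iff)
  then have "\<bar>int k\<bar> \<le> 2 ^ n" by simp
  then show ?thesis unfolding bounded_rat_def by (intro exI[of _ "int k"] exI[of _ 1]) auto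
qed

lemma bounded_rat_power2: "bounded_rat n (2 ^ n)"
  using bounded_rat_of_nat[of "2 ^ n" n] by simp

section \<open>Arithmetic of bit sizes in units of the input length\<close>

locale size_bound =
  fixes S :: nat
  assumes S: "S \<ge> 1"
begin

text \<open>Sizes are counted in multiples of \<open>S\<close>, so each operation adds fixed
  constants, and \<open>S \<ge> 1\<close> absorbs the carry of an addition into one more unit. The
  large numerals in later size statements are totals of these constants, some of them rounded
  up.\<close>

definition sz :: "nat \<Rightarrow> real \<Rightarrow> bool" where "sz k x \<longleftrightarrow> bounded_rat (k * S) x"
definition szv :: "nat \<Rightarrow> point \<Rightarrow> bool" where "szv k x \<longleftrightarrow> (\<forall>i. sz k (x $ i))"

lemma sz_mono: "sz k x \<Longrightarrow> k \<le> l \<Longrightarrow> sz l x"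
  unfolding sz_def by (erule bounded_rat_mono) simp

lemma szv_mono: "szv k x \<Longrightarrow> k \<le> l \<Longrightarrow> szv l x"
  unfolding szv_def using sz_mono by blast

lemma sz_add: "sz k x \<Longrightarrow> sz l y \<Longrightarrow> sz (k + l + 1) (x + y)"
  unfolding sz_def using S by (intro bounded_rat_mono[OF bounded_rat_add]) (auto simp: algebra_simps)

lemma sz_minus: "sz k x \<Longrightarrow> sz k (- x)"
  unfolding sz_def by (rule bounded_rat_minus)

lemma sz_diff: "sz k x \<Longrightarrow> sz l y \<Longrightarrow> sz (k + l + 1) (x - y)"
  using sz_add[OF _ sz_minus] by (metis diff_conv_add_uminus)

lemma sz_mult: "sz k x \<Longrightarrow> sz l y \<Longrightarrow> sz (k + l) (x * y)"
  unfolding sz_def by (rule bounded_rat_mono[OF bounded_rat_mult]) (auto simp: algebra_simps)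

lemma sz_divide: "sz k x \<Longrightarrow> sz l y \<Longrightarrow> sz (k + l) (x / y)"
  unfolding divide_inverse by (rule sz_mult) (auto simp: sz_def bounded_rat_inverse)

lemma sz_of_nat: "n \<le> 2 ^ (k * S) \<Longrightarrow> sz k (real n)"
  unfolding sz_def by (rule bounded_rat_of_nat)

lemma sz_power2: "n \<le> k * S \<Longrightarrow> sz k (2 ^ n)"
  unfolding sz_def by (rule bounded_rat_mono[OF bounded_rat_power2])

lemma sz_1: "sz 1 1" using sz_power2[of 0 1] by simp

lemma szv_add: "szv k x \<Longrightarrow> szv l y \<Longrightarrow> szv (k + l + 1) (x + y)"
  unfolding szv_def vector_add_component by (intro allI sz_add) blast+

lemma szv_diff: "szv k x \<Longrightarrow> szv l y \<Longrightarrow> szv (k + l + 1) (x - y)"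
  unfolding szv_def vector_minus_component by (intro allI sz_diff) blast+

lemma szv_scale: "sz k c \<Longrightarrow> szv l x \<Longrightarrow> szv (k + l) (c *\<^sub>R x)"
  unfolding szv_def by (simp add: sz_mult)

lemma sz_inner: assumes "szv k x" "szv l y" shows "sz (3 * (k + l) + 2) (x \<bullet> y)"
proof -
  have m: "sz (k + l) (x $ i * y $ i)" for i using assms sz_mult unfolding szv_def by blast
  have "sz ((k + l) + (k + l) + 1 + (k + l) + 1) (x $ 1 * y $ 1 + x $ 2 * y $ 2 + x $ 3 * y $ 3)"
    by (intro sz_add m)
  then have "sz (3 * (k + l) + 2) (x $ 1 * y $ 1 + x $ 2 * y $ 2 + x $ 3 * y $ 3)" by (rule sz_mono) simp
  then show ?thesis unfolding inner_vec_def sum_3 by simp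
qed

lemma szv_cross3: assumes "szv k x" "szv l y" shows "szv (2 * (k + l) + 1) (cross3 x y)"
  unfolding szv_def
proof
  fix i :: 3
  have m: "sz ((k + l) + (k + l) + 1) (x $ i * y $ j - x $ j' * y $ i')" for i j i' j'
    using assms unfolding szv_def by (intro sz_diff sz_mult) blast+
  have "sz ((k + l) + (k + l) + 1) (cross3 x y $ i)"
    using exhaust_3[of i] m by (auto simp: cross3_def)
  then show "sz (2 * (k + l) + 1) (cross3 x y $ i)" by (rule sz_mono) simp
qed

lemma szv_point_length:
  assumes "szv k x" shows "rational_point x" "point_length x \<le> 3 * (2 * (k * S) + 4)"
proof -
  show "rational_point x" using assms bounded_rat_real_length(1) unfolding szv_def sz_def rational_point_def by blast
  have "point_length x \<le> (\<Sum>i\<in>(UNIV :: 3 set). 2 * (k * S) + 4)"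
    unfolding point_length_def
    using assms bounded_rat_real_length(2) unfolding szv_def sz_def by (intro sum_mono) blast
  then show "point_length x \<le> 3 * (2 * (k * S) + 4)" by simp
qed

lemma point_length_szv:
  assumes "rational_point x" "point_length x \<le> S" shows "szv 1 x"
  unfolding szv_def sz_def
proof
  fix i
  have "real_length (x $ i) \<le> point_length x" unfolding point_length_def by (intro member_le_sum) auto
  then show "bounded_rat (1 * S) (x $ i)"
    using assms by (intro real_length_bounded_rat) (auto simp: rational_point_def)
qed

end

subsection \<open>The projective coordinates\<close>

lemma cyclic3 [simp]:
  "(i::3) + 1 + 1 = i + 2" "i + 1 + 2 = i" "i + 2 + 1 = i" "i + 2 + 2 = i + 1"
  "i \<noteq> i + 1" "i \<noteq> i + 2" "i + 1 \<noteq> i" "i + 2 \<noteq> i" "i + 1 \<noteq> i + 2" "i + 2 \<noteq> i + 1"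
  using exhaust_3[of i] by auto

lemma cyclic3_cases: "(j::3) = i \<or> j = i + 1 \<or> j = i + 2"
  using exhaust_3[of i] exhaust_3[of j] by auto

lemma UNIV_cyclic3: "(UNIV :: 3 set) = {i, i + 1, i + 2}"
  using cyclic3_cases[of _ i] by auto

lemma sum_cyclic3: "(\<Sum>j\<in>UNIV. f (j::3)) = f i + f (i + 1) + (f (i + 2) :: 'a::comm_monoid_add)"
proof -
  have "(\<Sum>j\<in>UNIV. f j) = (\<Sum>j\<in>{i, i + 1, i + 2}. f j)" by (subst UNIV_cyclic3[of i]) (rule refl)
  also have "\<dots> = f i + (f (i + 1) + (f (i + 2) + 0))"
    by (subst sum.insert | simp only: finite.intros insert_iff cyclic3 empty_iff simp_thms sum.empty)+
  finally show ?thesis by (simp only: add_0_right add.assoc)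
qed

lemma all_cyclic3: "(\<forall>j::3. P j) \<longleftrightarrow> P i \<and> P (i + 1) \<and> P (i + 2)"
proof
  assume P: "P i \<and> P (i + 1) \<and> P (i + 2)"
  show "\<forall>j. P j"
  proof
    fix j show "P j" using cyclic3_cases[of j i] P by (elim disjE) simp_all
  qed
qed blast

lemma range_cyclic3: "range (f :: 3 \<Rightarrow> 'a) = {f i, f (i + 1), f (i + 2)}"
  by (subst UNIV_cyclic3[of i]) (simp only: image_insert image_empty)

locale affine_frame =
  fixes v :: point and d :: "3 \<Rightarrow> point" and X :: "3 \<Rightarrow> point \<Rightarrow> real"
  assumes affine_X: "affine_fun (X k)"
    and X_point: "X k (v + (\<Sum>j\<in>UNIV. y j *\<^sub>R d j)) = y k"
    and point_X: "v + (\<Sum>j\<in>UNIV. X j p *\<^sub>R d j) = p"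
begin

lemma X_inject: "(\<And>k. X k p = X k q) \<Longrightarrow> p = q"
proof -
  assume "\<And>k. X k p = X k q"
  then have "v + (\<Sum>j\<in>UNIV. X j p *\<^sub>R d j) = v + (\<Sum>j\<in>UNIV. X j q *\<^sub>R d j)" by simp
  then show "p = q" unfolding point_X .
qed

end

text \<open>Here \<open>bump s - s = s * (1 - s) / 2\<close>, a parabola above the chord from (0, 0)
  to (1, 1). A quadratic with rational coefficients keeps rational data rational, and its deviation
  from any secant factors into two linear terms.\<close>

definition bump :: "real \<Rightarrow> real" where
  "bump s = s * (3 - s) / 2"

lemma bump_0_1 [simp]: "bump 0 = 0" "bump 1 = 1"
  by (simp_all add: bump_def)

lemma bump_strict_mono: "\<lbrakk>0 \<le> s; s < t; t \<le> 1\<rbrakk> \<Longrightarrow> bump s < bump t"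
proof -
  assume "0 \<le> s" "s < t" "t \<le> 1"
  then have "(t - s) * (3 - s - t) > 0" by (intro mult_pos_pos) auto
  moreover have "bump t - bump s = (t - s) * (3 - s - t) / 2"
    unfolding bump_def by (simp add: field_simps)
  ultimately show ?thesis by simp
qed

lemma bump_bounds: "\<lbrakk>0 \<le> s; s \<le> 1\<rbrakk> \<Longrightarrow> 0 \<le> bump s \<and> bump s \<le> 1"
  using bump_strict_mono[of 0 s] bump_strict_mono[of s 1]
  by (metis bump_0_1 less_eq_real_def order_refl)

locale cupola_frame = affine_frame +
  fixes \<kappa> a b :: real
  assumes kappa: "\<kappa> \<ge> 2" and a: "a > 0" and b: "b > 0" and ab: "a \<noteq> b"
begin

definition sigma :: "point \<Rightarrow> real" where
  "sigma p = (\<Sum>j\<in>UNIV. X j p)"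

definition zeta :: "point \<Rightarrow> real" where
  "zeta p = b * (sigma p - a) / (b - a)"

text \<open>
  A point is determined by the homogeneous vector \<open>(X, zeta)\<close>, normalised by \<open>normalised\<close> below.
  In these coordinates the two levels \<open>sigma = a\<close> and \<open>sigma = b\<close> become \<open>zeta = 0\<close> and
  \<open>zeta = sigma\<close>, and \<open>a\<close>, \<open>b\<close> disappear from all further computations.
\<close>

lemma normalised: "(sigma p - zeta p) / a + zeta p / b = 1"
proof -
  define r where "r = (sigma p - a) / (b - a)"
  have r: "sigma p = a + r * (b - a)" "zeta p = b * r" using ab by (simp_all add: r_def zeta_def)
  show ?thesis using a b unfolding r by (simp add: field_simps)
qed

text \<open>The absence of a constant term makes the sign depend only on the homogeneous vector up
  to a positive factor.\<close>

definition lin :: "3 \<Rightarrow> real \<Rightarrow> real \<Rightarrow> real \<Rightarrow> real \<Rightarrow> point \<Rightarrow> real" where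
  "lin i u0 u1 u2 w p = u0 * X i p + u1 * X (i + 1) p + u2 * X (i + 2) p + w * zeta p"

lemma affine_sigma: "affine_fun sigma"
  unfolding sigma_def sum_cyclic3[of _ 0] by (intro affine_fun_add affine_X)

lemma affine_zeta: "affine_fun zeta"
proof -
  have "zeta = (\<lambda>p. b / (b - a) * (sigma p - a))" unfolding zeta_def by auto
  moreover have "affine_fun (\<lambda>p. b / (b - a) * (sigma p - a))"
    by (intro affine_fun_scale affine_fun_diff affine_sigma affine_fun_const)
  ultimately show ?thesis by simp
qed

lemma affine_lin: "affine_fun (lin i u0 u1 u2 w)"
  unfolding lin_def by (intro affine_fun_add affine_fun_scale affine_X affine_zeta)

lemma sigma_cyclic: "sigma p = X i p + X (i + 1) p + X (i + 2) p"
  unfolding sigma_def sum_cyclic3[of _ i] ..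

text \<open>
  Up to the factor \<open>weight s / (\<kappa> - 1)\<close>, the homogeneous vector of \<open>vtx i s\<close> is that of the point
  dividing the segment from \<open>A i\<close> to \<open>B (i + 1)\<close> in the ratio \<open>s : 1 - s\<close>, with \<open>zeta\<close> raised from \<open>s\<close> to
  the strictly concave \<open>bump s\<close>.
\<close>

definition weight :: "real \<Rightarrow> real" where
  "weight s = (\<kappa> - 1) * ((1 - bump s) / a + bump s / b)"

definition vtx_coord :: "3 \<Rightarrow> real \<Rightarrow> 3 \<Rightarrow> real" where
  "vtx_coord i s j = (if j = i then (1 - s) * \<kappa> else if j = i + 1 then (\<kappa> - 1) * s else - (1 - s)) / weight s"

definition vtx :: "3 \<Rightarrow> real \<Rightarrow> point" where
  "vtx i s = v + (\<Sum>j\<in>UNIV. vtx_coord i s j *\<^sub>R d j)"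

definition A :: "3 \<Rightarrow> point" where "A i = vtx i 0"
definition B :: "3 \<Rightarrow> point" where "B i = vtx (i + 2) 1"

lemma weight_pos: "0 \<le> s \<Longrightarrow> s \<le> 1 \<Longrightarrow> weight s > 0"
proof -
  assume s: "0 \<le> s" "s \<le> 1"
  then have G: "0 \<le> bump s" "bump s \<le> 1" using bump_bounds by auto
  have "(1 - bump s) / a + bump s / b > 0"
  proof (cases "bump s = 0")
    case False
    then show ?thesis using G a b by (intro add_nonneg_pos) auto
  qed (use a in simp)
  then show ?thesis unfolding weight_def using kappa by simp
qed

lemma X_vtx: "X j (vtx i s) = vtx_coord i s j"
  unfolding vtx_def by (rule X_point)

lemma X_vtx_cyclic:
  "X i (vtx i s) = (1 - s) * \<kappa> / weight s"
  "X (i + 1) (vtx i s) = (\<kappa> - 1) * s / weight s"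
  "X (i + 2) (vtx i s) = - (1 - s) / weight s"
  "X i (vtx (i + 1) s) = - (1 - s) / weight s"
  "X (i + 1) (vtx (i + 1) s) = (1 - s) * \<kappa> / weight s"
  "X (i + 2) (vtx (i + 1) s) = (\<kappa> - 1) * s / weight s"
  "X i (vtx (i + 2) s) = (\<kappa> - 1) * s / weight s"
  "X (i + 1) (vtx (i + 2) s) = - (1 - s) / weight s"
  "X (i + 2) (vtx (i + 2) s) = (1 - s) * \<kappa> / weight s"
  unfolding X_vtx vtx_coord_def by simp_all

lemma sigma_vtx: "sigma (vtx i s) = (\<kappa> - 1) / weight s"
  unfolding sigma_cyclic[of _ i] X_vtx_cyclic by (simp add: divide_inverse algebra_simps)

lemma zeta_vtx: assumes "0 \<le> s" "s \<le> 1" shows "zeta (vtx i s) = (\<kappa> - 1) * bump s / weight s"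
proof -
  have "weight s \<noteq> 0" using weight_pos[OF assms] by simp
  then have w: "(1 - bump s) / a + bump s / b \<noteq> 0" and k: "\<kappa> - 1 \<noteq> 0" using kappa by (auto simp: weight_def)
  define D where "D = b * (1 - bump s) + a * bump s"
  have D: "(1 - bump s) / a + bump s / b = D / (a * b)" using a b by (simp add: D_def field_simps)
  then have "D \<noteq> 0" using w by auto
  have "(\<kappa> - 1) / weight s = a * b / D" unfolding weight_def D using k by simp
  then have "zeta (vtx i s) = b * (a * b / D - a) / (b - a)"
    unfolding zeta_def sigma_vtx by simp
  also have "a * b / D - a = a * bump s * (b - a) / D"
  proof -
    have "a * b / D - a = a * (b - D) / D" using \<open>D \<noteq> 0\<close> by (simp add: field_simps)
    also have "b - D = bump s * (b - a)" unfolding D_def by (simp add: algebra_simps)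
    finally show ?thesis by simp
  qed
  also have "b * (a * bump s * (b - a) / D) / (b - a) = bump s * (a * b / D)" using ab by simp
  also have "\<dots> = (\<kappa> - 1) * bump s / weight s"
    unfolding weight_def D using k a b \<open>D \<noteq> 0\<close> by (simp add: field_simps)
  finally show ?thesis .
qed

lemma lin_vtx:
  assumes "0 \<le> s" "s \<le> 1"
  shows "lin i u0 u1 u2 w (vtx i s) =
      (u0 * (1 - s) * \<kappa> + u1 * (\<kappa> - 1) * s - u2 * (1 - s) + w * (\<kappa> - 1) * bump s) / weight s"
    and "lin i u0 u1 u2 w (vtx (i + 1) s) =
      (u1 * (1 - s) * \<kappa> + u2 * (\<kappa> - 1) * s - u0 * (1 - s) + w * (\<kappa> - 1) * bump s) / weight s"
    and "lin i u0 u1 u2 w (vtx (i + 2) s) =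
      (u2 * (1 - s) * \<kappa> + u0 * (\<kappa> - 1) * s - u1 * (1 - s) + w * (\<kappa> - 1) * bump s) / weight s"
  unfolding lin_def X_vtx_cyclic zeta_vtx[OF assms] by (simp_all add: divide_inverse algebra_simps)

section \<open>Convex hull membership in terms of homogeneous vectors\<close>

definition in_cone :: "point set \<Rightarrow> 3 \<Rightarrow> real \<times> real \<times> real \<times> real \<Rightarrow> bool" where
  "in_cone S i y \<longleftrightarrow> (\<exists>r\<ge>0. \<exists>p\<in>convex hull S. y = r *\<^sub>R (X i p, X (i + 1) p, X (i + 2) p, zeta p))"

lemma in_cone_scale: "in_cone S i y \<Longrightarrow> c \<ge> 0 \<Longrightarrow> in_cone S i (c *\<^sub>R y)"
proof -
  assume "in_cone S i y" and c: "c \<ge> 0"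
  then obtain r p where 1: "r \<ge> 0" "p \<in> convex hull S" "y = r *\<^sub>R (X i p, X (i + 1) p, X (i + 2) p, zeta p)"
    unfolding in_cone_def by blast
  then have "c *\<^sub>R y = (c * r) *\<^sub>R (X i p, X (i + 1) p, X (i + 2) p, zeta p)" by simp
  then show ?thesis unfolding in_cone_def using 1 c by (intro exI[of _ "c * r"] conjI bexI[of _ p]) simp_all
qed

lemma in_cone_add:
  assumes "in_cone S i y" "in_cone S i y'" shows "in_cone S i (y + y')"
proof -
  obtain r p where 1: "r \<ge> 0" "p \<in> convex hull S" "y = r *\<^sub>R (X i p, X (i + 1) p, X (i + 2) p, zeta p)"
    using assms unfolding in_cone_def by blast
  obtain r' p' where 2: "r' \<ge> 0" "p' \<in> convex hull S" "y' = r' *\<^sub>R (X i p', X (i + 1) p', X (i + 2) p', zeta p')"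
    using assms unfolding in_cone_def by blast
  show ?thesis
  proof (cases "r + r' = 0")
    case True
    then have "r = 0" "r' = 0" using 1 2 by auto
    then show ?thesis using 1 2 assms by simp
  next
    case False
    define R where "R = r + r'"
    \<comment> \<open>The weights are the two scale factors, normalised to sum 1; values of affine
      functions then add up after multiplication by \<open>R\<close>.\<close>
    define P where "P = (r / R) *\<^sub>R p + (r' / R) *\<^sub>R p'"
    have R: "R > 0" using False 1 2 unfolding R_def by simp
    then have s: "r / R + r' / R = 1" unfolding add_divide_distrib[symmetric] R_def by simp
    have "P \<in> convex hull S" unfolding P_def
      using R 1 2 s by (intro convexD[OF convex_convex_hull]) auto
    moreover have "R * f P = r * f p + r' * f p'" if "affine_fun f" for f
      unfolding P_def affine_fun_comb[OF that s] using R by (simp add: distrib_left)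
    then have "y + y' = R *\<^sub>R (X i P, X (i + 1) P, X (i + 2) P, zeta P)"
      by (simp add: 1(3) 2(3) affine_X affine_zeta)
    ultimately show ?thesis using R unfolding in_cone_def by (intro exI[of _ R]) auto
  qed
qed

lemma in_cone_vtx:
  assumes "0 \<le> s" "s \<le> 1"
  shows "vtx i s \<in> S \<Longrightarrow> in_cone S i ((1 - s) * \<kappa>, (\<kappa> - 1) * s, - (1 - s), (\<kappa> - 1) * bump s)"
    and "vtx (i + 1) s \<in> S \<Longrightarrow> in_cone S i (- (1 - s), (1 - s) * \<kappa>, (\<kappa> - 1) * s, (\<kappa> - 1) * bump s)"
    and "vtx (i + 2) s \<in> S \<Longrightarrow> in_cone S i ((\<kappa> - 1) * s, - (1 - s), (1 - s) * \<kappa>, (\<kappa> - 1) * bump s)"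
proof -
  have *: "in_cone S i (weight s *\<^sub>R (X i p, X (i + 1) p, X (i + 2) p, zeta p))" if "p \<in> S" for p
    unfolding in_cone_def using weight_pos[OF assms] hull_inc[OF that, of convex]
    by (intro exI[of _ "weight s"] conjI bexI[of _ p]) auto
  show "vtx i s \<in> S \<Longrightarrow> in_cone S i ((1 - s) * \<kappa>, (\<kappa> - 1) * s, - (1 - s), (\<kappa> - 1) * bump s)"
    using *[of "vtx i s"] weight_pos[OF assms] by (simp add: X_vtx_cyclic zeta_vtx[OF assms])
  show "vtx (i + 1) s \<in> S \<Longrightarrow> in_cone S i (- (1 - s), (1 - s) * \<kappa>, (\<kappa> - 1) * s, (\<kappa> - 1) * bump s)"
    using *[of "vtx (i + 1) s"] weight_pos[OF assms] by (simp add: X_vtx_cyclic zeta_vtx[OF assms])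
  show "vtx (i + 2) s \<in> S \<Longrightarrow> in_cone S i ((\<kappa> - 1) * s, - (1 - s), (1 - s) * \<kappa>, (\<kappa> - 1) * bump s)"
    using *[of "vtx (i + 2) s"] weight_pos[OF assms] by (simp add: X_vtx_cyclic zeta_vtx[OF assms])
qed

text \<open>The relation \<open>normalised\<close> fixes the scale: it is linear in the homogeneous
  vector and equals 1 at every point, so the factor \<open>r\<close> is 1.\<close>

lemma in_cone_self:
  assumes "in_cone S i (X i p, X (i + 1) p, X (i + 2) p, zeta p)" shows "p \<in> convex hull S"
proof -
  obtain r p' where r: "r \<ge> 0" "p' \<in> convex hull S"
    and e: "X i p = r * X i p'" "X (i + 1) p = r * X (i + 1) p'" "X (i + 2) p = r * X (i + 2) p'"
      "zeta p = r * zeta p'"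
    using assms unfolding in_cone_def by auto
  have "sigma p = r * sigma p'" unfolding sigma_cyclic[of _ i] e by (simp add: algebra_simps)
  then have "(sigma p - zeta p) / a + zeta p / b = r * ((sigma p' - zeta p') / a + zeta p' / b)"
    unfolding e by (simp add: algebra_simps)
  then have "r = 1" unfolding normalised by simp
  then have "X j p = X j p'" for j using e cyclic3_cases[of j i] by auto
  then have "p = p'" by (rule X_inject)
  then show ?thesis using r by simp
qed

text \<open>Reduces membership of a point to that of the two points below and above it on the same
  vertical line of the projective picture, one in the bottom and one in the roof.\<close>

lemma in_cone_below:
  assumes "in_cone S i (x, y, z, h)" "in_cone S i (x, y, z, 0)" "0 \<le> t" "t \<le> h"
  shows "in_cone S i (x, y, z, t)"
proof (cases "h = 0")
  case False
  then have h: "h > 0" using assms by simp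
  have "in_cone S i ((t / h) *\<^sub>R (x, y, z, h) + (1 - t / h) *\<^sub>R (x, y, z, 0))"
    using assms h by (intro in_cone_add in_cone_scale) auto
  moreover have "(t / h) *\<^sub>R (x, y, z, h) + (1 - t / h) *\<^sub>R (x, y, z, 0) = (x, y, z, t)"
    using h by (simp add: algebra_simps)
  ultimately show ?thesis by simp
qed (use assms in auto)

text \<open>\<open>sigma\<close> fixes the weight, then \<open>zeta\<close> fixes
  \<open>bump\<close> and by monotonicity the parameter; the coordinates fix the index.\<close>

lemma vtx_inject:
  assumes "vtx i s = vtx j t" "0 \<le> s" "s \<le> 1" "0 \<le> t" "t \<le> 1"
  shows "i = j \<and> s = t"
proof -
  have w: "weight s > 0" "weight t > 0" using weight_pos assms by auto
  have k: "\<kappa> - 1 > 0" using kappa by simp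
  have "sigma (vtx i s) = sigma (vtx j t)" "zeta (vtx i s) = zeta (vtx j t)" using assms(1) by simp_all
  then have ws: "weight s = weight t" and "bump s = bump t"
    using w k unfolding sigma_vtx zeta_vtx[OF assms(2,3)] zeta_vtx[OF assms(4,5)]
    by (simp_all add: frac_eq_eq)
  then have st: "s = t"
    using bump_strict_mono[of s t] bump_strict_mono[of t s] assms by (cases s t rule: linorder_cases) auto
  have eq: "X l (vtx i s) * weight s = X l (vtx j s) * weight s" for l using assms(1) st by simp
  have "j \<noteq> i + 1"
  proof
    assume j: "j = i + 1"
    have "(1 - s) * \<kappa> = - (1 - s)" "(\<kappa> - 1) * s = (1 - s) * \<kappa>"
      using eq[of i] eq[of "i + 1"] w unfolding j by (simp_all add: X_vtx_cyclic)
    from this(1) have "(1 - s) * (\<kappa> + 1) = 0" unfolding distrib_left by simp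
    then have "s = 1" using kappa by auto
    then show False using \<open>(\<kappa> - 1) * s = (1 - s) * \<kappa>\<close> kappa by simp
  qed
  moreover have "j \<noteq> i + 2"
  proof
    assume j: "j = i + 2"
    have "(\<kappa> - 1) * s = - (1 - s)" using eq[of "i + 1"] w unfolding j by (simp add: X_vtx_cyclic)
    moreover have "(\<kappa> - 1) * s \<ge> 1 * s" using kappa assms by (intro mult_right_mono) auto
    ultimately show False by simp
  qed
  ultimately show ?thesis using st cyclic3_cases[of j i] by auto
qed

section \<open>Linear forms at the vertices, non-degeneracy and sides of planes\<close>

lemma lin_X: "lin i 1 0 0 0 = X i" "lin i 0 1 0 0 = X (i + 1)" "lin i 0 0 1 0 = X (i + 2)"
  by (simp_all add: lin_def fun_eq_iff)

lemma lin_eq_zeta: "lin i 0 0 0 1 = zeta" and lin_eq_sigma_zeta: "lin i 1 1 1 (- 1) p = sigma p - zeta p"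
  by (simp_all add: lin_def fun_eq_iff sigma_cyclic[of _ i])

lemma lin_A:
  "lin i u0 u1 u2 w (A i) = (u0 * \<kappa> - u2) / weight 0"
  "lin i u0 u1 u2 w (A (i + 1)) = (u1 * \<kappa> - u0) / weight 0"
  "lin i u0 u1 u2 w (A (i + 2)) = (u2 * \<kappa> - u1) / weight 0"
  unfolding A_def using lin_vtx[of 0 i u0 u1 u2 w] by simp_all

lemma lin_B:
  "lin i u0 u1 u2 w (B i) = (u0 + w) * (\<kappa> - 1) / weight 1"
  "lin i u0 u1 u2 w (B (i + 1)) = (u1 + w) * (\<kappa> - 1) / weight 1"
  "lin i u0 u1 u2 w (B (i + 2)) = (u2 + w) * (\<kappa> - 1) / weight 1"
  unfolding B_def using lin_vtx[of 1 i u0 u1 u2 w] by (simp_all add: distrib_right)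

lemma weight_01: "weight 0 > 0" "weight 1 > 0" by (simp_all add: weight_pos)

lemma A_triangle: "\<not> affine_dependent (range A)" "card (range A) = 3"
proof -
  \<comment> \<open>At \<open>A (0 + 2)\<close> the first form below has the value
    \<open>(\<kappa> ^ 3 - 1) / weight 0\<close>.\<close>
  have "\<kappa> ^ 2 * \<kappa> \<noteq> 1" using power_strict_mono[of 1 \<kappa> 3] kappa
    by (simp add: power2_eq_square power3_eq_cube)
  then have "\<not> affine_dependent {A (0 + 2), A (0 + 1), A 0}" "card {A (0 + 2), A (0 + 1), A 0} = 3"
    using kappa weight_01
    by (intro not_affine_dependent_triangular[of "lin 0 \<kappa> 1 (\<kappa>^2) 0" "lin 0 0 1 0 0"] affine_lin;
      simp only: lin_A; simp add: power2_eq_square)+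
  moreover have "{A (0 + 2), A (0 + 1), A 0} = range A" unfolding range_cyclic3[of A 0] by blast
  ultimately show "\<not> affine_dependent (range A)" "card (range A) = 3" by simp_all
qed

lemma B_triangle: "\<not> affine_dependent (range B)" "card (range B) = 3"
proof -
  have "\<not> affine_dependent {B (0 + 2), B (0 + 1), B 0}" "card {B (0 + 2), B (0 + 1), B 0} = 3"
    using kappa weight_01
    by (intro not_affine_dependent_triangular[of "lin 0 0 0 1 0" "lin 0 0 1 0 0"] affine_lin;
      simp only: lin_B; simp)+
  moreover have "{B (0 + 2), B (0 + 1), B 0} = range B" unfolding range_cyclic3[of B 0] by blast
  ultimately show "\<not> affine_dependent (range B)" "card (range B) = 3" by simp_all
qed

text \<open>The whole arc from \<open>A i\<close> to \<open>B (i + 1)\<close> lies in the plane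
  \<open>lin i 1 0 \<kappa> 0 = 0\<close> through the apex, and \<open>p\<close> does not. The
  second form vanishes at the parameter \<open>t\<close> and is nonzero at \<open>s\<close>.\<close>

lemma arc_triangle:
  assumes "0 \<le> s" "s < t" "t \<le> 1" "p = B i \<or> p = A (i + 1)"
  shows "\<not> affine_dependent {p, vtx i s, vtx i t}" "card {p, vtx i s, vtx i t} = 3"
proof -
  have w: "weight s \<noteq> 0" "weight t \<noteq> 0" using weight_pos[of s] weight_pos[of t] assms by auto
  have "lin i 1 0 \<kappa> 0 p \<noteq> 0" using assms(4) lin_B(1) lin_A(2) kappa weight_01 by auto
  moreover have "lin i 1 0 \<kappa> 0 (vtx i s) = 0" "lin i 1 0 \<kappa> 0 (vtx i t) = 0"
    using assms by (simp_all add: lin_vtx)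
  moreover have "lin i 0 (1 - t) ((\<kappa> - 1) * t) 0 (vtx i t) = 0"
    using assms by (simp add: lin_vtx algebra_simps)
  moreover have "lin i 0 (1 - t) ((\<kappa> - 1) * t) 0 (vtx i s) = (\<kappa> - 1) * (s - t) / weight s"
    using assms by (simp add: lin_vtx algebra_simps)
  then have "lin i 0 (1 - t) ((\<kappa> - 1) * t) 0 (vtx i s) \<noteq> 0" using kappa assms w by auto
  ultimately show "\<not> affine_dependent {p, vtx i s, vtx i t}" "card {p, vtx i s, vtx i t} = 3"
    using not_affine_dependent_triangular[of "lin i 1 0 \<kappa> 0" "lin i 0 (1 - t) ((\<kappa> - 1) * t) 0" p "vtx i s" "vtx i t",
        OF affine_lin affine_lin] by simp_all
qed

text \<open>The arc starts on one side of the plane and ends at \<open>B (i + 1)\<close> on the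
  other, so intermediate vertices have to stay near \<open>A i\<close>. Since
  \<open>bump t \<le> t * 3 / 2\<close>, the bound \<open>t \<le> 1 / 3\<close> keeps
  \<open>1 - t - bump t\<close> positive.\<close>

lemma opposite_side_vtx:
  assumes "0 \<le> t" "t \<le> 1 / 3"
  shows "opposite_side (B i) (A (i + 1)) (B (i + 2)) (vtx i t) (B (i + 1))"
proof -
  let ?f = "lin i \<kappa> 1 \<kappa> (- \<kappa>)"
  have f: "affine_fun ?f" by (rule affine_lin)
  have z: "?f (B i) = 0" "?f (A (i + 1)) = 0" "?f (B (i + 2)) = 0"
    unfolding lin_B lin_A by simp_all
  have "(1 - \<kappa>) * (\<kappa> - 1) < 0" using kappa by (intro mult_neg_pos) auto
  then have neg: "?f (B (i + 1)) < 0"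
    unfolding lin_B using weight_01 by (simp add: divide_neg_pos)
  have "bump t \<le> t * 3 / 2" using assms unfolding bump_def by (simp add: mult_left_mono)
  then have "\<kappa> * (1 - t - bump t) > 0" using assms kappa by (intro mult_pos_pos) auto
  then have "(\<kappa> - 1) * (\<kappa> * (1 - t - bump t) + t) > 0"
    using assms kappa by (intro mult_pos_pos) auto
  moreover have "?f (vtx i t) = (\<kappa> - 1) * (\<kappa> * (1 - t - bump t) + t) / weight t"
    using assms by (simp add: lin_vtx algebra_simps)
  ultimately have pos: "?f (vtx i t) > 0" using weight_pos[of t] assms by simp
  \<comment> \<open>The sign of \<open>u\<close> depends on the orientation of the frame, so only
    \<open>u * u > 0\<close> is used.\<close>
  define u where "u = plane_side (B i) (A (i + 1)) (B (i + 2)) (B (i + 1))"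
  have u: "u \<noteq> 0" unfolding u_def
  proof (rule plane_side_nonzero[of "lin i 1 1 1 (- 1)" "lin i 0 0 1 0" _ _ _ ?f])
    show "lin i 1 1 1 (- 1) (A (i + 1)) \<noteq> 0" "lin i 0 0 1 0 (B (i + 2)) \<noteq> 0"
      unfolding lin_A lin_B using kappa weight_01 by auto
  qed (use z neg in \<open>auto simp: affine_lin lin_A lin_B\<close>)
  have "plane_side (B i) (A (i + 1)) (B (i + 2)) (vtx i t) * ?f (B (i + 1)) = u * ?f (vtx i t)"
    unfolding u_def by (rule plane_side_proportional[OF f z])
  then have "plane_side (B i) (A (i + 1)) (B (i + 2)) (vtx i t) * u * ?f (B (i + 1)) = u * u * ?f (vtx i t)"
    by simp
  moreover have "u * u > 0" using u not_real_square_gt_zero by blast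
  ultimately have "plane_side (B i) (A (i + 1)) (B (i + 2)) (vtx i t) * u * ?f (B (i + 1)) > 0"
    using pos by (simp only: mult_pos_pos)
  then show ?thesis
    unfolding opposite_side_def u_def[symmetric] using neg by (simp add: zero_less_mult_iff)
qed

text \<open>The pinwheel puts \<open>A (i + 1)\<close> on the wall \<open>X (i + 2) = 0\<close> that
  contains \<open>B i\<close> and \<open>B (i + 1)\<close>, so the planes of the visibility cone are
  the walls of the octant.\<close>

lemma visibility_cone_eq: "visibility_cone A B = {p. \<forall>i. X i p \<ge> 0}"
proof -
  have *: "same_closed_side (B i) (B (i + 1)) (A (i + 1)) p (B (i + 2)) \<longleftrightarrow> X (i + 2) p \<ge> 0" for i p
  proof -
    let ?f = "lin i 0 0 1 0"
    have f: "affine_fun ?f" by (rule affine_lin)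
    have z: "?f (B i) = 0" "?f (B (i + 1)) = 0" "?f (A (i + 1)) = 0"
      unfolding lin_B lin_A by simp_all
    have pos: "?f (B (i + 2)) > 0"
      unfolding lin_B using weight_01 kappa by simp
    define u where "u = plane_side (B i) (B (i + 1)) (A (i + 1)) (B (i + 2))"
    have u: "u \<noteq> 0" unfolding u_def
    proof (rule plane_side_nonzero[of "lin i 0 1 0 0" "lin i 1 1 1 (- 1)" _ _ _ ?f])
      show "lin i 0 1 0 0 (B (i + 1)) \<noteq> 0" "lin i 1 1 1 (- 1) (A (i + 1)) \<noteq> 0"
        unfolding lin_A lin_B using kappa weight_01 by auto
    qed (use z pos in \<open>auto simp: affine_lin lin_A lin_B\<close>)
    have "plane_side (B i) (B (i + 1)) (A (i + 1)) p * ?f (B (i + 2)) = u * ?f p"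
      unfolding u_def by (rule plane_side_proportional[OF f z])
    then have "plane_side (B i) (B (i + 1)) (A (i + 1)) p * u * ?f (B (i + 2)) = (u * u) * ?f p"
      by simp
    moreover have "u * u > 0" using u not_real_square_gt_zero by blast
    moreover have "0 \<le> x \<longleftrightarrow> 0 \<le> y" if "x * r = c * y" "r > 0" "c > 0" for x y r c :: real
      using that by (metis mult_le_cancel_left_pos mult_le_cancel_right_pos mult_zero_left mult_zero_right)
    ultimately have "0 \<le> plane_side (B i) (B (i + 1)) (A (i + 1)) p * u \<longleftrightarrow> 0 \<le> ?f p"
      using pos by blast
    then show ?thesis unfolding same_closed_side_def u_def[symmetric] lin_X .
  qed
  have "(\<forall>i. X (i + 2) p \<ge> 0) \<longleftrightarrow> (\<forall>i. X i p \<ge> 0)" for p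
    by (metis cyclic3(3) add.assoc add.commute)
  then show ?thesis unfolding visibility_cone_def * by simp
qed

lemma in_cone_A:
  "A i \<in> S \<Longrightarrow> in_cone S i (\<kappa>, 0, - 1, 0)"
  "A (i + 1) \<in> S \<Longrightarrow> in_cone S i (- 1, \<kappa>, 0, 0)"
  "A (i + 2) \<in> S \<Longrightarrow> in_cone S i (0, - 1, \<kappa>, 0)"
  unfolding A_def using in_cone_vtx[of 0 i S] by simp_all

lemma in_cone_B:
  "B i \<in> S \<Longrightarrow> in_cone S i (\<kappa> - 1, 0, 0, \<kappa> - 1)"
  "B (i + 1) \<in> S \<Longrightarrow> in_cone S i (0, \<kappa> - 1, 0, \<kappa> - 1)"
  "B (i + 2) \<in> S \<Longrightarrow> in_cone S i (0, 0, \<kappa> - 1, \<kappa> - 1)"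
  unfolding B_def using in_cone_vtx[of 1 i S] by simp_all

text \<open>The homogeneous vectors of the \<open>A i\<close> form a circulant matrix of determinant
  \<open>\<kappa> ^ 3 - 1\<close>; by Cramer's rule the three floor values divided by it are the
  coefficients.\<close>

lemma in_cone_bottom:
  assumes "range A \<subseteq> S" and floor: "\<And>i. lin i \<kappa> 1 (\<kappa>\<^sup>2) 0 p \<ge> 0"
  shows "in_cone S i (X i p, X (i + 1) p, X (i + 2) p, 0)"
proof -
  define K where "K = \<kappa> ^ 3 - 1"
  have K: "K > 0" using power_strict_mono[of 1 \<kappa> 3] kappa unfolding K_def by simp
  define x0 x1 x2 where "x0 = X i p" and "x1 = X (i + 1) p" and "x2 = X (i + 2) p"
  note x = x0_def[symmetric] x1_def[symmetric] x2_def[symmetric]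
  have "in_cone S i (\<kappa>, 0, - 1, 0)" "in_cone S i (- 1, \<kappa>, 0, 0)" "in_cone S i (0, - 1, \<kappa>, 0)"
    using in_cone_A[of i S] assms(1) by auto
  then have "in_cone S i (((\<kappa> * x1 + x2 + \<kappa>\<^sup>2 * x0) / K) *\<^sub>R (\<kappa>, 0, - 1, 0) +
      ((\<kappa> * x2 + x0 + \<kappa>\<^sup>2 * x1) / K) *\<^sub>R (- 1, \<kappa>, 0, 0) +
      ((\<kappa> * x0 + x1 + \<kappa>\<^sup>2 * x2) / K) *\<^sub>R (0, - 1, \<kappa>, 0))"
    using K floor[of i] floor[of "i + 1"] floor[of "i + 2"] unfolding lin_def cyclic3 x
    by (intro in_cone_add in_cone_scale) auto
  moreover have "(\<kappa> * x1 + x2 + \<kappa>\<^sup>2 * x0) / K * \<kappa> - (\<kappa> * x2 + x0 + \<kappa>\<^sup>2 * x1) / K = x0"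
    "(\<kappa> * x2 + x0 + \<kappa>\<^sup>2 * x1) / K * \<kappa> - (\<kappa> * x0 + x1 + \<kappa>\<^sup>2 * x2) / K = x1"
    "(\<kappa> * x0 + x1 + \<kappa>\<^sup>2 * x2) / K * \<kappa> - (\<kappa> * x1 + x2 + \<kappa>\<^sup>2 * x0) / K = x2"
    using K by (simp_all add: field_simps) (simp_all add: K_def algebra_simps power2_eq_square power3_eq_cube)
  ultimately show ?thesis unfolding x by simp
qed

lemma in_cone_top:
  assumes "range B \<subseteq> S" and X: "\<And>i. X i p \<ge> 0"
  shows "in_cone S i (X i p, X (i + 1) p, X (i + 2) p, sigma p)"
proof -
  have k1: "\<kappa> - 1 > 0" using kappa by simp
  have "in_cone S i (\<kappa> - 1, 0, 0, \<kappa> - 1)" "in_cone S i (0, \<kappa> - 1, 0, \<kappa> - 1)" "in_cone S i (0, 0, \<kappa> - 1, \<kappa> - 1)"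
    using in_cone_B[of i S] assms(1) by auto
  then have "in_cone S i ((X i p / (\<kappa> - 1)) *\<^sub>R (\<kappa> - 1, 0, 0, \<kappa> - 1) +
      (X (i + 1) p / (\<kappa> - 1)) *\<^sub>R (0, \<kappa> - 1, 0, \<kappa> - 1) +
      (X (i + 2) p / (\<kappa> - 1)) *\<^sub>R (0, 0, \<kappa> - 1, \<kappa> - 1))"
    using X k1 by (intro in_cone_add in_cone_scale) auto
  then show ?thesis unfolding sigma_cyclic[of p i] using k1 by simp
qed

end

subsection \<open>The facets of the cupola\<close>

datatype facet_label = Bottom | Top | Side_B 3 nat | Side_A 3 nat

locale cupola_config = cupola_frame +
  fixes m :: nat and s :: "nat \<Rightarrow> real"
  assumes s_0: "s 0 = 0" and s_last: "s (m + 1) = 1"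
    and s_less: "\<And>k l. k < l \<Longrightarrow> l \<le> m + 1 \<Longrightarrow> s k < s l"
    and s_third: "\<And>k. k \<le> m \<Longrightarrow> s k \<le> 1 / 3"
begin

lemma s_bounds: "k \<le> m + 1 \<Longrightarrow> 0 \<le> s k \<and> s k \<le> 1"
  using s_less[of 0 k] s_less[of k "m + 1"] s_0 s_last
  by (cases "k = 0"; cases "k = m + 1") auto

definition q :: "3 \<Rightarrow> nat \<Rightarrow> point" where "q i k = vtx i (s k)"

definition W :: "point set" where "W = (\<Union>i. q i ` {0..m + 1})"

lemma q_in_W: "k \<le> m + 1 \<Longrightarrow> q i k \<in> W" unfolding W_def by (intro UN_I[of i] imageI) auto

lemma A_q: "A i = q i 0" and B_q: "B i = q (i + 2) (m + 1)"
  by (simp_all only: A_def B_def q_def s_0 s_last)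

text \<open>
  The affine function with the values \<open>lo k\<close> at 0 and \<open>hi k\<close> at 1 is the secant of the concave
  function \<open>bump\<close> through \<open>s k\<close> and \<open>s (k + 1)\<close>.  The coefficients in \<open>facet_fun\<close> below come from
  interpolating \<open>zeta\<close> linearly over the projected facet: it is 1 at \<open>B i\<close>, 0 at \<open>A (i + 1)\<close>,
  and this secant along the line from \<open>A i\<close> to \<open>B (i + 1)\<close>.
\<close>

definition lo :: "nat \<Rightarrow> real" where "lo k = s k * s (k + 1) / 2"
definition hi :: "nat \<Rightarrow> real" where "hi k = 1 + (1 - s k) * (1 - s (k + 1)) / 2"

lemma secant: "lo k * (1 - t) + hi k * t - bump t = (t - s k) * (t - s (k + 1)) / 2"
  unfolding lo_def hi_def bump_def by (simp add: field_simps)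

lemma lo_hi_bounds:
  assumes "k \<le> m" shows "0 \<le> lo k" "lo k \<le> 1 / 6" "1 \<le> hi k" "hi k \<le> 3 / 2"
proof -
  have b: "0 \<le> s k" "s k \<le> 1" "0 \<le> s (k + 1)" "s (k + 1) \<le> 1" "s k \<le> 1 / 3"
    using s_bounds[of k] s_bounds[of "k + 1"] s_third assms by auto
  then show "0 \<le> lo k" "1 \<le> hi k" unfolding lo_def hi_def by auto
  \<comment> \<open>Only the left node is known to be at most 1 / 3; for \<open>k = m\<close> the
    right one is 1.\<close>
  have "s k * s (k + 1) \<le> (1 / 3) * 1" using b by (intro mult_mono) auto
  then show "lo k \<le> 1 / 6" unfolding lo_def by simp
  have "(1 - s k) * (1 - s (k + 1)) \<le> 1 * 1" using b by (intro mult_mono) auto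
  then show "hi k \<le> 3 / 2" unfolding hi_def by simp
qed

fun facet_fun :: "facet_label \<Rightarrow> point \<Rightarrow> real" where
  "facet_fun Bottom = lin 0 0 0 0 1"
| "facet_fun Top = lin 0 1 1 1 (- 1)"
| "facet_fun (Side_B i k) = lin i 1 (hi k) (\<kappa> - lo k * (\<kappa> - 1)) (- 1)"
| "facet_fun (Side_A i k) = lin i (hi k * \<kappa>) (hi k) (hi k * \<kappa>\<^sup>2 - lo k * (\<kappa> - 1)) (- 1)"

fun facet_verts :: "facet_label \<Rightarrow> point set" where
  "facet_verts Bottom = range A"
| "facet_verts Top = range B"
| "facet_verts (Side_B i k) = {B i, q i k, q i (k + 1)}"
| "facet_verts (Side_A i k) = {A (i + 1), q i k, q i (k + 1)}"

definition labels :: "facet_label set" where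
  "labels = {Bottom, Top} \<union> (\<lambda>(i, k). Side_B i k) ` (UNIV \<times> {0..m}) \<union>
     (\<lambda>(i, k). Side_A i k) ` (UNIV \<times> {0..m})"

lemma Side_in_labels: "k \<le> m \<Longrightarrow> Side_B i k \<in> labels" "k \<le> m \<Longrightarrow> Side_A i k \<in> labels"
  unfolding labels_def by auto

lemma labels_cases:
  assumes "g \<in> labels"
  obtains "g = Bottom" | "g = Top" | i k where "k \<le> m" "g = Side_B i k" | i k where "k \<le> m" "g = Side_A i k"
  using assms unfolding labels_def by auto

lemma image_labels:
  "h ` labels = {h Bottom, h Top} \<union> (\<Union>i. \<Union>k\<in>{0..m}. {h (Side_B i k), h (Side_A i k)})"
  unfolding labels_def by auto

lemma facet_fun_Bottom: "facet_fun Bottom p = zeta p"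
  and facet_fun_Top: "facet_fun Top p = sigma p - zeta p"
  by (simp_all add: lin_eq_zeta lin_eq_sigma_zeta)

lemma affine_facet_fun: "affine_fun (facet_fun g)"
  by (cases g) (auto simp del: One_nat_def intro: affine_lin)

section \<open>Signs of the side facet functions at the vertices\<close>

context
  fixes k :: nat and t :: real
  assumes k: "k \<le> m" and t: "0 \<le> t" "t \<le> 1"
begin

lemma side_own:
  "facet_fun (Side_B i k) (vtx i t) = (\<kappa> - 1) * ((t - s k) * (t - s (k + 1)) / 2) / weight t"
  "facet_fun (Side_A i k) (vtx i t) = (\<kappa> - 1) * ((t - s k) * (t - s (k + 1)) / 2) / weight t"
  unfolding facet_fun.simps lin_vtx[OF t] secant[symmetric]
  by (simp_all add: algebra_simps power2_eq_square)

text \<open>The numerator is a sum of nonnegative terms, among which \<open>1 - bump t\<close> is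
  positive for \<open>t = 0\<close> and the term with \<open>t * (\<kappa> - 1)\<close> for
  \<open>t > 0\<close>.\<close>

lemma side_B_1: "facet_fun (Side_B i k) (vtx (i + 1) t) > 0"
proof -
  note b = lo_hi_bounds[OF k] bump_bounds[OF t]
  have "t * (\<kappa> - 1) * (1 - lo k) \<ge> 0" using t kappa b by auto
  moreover have "t * (\<kappa> - 1) * (1 - lo k) > 0 \<or> bump t < 1"
    using t kappa b by (cases "t = 0") auto
  ultimately have "(1 - bump t) + t * (\<kappa> - 1) * (1 - lo k) > 0" using b by linarith
  then have "(\<kappa> - 1) * ((1 - bump t) + t * (\<kappa> - 1) * (1 - lo k)) > 0"
    using kappa by simp
  moreover have "(hi k - 1) * (1 - t) * \<kappa> \<ge> 0" using t b kappa by auto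
  ultimately have "(\<kappa> - 1) * ((1 - bump t) + t * (\<kappa> - 1) * (1 - lo k)) + (hi k - 1) * (1 - t) * \<kappa> > 0"
    by linarith
  moreover have "(\<kappa> - 1) * ((1 - bump t) + t * (\<kappa> - 1) * (1 - lo k)) + (hi k - 1) * (1 - t) * \<kappa> =
    hi k * (1 - t) * \<kappa> + (\<kappa> - lo k * (\<kappa> - 1)) * (\<kappa> - 1) * t - 1 * (1 - t) + - 1 * (\<kappa> - 1) * bump t"
    by (simp add: algebra_simps)
  ultimately show ?thesis
    unfolding facet_fun.simps lin_vtx[OF t] using weight_pos[OF t] by simp
qed

text \<open>The factor \<open>1 - t\<close> reflects that this arc ends at \<open>B i\<close>, a
  corner of the facet. Positivity of the cofactor rests on \<open>\<kappa> \<ge> 2\<close> and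
  \<open>lo k \<le> 1 / 6\<close>.\<close>

lemma side_B_2: "\<exists>r>0. facet_fun (Side_B i k) (vtx (i + 2) t) = (1 - t) * r"
proof -
  note b = lo_hi_bounds[OF k]
  define r where "r = \<kappa>\<^sup>2 - lo k * \<kappa> * (\<kappa> - 1) - hi k - (\<kappa> - 1) * t / 2"
  have "(\<kappa> - 1) * t \<le> (\<kappa> - 1) * 1" using t kappa by (intro mult_left_mono) auto
  moreover have "(\<kappa> * (\<kappa> - 1)) * (1 - lo k) \<ge> (2 * (\<kappa> - 1)) * (5 / 6)"
    using kappa b by (intro mult_mono) auto
  moreover have "r = (\<kappa> * (\<kappa> - 1)) * (1 - lo k) + \<kappa> - hi k - (\<kappa> - 1) * t / 2"
    unfolding r_def by (simp add: algebra_simps power2_eq_square)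
  moreover have "y + \<kappa> - h - x / 2 > 0" if "x \<le> (\<kappa> - 1) * 1" "y \<ge> (2 * (\<kappa> - 1)) * (5 / 6)" "h \<le> 3 / 2"
    for x y h using that kappa by (simp add: field_simps)
  ultimately have "r > 0" using b(4) by simp
  moreover have "(\<kappa> - lo k * (\<kappa> - 1)) * (1 - t) * \<kappa> + 1 * (\<kappa> - 1) * t - hi k * (1 - t) + - 1 * (\<kappa> - 1) * bump t
      = (1 - t) * r"
    unfolding r_def bump_def by (simp add: field_simps power2_eq_square)
  then have "facet_fun (Side_B i k) (vtx (i + 2) t) = (1 - t) * (r / weight t)"
    unfolding facet_fun.simps lin_vtx[OF t] by simp
  ultimately show ?thesis using weight_pos[OF t] by (intro exI[of _ "r / weight t"]) simp
qed

text \<open>The factor \<open>t\<close> reflects that this arc starts at \<open>A (i + 1)\<close>, a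
  corner of the facet.\<close>

lemma side_A_1: "\<exists>r>0. facet_fun (Side_A i k) (vtx (i + 1) t) = t * r"
proof -
  note b = lo_hi_bounds[OF k]
  define r where "r = (\<kappa> - 1) * (hi k * \<kappa>\<^sup>2 - lo k * (\<kappa> - 1) - (3 - t) / 2)"
  have "hi k * \<kappa>\<^sup>2 \<ge> 1 * (2 * \<kappa>)" using b kappa unfolding power2_eq_square by (intro mult_mono) auto
  moreover have "lo k * (\<kappa> - 1) \<le> (1 / 6) * (\<kappa> - 1)" using b kappa by (intro mult_right_mono) auto
  moreover have "x - y - (3 - t) / 2 > 0" if "x \<ge> 1 * (2 * \<kappa>)" "y \<le> (1 / 6) * (\<kappa> - 1)" for x y
    using that kappa t by (simp add: field_simps)
  ultimately have "hi k * \<kappa>\<^sup>2 - lo k * (\<kappa> - 1) - (3 - t) / 2 > 0" by simp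
  then have "r > 0" unfolding r_def using kappa by simp
  moreover have "hi k * (1 - t) * \<kappa> + (hi k * \<kappa>\<^sup>2 - lo k * (\<kappa> - 1)) * (\<kappa> - 1) * t - hi k * \<kappa> * (1 - t) +
      - 1 * (\<kappa> - 1) * bump t = t * r"
    unfolding r_def bump_def by (simp add: field_simps power2_eq_square)
  then have "facet_fun (Side_A i k) (vtx (i + 1) t) = t * (r / weight t)"
    unfolding facet_fun.simps lin_vtx[OF t] by simp
  ultimately show ?thesis using weight_pos[OF t] by (intro exI[of _ "r / weight t"]) simp
qed

lemma side_A_2: "facet_fun (Side_A i k) (vtx (i + 2) t) > 0"
proof -
  note b = lo_hi_bounds[OF k]
  have "hi k * \<kappa> \<ge> 1 * 2" using b kappa by (intro mult_mono) auto
  then have "t * (hi k * \<kappa>) \<ge> t * 2" using t by (intro mult_left_mono) auto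
  moreover have "bump t = 3 / 2 * t - t * t / 2" unfolding bump_def by (simp add: field_simps)
  moreover have "t * t \<ge> 0" by simp
  ultimately have *: "t * (hi k * \<kappa>) - bump t \<ge> t / 2" by linarith
  have "hi k * (\<kappa>\<^sup>2 + \<kappa> + 1) \<ge> 1 * (\<kappa>\<^sup>2 + \<kappa> + 1)" using b kappa by (intro mult_right_mono) auto
  moreover have "lo k * \<kappa> \<le> (1 / 6) * \<kappa>" using b kappa by (intro mult_right_mono) auto
  moreover have "\<kappa>\<^sup>2 \<ge> 0" by simp
  moreover have "x - y > 0" if "x \<ge> 1 * (z + \<kappa> + 1)" "y \<le> (1 / 6) * \<kappa>" "z \<ge> 0" for x y z
    using that kappa by simp
  ultimately have "hi k * (\<kappa>\<^sup>2 + \<kappa> + 1) - lo k * \<kappa> > 0" by blast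
  then have r: "(\<kappa> - 1) * (hi k * (\<kappa>\<^sup>2 + \<kappa> + 1) - lo k * \<kappa>) > 0" (is "?r > 0") using kappa by simp
  have "(1 - t) * ?r + (\<kappa> - 1) * (t * (hi k * \<kappa>) - bump t) > 0"
  proof (cases "t = 1")
    case True
    then show ?thesis using * kappa by (simp add: mult_pos_pos)
  next
    case False
    then have "1 - t > 0" using t by simp
    then have "(1 - t) * ?r > 0" using r by (rule mult_pos_pos)
    moreover have "(\<kappa> - 1) * (t * (hi k * \<kappa>) - bump t) \<ge> 0" using * t kappa by (intro mult_nonneg_nonneg) auto
    ultimately show ?thesis by linarith
  qed
  moreover have "(1 - t) * ?r + (\<kappa> - 1) * (t * (hi k * \<kappa>) - bump t) =
    (hi k * \<kappa>\<^sup>2 - lo k * (\<kappa> - 1)) * (1 - t) * \<kappa> + hi k * \<kappa> * (\<kappa> - 1) * t - hi k * (1 - t) + - 1 * (\<kappa> - 1) * bump t"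
    by (simp add: algebra_simps power2_eq_square)
  ultimately show ?thesis
    unfolding facet_fun.simps lin_vtx[OF t] using weight_pos[OF t] by simp
qed

end

text \<open>No node lies strictly between two consecutive ones. Together with \<open>secant\<close>
  this is the discrete concavity of \<open>bump\<close>: all nodes of an arc lie on or below each of
  its secants.\<close>

lemma s_sign:
  assumes "k \<le> m" "l \<le> m + 1"
  shows "(s l - s k) * (s l - s (k + 1)) \<ge> 0"
    and "(s l - s k) * (s l - s (k + 1)) = 0 \<longleftrightarrow> l = k \<or> l = k + 1"
proof -
  consider "l < k" | "l = k" | "l = k + 1" | "l > k + 1" by linarith
  then show "(s l - s k) * (s l - s (k + 1)) \<ge> 0"
  proof cases
    case 1
    then show ?thesis using s_less[of l k] s_less[of l "k + 1"] assms by (intro mult_nonpos_nonpos) auto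
  next
    case 4
    then show ?thesis using s_less[of k l] s_less[of "k + 1" l] assms by (intro mult_nonneg_nonneg) auto
  qed auto
  have "s l = s j \<longleftrightarrow> l = j" if "j \<le> m + 1" for j
    using s_less[of l j] s_less[of j l] assms(2) that by (cases l j rule: linorder_cases) auto
  then show "(s l - s k) * (s l - s (k + 1)) = 0 \<longleftrightarrow> l = k \<or> l = k + 1"
    using assms by simp
qed

lemma facet_fun_q:
  assumes g: "g \<in> labels" and l: "l \<le> m + 1"
  shows "facet_fun g (q j l) \<ge> 0 \<and> (facet_fun g (q j l) = 0 \<longrightarrow> q j l \<in> facet_verts g)"
proof -
  note t = s_bounds[OF l, THEN conjunct1] s_bounds[OF l, THEN conjunct2]
  note w = weight_pos[OF t]
  have one: "l = m + 1" if "s l = 1" using that s_less[of l "m + 1"] l s_last by (cases "l = m + 1") auto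
  have zero: "l = 0" if "s l = 0" using that s_less[of 0 l] l s_0 by (cases "l = 0") auto
  from g show ?thesis
  proof (cases rule: labels_cases)
    case 1
    have "facet_fun g (q j l) = (\<kappa> - 1) * bump (s l) / weight (s l)"
      unfolding 1 facet_fun_Bottom q_def zeta_vtx[OF t] ..
    moreover have "bump (s l) > 0" if "l \<noteq> 0" using bump_strict_mono[of 0 "s l"] that s_less[of 0 l] s_0 l t by auto
    ultimately show ?thesis using w kappa 1 bump_bounds[OF t] by (cases "l = 0") (auto simp: A_q s_0)
  next
    case 2
    have "facet_fun g (q j l) = (\<kappa> - 1) * (1 - bump (s l)) / weight (s l)"
      unfolding 2 facet_fun_Top q_def zeta_vtx[OF t] sigma_vtx
      by (simp add: right_diff_distrib diff_divide_distrib)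
    moreover have "bump (s l) < 1" if "l \<noteq> m + 1"
      using bump_strict_mono[of "s l" 1] that s_less[of l "m + 1"] s_last l t by auto
    moreover have "q j (m + 1) = B (j + 1)" by (simp add: B_q)
    ultimately show ?thesis using w kappa 2 bump_bounds[OF t] by (cases "l = m + 1") (auto simp: s_last)
  next
    case (3 i k)
    consider "j = i" | "j = i + 1" | "j = i + 2" using cyclic3_cases by blast
    then show ?thesis
    proof cases
      case 1
      have "facet_fun g (q j l) = (s l - s k) * (s l - s (k + 1)) * ((\<kappa> - 1) / (2 * weight (s l)))"
        unfolding 3 1 q_def side_own[OF 3(1) t] using w by (simp add: field_simps)
      moreover have "(\<kappa> - 1) / (2 * weight (s l)) > 0" using w kappa by simp
      ultimately show ?thesis
        using s_sign[OF 3(1) l] 1 by (auto simp: 3 simp del: mult_eq_0_iff facet_fun.simps times_divide_eq_right)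
    next
      case 2
      then show ?thesis unfolding 3 q_def using side_B_1[OF 3(1) t, of i] by (auto simp del: facet_fun.simps)
    next
      case j: 3
      obtain r where r: "r > 0" "facet_fun g (q j l) = (1 - s l) * r"
        unfolding 3 j q_def using side_B_2[OF 3(1) t] by blast
      then show ?thesis using t one unfolding 3 j by (auto simp: B_q)
    qed
  next
    case (4 i k)
    consider "j = i" | "j = i + 1" | "j = i + 2" using cyclic3_cases by blast
    then show ?thesis
    proof cases
      case 1
      have "facet_fun g (q j l) = (s l - s k) * (s l - s (k + 1)) * ((\<kappa> - 1) / (2 * weight (s l)))"
        unfolding 4 1 q_def side_own[OF 4(1) t] using w by (simp add: field_simps)
      moreover have "(\<kappa> - 1) / (2 * weight (s l)) > 0" using w kappa by simp
      ultimately show ?thesis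
        using s_sign[OF 4(1) l] 1 by (auto simp: 4 simp del: mult_eq_0_iff facet_fun.simps times_divide_eq_right)
    next
      case 3
      then show ?thesis unfolding 4 q_def using side_A_2[OF 4(1) t, of i] by (auto simp del: facet_fun.simps)
    next
      case j: 2
      obtain r where r: "r > 0" "facet_fun g (q j l) = s l * r"
        unfolding 4 j q_def using side_A_1[OF 4(1) t] by blast
      then show ?thesis using t zero unfolding 4 j by (auto simp: A_q)
    qed
  qed
qed

lemma facet_fun_verts:
  assumes g: "g \<in> labels" and p: "p \<in> facet_verts g"
  shows "facet_fun g p = 0 \<and> p \<in> W"
proof -
  from g show ?thesis
  proof (cases rule: labels_cases)
    case 1
    then obtain i where "p = A i" using p by auto
    then show ?thesis unfolding 1 facet_fun_Bottom by (simp add: A_def zeta_vtx q_in_W flip: A_q) (simp add: A_q q_in_W flip: A_def)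
  next
    case 2
    then obtain i where "p = B i" using p by auto
    then show ?thesis unfolding 2 facet_fun_Top by (auto simp: B_def zeta_vtx sigma_vtx) (auto simp: B_q q_in_W simp flip: B_def)
  next
    case (3 i k)
    have b: "0 \<le> s k" "s k \<le> 1" "0 \<le> s (k + 1)" "s (k + 1) \<le> 1"
      using s_bounds[of k] s_bounds[of "k + 1"] 3 by auto
    have "facet_fun g (B i) = 0" unfolding 3 facet_fun.simps lin_B by simp
    moreover have "facet_fun g (q i k) = 0" "facet_fun g (q i (k + 1)) = 0"
      unfolding 3 q_def using side_own[OF 3(1)] b by (simp_all del: facet_fun.simps)
    ultimately show ?thesis using p 3 q_in_W by (auto simp: B_q)
  next
    case (4 i k)
    have b: "0 \<le> s k" "s k \<le> 1" "0 \<le> s (k + 1)" "s (k + 1) \<le> 1"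
      using s_bounds[of k] s_bounds[of "k + 1"] 4 by auto
    have "facet_fun g (A (i + 1)) = 0" unfolding 4 facet_fun.simps lin_A by simp
    moreover have "facet_fun g (q i k) = 0" "facet_fun g (q i (k + 1)) = 0"
      unfolding 4 q_def using side_own[OF 4(1)] b by (simp_all del: facet_fun.simps)
    ultimately show ?thesis using p 4 q_in_W by (auto simp: A_q)
  qed
qed

section \<open>Completeness of the facet inequalities\<close>

lemma interval_index:
  assumes "0 \<le> r" "r \<le> 1" shows "\<exists>k\<le>m. s k \<le> r \<and> r \<le> s (k + 1)"
proof -
  have "r \<le> s (n + 1) \<Longrightarrow> \<exists>k\<le>n. s k \<le> r \<and> r \<le> s (k + 1)" for n
  proof (induction n)
    case 0
    then show ?case using assms s_0 by auto
  next
    case (Suc n)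
    show ?case
    proof (cases "r \<le> s (n + 1)")
      case True
      then obtain k where "k \<le> n" "s k \<le> r \<and> r \<le> s (k + 1)" using Suc.IH by blast
      then show ?thesis by (intro exI[of _ k]) auto
    next
      case False
      then show ?thesis using Suc.prems by (intro exI[of _ "Suc n"]) auto
    qed
  qed
  then show ?thesis using assms s_last by simp
qed

text \<open>\<open>P\<close> and \<open>R\<close> are the masses at the ends \<open>A i\<close> and
  \<open>B (i + 1)\<close>. The ratio \<open>R / (P + R)\<close> selects the interval between two
  nodes, and distributing the total mass on these nodes reaches the height of the secant.\<close>

lemma arc_combination:
  assumes "P \<ge> 0" "R \<ge> 0"
  obtains k c1 c2 where "k \<le> m" "c1 \<ge> 0" "c2 \<ge> 0"
    "c1 * (1 - s k) + c2 * (1 - s (k + 1)) = P" "c1 * s k + c2 * s (k + 1) = R"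
    "c1 * bump (s k) + c2 * bump (s (k + 1)) = lo k * P + hi k * R"
proof -
  note result = that
  have *: thesis if "k \<le> m" "c1 \<ge> 0" "c2 \<ge> 0" "c1 * (1 - s k) + c2 * (1 - s (k + 1)) = P"
    "c1 * s k + c2 * s (k + 1) = R" for k c1 c2
  proof -
    have *: "bump (s k) = lo k * (1 - s k) + hi k * s k"
      "bump (s (k + 1)) = lo k * (1 - s (k + 1)) + hi k * s (k + 1)"
      using secant[of k "s k"] secant[of k "s (k + 1)"] by simp_all
    have "c1 * bump (s k) + c2 * bump (s (k + 1)) = lo k * P + hi k * R"
      unfolding that(4,5)[symmetric] * by (simp add: algebra_simps)
    with that show thesis by (rule result)
  qed
  show thesis
  proof (cases "P + R = 0")
    case True
    then show ?thesis using *[of 0 0 0] assms by simp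
  next
    case False
    define T where "T = P + R"
    have T: "T > 0" using False assms unfolding T_def by simp
    obtain k where k: "k \<le> m" "s k \<le> R / T" "R / T \<le> s (k + 1)"
      using interval_index[of "R / T"] T assms unfolding T_def by auto
    define D where "D = s (k + 1) - s k"
    have D: "D > 0" using s_less[of k "k + 1"] k unfolding D_def by simp
    define e1 where "e1 = (s (k + 1) - R / T) / D"
    define e2 where "e2 = (R / T - s k) / D"
    have e: "e1 \<ge> 0" "e2 \<ge> 0" using k D unfolding e1_def e2_def by auto
    have sum: "e1 + e2 = 1" unfolding e1_def e2_def add_divide_distrib[symmetric] using D by (simp add: D_def)
    have "e1 * s k + e2 * s (k + 1) = ((s (k + 1) - R / T) * s k + (R / T - s k) * s (k + 1)) / D"
      unfolding e1_def e2_def by (simp add: add_divide_distrib)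
    also have "(s (k + 1) - R / T) * s k + (R / T - s k) * s (k + 1) = R / T * D"
      unfolding D_def by (simp add: algebra_simps)
    finally have e3: "e1 * s k + e2 * s (k + 1) = R / T" using D by simp
    show ?thesis
    proof (rule *[OF k(1), of "T * e1" "T * e2"])
      have "T * e1 * s k + T * e2 * s (k + 1) = T * (e1 * s k + e2 * s (k + 1))" by (simp add: algebra_simps)
      also have "\<dots> = R" unfolding e3 using T by simp
      finally show R: "T * e1 * s k + T * e2 * s (k + 1) = R" .
      have "T * e1 * (1 - s k) + T * e2 * (1 - s (k + 1)) = T * (e1 + e2) - (T * e1 * s k + T * e2 * s (k + 1))"
        by (simp add: algebra_simps)
      also have "\<dots> = P" unfolding sum R by (simp add: T_def)
      finally show "T * e1 * (1 - s k) + T * e2 * (1 - s (k + 1)) = P" .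
    qed (use T e in auto)
  qed
qed

text \<open>Where \<open>X (i + 2) < 0\<close>, the roof consists of two fans, around
  \<open>B i\<close> and around \<open>A (i + 1)\<close>, joined along the arc. The sign of
  \<open>q'\<close> tells on which side of the plane of the arc the point lies; removing a multiple
  of the corresponding fan centre moves it into that plane, where \<open>arc_combination\<close>
  finds the facet above it.\<close>

lemma complete_aux:
  fixes p :: point and i :: 3
  assumes nonneg: "\<And>g. g \<in> labels \<Longrightarrow> facet_fun g p \<ge> 0"
    and i: "X (i + 2) p < 0" "X (i + 1) p \<ge> 0"
    and floor: "\<kappa> * X i p + X (i + 1) p + \<kappa>\<^sup>2 * X (i + 2) p \<ge> 0"
    and bottom: "in_cone W i (X i p, X (i + 1) p, X (i + 2) p, 0)"
  shows "p \<in> convex hull W"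
proof -
  define x0 x1 x2 where "x0 = X i p" and "x1 = X (i + 1) p" and "x2 = X (i + 2) p"
  note x = x0_def[symmetric] x1_def[symmetric] x2_def[symmetric]
  define q' where "q' = x0 + \<kappa> * x2"
  \<comment> \<open>The fan centres have \<open>X (i + 2) = 0\<close>, so \<open>x2\<close> alone
    determines the mass \<open>P\<close> at \<open>A i\<close>.\<close>
  define P where "P = (\<kappa> - 1) * (- x2)"
  have k1: "\<kappa> - 1 > 0" using kappa by simp
  have P: "P \<ge> 0" unfolding P_def using i(1) k1 unfolding x by (intro mult_nonneg_nonneg) auto
  have z: "zeta p \<ge> 0" using nonneg[of Bottom] facet_fun_Bottom[of p] by (simp add: labels_def)
  have arc: "in_cone W i (\<kappa> * P / (\<kappa> - 1), c1 * s k + c2 * s (k + 1), - P / (\<kappa> - 1),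
      c1 * bump (s k) + c2 * bump (s (k + 1)))"
    if k: "k \<le> m" "c1 \<ge> 0" "c2 \<ge> 0" "c1 * (1 - s k) + c2 * (1 - s (k + 1)) = P" for k c1 c2
  proof -
    have b: "0 \<le> s k" "s k \<le> 1" "0 \<le> s (k + 1)" "s (k + 1) \<le> 1"
      using s_bounds[of k] s_bounds[of "k + 1"] k by auto
    have "in_cone W i ((c1 / (\<kappa> - 1)) *\<^sub>R ((1 - s k) * \<kappa>, (\<kappa> - 1) * s k, - (1 - s k), (\<kappa> - 1) * bump (s k)) +
       (c2 / (\<kappa> - 1)) *\<^sub>R ((1 - s (k + 1)) * \<kappa>, (\<kappa> - 1) * s (k + 1), - (1 - s (k + 1)), (\<kappa> - 1) * bump (s (k + 1))))"
      using k k1 q_in_W[of k i] q_in_W[of "k + 1" i] b unfolding q_def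
      by (intro in_cone_add in_cone_scale in_cone_vtx(1)) auto
    moreover have "c1 / (\<kappa> - 1) * ((1 - s k) * \<kappa>) + c2 / (\<kappa> - 1) * ((1 - s (k + 1)) * \<kappa>) = \<kappa> * P / (\<kappa> - 1)"
      unfolding k(4)[symmetric] by (simp add: divide_inverse algebra_simps)
    moreover have "c1 / (\<kappa> - 1) * - (1 - s k) + c2 / (\<kappa> - 1) * - (1 - s (k + 1)) = - P / (\<kappa> - 1)"
      unfolding k(4)[symmetric] by (simp add: divide_inverse algebra_simps)
    ultimately show ?thesis using k1 by simp
  qed
  show ?thesis
  proof (cases "q' \<ge> 0")
    case True
    obtain k c1 c2 where k: "k \<le> m" "c1 \<ge> 0" "c2 \<ge> 0"
      "c1 * (1 - s k) + c2 * (1 - s (k + 1)) = P" "c1 * s k + c2 * s (k + 1) = x1"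
      "c1 * bump (s k) + c2 * bump (s (k + 1)) = lo k * P + hi k * x1"
      using arc_combination[of P x1] P i unfolding x by blast
    have "in_cone W i (\<kappa> - 1, 0, 0, \<kappa> - 1)"
      using in_cone_vtx(3)[of 1 i W] q_in_W[of "m + 1" "i + 2"] by (simp add: q_def s_last[simplified])
    then have "in_cone W i ((\<kappa> * P / (\<kappa> - 1), x1, - P / (\<kappa> - 1), lo k * P + hi k * x1) + (q' / (\<kappa> - 1)) *\<^sub>R (\<kappa> - 1, 0, 0, \<kappa> - 1))"
      using arc[OF k(1-4)] True k1 unfolding k(5,6) by (intro in_cone_add in_cone_scale) auto
    moreover have "\<kappa> * P / (\<kappa> - 1) + q' = x0" "- P / (\<kappa> - 1) = x2"
      unfolding P_def q'_def using k1 by (simp_all add: field_simps)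
    ultimately have "in_cone W i (x0, x1, x2, lo k * P + hi k * x1 + q')" using k1 by simp
    moreover have "zeta p \<le> lo k * P + hi k * x1 + q'"
    proof -
      have "facet_fun (Side_B i k) p \<ge> 0" using nonneg k(1) Side_in_labels by blast
      then show ?thesis unfolding facet_fun.simps lin_def x P_def q'_def by (simp add: algebra_simps)
    qed
    ultimately have "in_cone W i (x0, x1, x2, zeta p)" using in_cone_below z bottom unfolding x by blast
    then show ?thesis unfolding x0_def x1_def x2_def by (rule in_cone_self)
  next
    case False
    define R where "R = x1 + \<kappa> * q'"
    have "\<kappa> * x0 + x1 + \<kappa>\<^sup>2 * x2 = R" unfolding R_def q'_def by (simp add: algebra_simps power2_eq_square)
    then have R: "R \<ge> 0" using floor unfolding x by simp
    obtain k c1 c2 where k: "k \<le> m" "c1 \<ge> 0" "c2 \<ge> 0"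
      "c1 * (1 - s k) + c2 * (1 - s (k + 1)) = P" "c1 * s k + c2 * s (k + 1) = R"
      "c1 * bump (s k) + c2 * bump (s (k + 1)) = lo k * P + hi k * R"
      using arc_combination[OF P R] by blast
    have "in_cone W i (- 1, \<kappa>, 0, 0)"
      using in_cone_vtx(2)[of 0 i W] q_in_W[of 0 "i + 1"] by (simp add: q_def s_0)
    then have "in_cone W i ((\<kappa> * P / (\<kappa> - 1), R, - P / (\<kappa> - 1), lo k * P + hi k * R) + (- q') *\<^sub>R (- 1, \<kappa>, 0, 0))"
      using arc[OF k(1-4)] False k1 unfolding k(5,6) by (intro in_cone_add in_cone_scale) auto
    moreover have "\<kappa> * P / (\<kappa> - 1) + q' = x0" "- P / (\<kappa> - 1) = x2" "R - q' * \<kappa> = x1"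
      unfolding P_def q'_def R_def using k1 by (simp_all add: field_simps)
    ultimately have "in_cone W i (x0, x1, x2, lo k * P + hi k * R)" by simp
    moreover have "zeta p \<le> lo k * P + hi k * R"
    proof -
      have "facet_fun (Side_A i k) p \<ge> 0" using nonneg k(1) Side_in_labels by blast
      then show ?thesis unfolding facet_fun.simps lin_def x P_def q'_def R_def
        by (simp add: algebra_simps power2_eq_square)
    qed
    ultimately have "in_cone W i (x0, x1, x2, zeta p)" using in_cone_below z bottom unfolding x by blast
    then show ?thesis unfolding x0_def x1_def x2_def by (rule in_cone_self)
  qed
qed

lemma complete:
  assumes nonneg: "\<And>g. g \<in> labels \<Longrightarrow> facet_fun g p \<ge> 0"
  shows "p \<in> convex hull W"
proof -
  have z: "zeta p \<ge> 0" using nonneg[of Bottom] facet_fun_Bottom[of p] by (simp add: labels_def)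
  have top: "zeta p \<le> sigma p" using nonneg[of Top] facet_fun_Top[of p] by (simp add: labels_def)
  \<comment> \<open>For \<open>k = 0\<close> the number \<open>lo k\<close> is 0, so the function of
    \<open>Side_A i 0\<close> is a positive multiple of the floor form minus
    \<open>zeta\<close>.\<close>
  have floor: "\<kappa> * X i p + X (i + 1) p + \<kappa>\<^sup>2 * X (i + 2) p \<ge> 0" for i
  proof -
    have "facet_fun (Side_A i 0) p \<ge> 0" using nonneg Side_in_labels by blast
    moreover have "facet_fun (Side_A i 0) p = hi 0 * (\<kappa> * X i p + X (i + 1) p + \<kappa>\<^sup>2 * X (i + 2) p) - zeta p"
      by (simp add: lin_def lo_def s_0 algebra_simps)
    ultimately have "hi 0 * (\<kappa> * X i p + X (i + 1) p + \<kappa>\<^sup>2 * X (i + 2) p) \<ge> 0" using z by linarith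
    then show ?thesis using lo_hi_bounds(3)[of 0] by (simp add: zero_le_mult_iff)
  qed
  have W: "range A \<subseteq> W" "range B \<subseteq> W" using q_in_W by (auto simp: A_q B_q)
  have "lin i \<kappa> 1 (\<kappa>\<^sup>2) 0 p \<ge> 0" for i using floor[of i] unfolding lin_def by simp
  then have bottom: "in_cone W i (X i p, X (i + 1) p, X (i + 2) p, 0)" for i
    by (rule in_cone_bottom[OF W(1)])
  show ?thesis
  proof (cases "\<forall>i. X i p \<ge> 0")
    case True
    then have "in_cone W 0 (X 0 p, X (0 + 1) p, X (0 + 2) p, sigma p)"
      using in_cone_top[OF W(2)] by blast
    then have "in_cone W 0 (X 0 p, X (0 + 1) p, X (0 + 2) p, zeta p)"
      using in_cone_below z top bottom[of 0] by blast
    then show ?thesis by (rule in_cone_self)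
  next
    case False
    \<comment> \<open>Otherwise a negative coordinate makes its predecessor negative, hence all
      three, against \<open>floor\<close>.\<close>
    have "\<exists>i. X (i + 2) p < 0 \<and> X (i + 1) p \<ge> 0"
    proof (rule ccontr)
      assume "\<not> ?thesis"
      then have *: "X (i + 2) p < 0 \<Longrightarrow> X (i + 1) p < 0" for i by (meson not_le)
      obtain j where j: "X j p < 0" using False by (auto simp: not_le)
      have "X (j + 2) p < 0" using *[of "j + 1"] j by simp
      moreover have "X (j + 1) p < 0" using *[of j] \<open>X (j + 2) p < 0\<close> by simp
      ultimately have "\<kappa> * X j p < 0" "\<kappa>\<^sup>2 * X (j + 2) p < 0"
        using j kappa by (auto intro!: mult_pos_neg)
      then show False using floor[of j] \<open>X (j + 1) p < 0\<close> by linarith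
    qed
    then obtain i where "X (i + 2) p < 0" "X (i + 1) p \<ge> 0" by blast
    then show ?thesis using complete_aux[OF nonneg _ _ floor bottom] by blast
  qed
qed

sublocale simplicial_description W facet_fun facet_verts labels
proof
  show "finite W" unfolding W_def by auto
  show "finite labels" unfolding labels_def by auto
  show "labels \<noteq> {}" unfolding labels_def by auto
  show "affine_fun (facet_fun g)" for g by (rule affine_facet_fun)
  show verts: "facet_verts g \<subseteq> W" if "g \<in> labels" for g using facet_fun_verts[OF that] by blast
  show "facet_fun g w \<ge> 0" "facet_fun g w = 0 \<longleftrightarrow> w \<in> facet_verts g" if "g \<in> labels" "w \<in> W" for g w
    using that facet_fun_q[OF that(1)] facet_fun_verts[OF that(1)] unfolding W_def by auto
  show indep: "\<not> affine_dependent (facet_verts g)" and card: "card (facet_verts g) = 3" if "g \<in> labels" for g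
  proof -
    from that have "\<not> affine_dependent (facet_verts g) \<and> card (facet_verts g) = 3"
    proof (cases rule: labels_cases)
      case 1 then show ?thesis using A_triangle by simp
    next
      case 2 then show ?thesis using B_triangle by simp
    next
      case (3 i k)
      then show ?thesis using arc_triangle[of "s k" "s (k + 1)"] s_bounds[of k] s_bounds[of "k + 1"] s_less[of k "k + 1"]
        by (simp add: q_def)
    next
      case (4 i k)
      then show ?thesis using arc_triangle[of "s k" "s (k + 1)"] s_bounds[of k] s_bounds[of "k + 1"] s_less[of k "k + 1"]
        by (simp add: q_def)
    qed
    then show "\<not> affine_dependent (facet_verts g)" "card (facet_verts g) = 3" by auto
  qed
  show "\<not> W \<subseteq> facet_verts g" if g: "g \<in> labels" for g
  proof
    assume "W \<subseteq> facet_verts g"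
    then have "\<forall>w\<in>W. facet_fun g w = 0" using facet_fun_verts[OF g] by blast
    then have A0: "facet_fun g (A i) = 0" and B0: "facet_fun g (B i) = 0" for i
      using q_in_W[of 0 i] q_in_W[of "m + 1" "i + 2"] by (auto simp: A_q B_q)
    from g show False
    proof (cases rule: labels_cases)
      case 1
      then show False using B0[of 0] kappa weight_01 by (simp only: facet_fun.simps lin_B) simp
    next
      case 2
      then show False using A0[of 0] kappa weight_01 by (simp only: facet_fun.simps lin_A) simp
    next
      case (3 i k)
      have "facet_fun g (vtx (i + 1) 0) > 0" unfolding 3 by (rule side_B_1) (use 3 in auto)
      then show False using A0[of "i + 1"] by (simp add: A_def)
    next
      case (4 i k)
      have "facet_fun g (vtx (i + 2) 0) > 0" unfolding 4 by (rule side_A_2) (use 4 in auto)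
      then show False using A0[of "i + 2"] by (simp add: A_def)
    qed
  qed
  show "x \<in> convex hull W" if "\<And>g. g \<in> labels \<Longrightarrow> facet_fun g x \<ge> 0" for x
    using complete that by blast
  show "W \<subseteq> (\<Union>g\<in>labels. facet_verts g)"
  proof
    fix w assume "w \<in> W"
    then obtain i k where w: "w = q i k" "k \<le> m + 1" unfolding W_def by auto
    show "w \<in> (\<Union>g\<in>labels. facet_verts g)"
    proof (cases "k \<le> m")
      case True
      then show ?thesis by (intro UN_I[of "Side_A i k"]) (auto simp: w labels_def)
    next
      case False
      then have "k = m + 1" using w by simp
      then show ?thesis by (intro UN_I[of "Side_A i m"]) (auto simp: w labels_def)
    qed
  qed
qed

lemma card_W: "card W = 3 * m + 6"
proof -
  have "inj_on (\<lambda>(i, k). q i k) (UNIV \<times> {0..m + 1})"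
  proof (rule inj_onI, clarify)
    fix i j :: 3 and k l assume kl: "k \<in> {0..m + 1}" "l \<in> {0..m + 1}" and "q i k = q j l"
    then have "i = j \<and> s k = s l" using vtx_inject[of i "s k" j "s l"] s_bounds[of k] s_bounds[of l] unfolding q_def by auto
    then show "i = j \<and> k = l"
      using s_less[of k l] s_less[of l k] kl by (cases k l rule: linorder_cases) auto
  qed
  then have "card ((\<lambda>(i, k). q i k) ` (UNIV \<times> {0..m + 1})) = card ((UNIV :: 3 set) \<times> {0..m + 1})"
    by (rule card_image)
  moreover have "(\<lambda>(i, k). q i k) ` (UNIV \<times> {0..m + 1}) = W" unfolding W_def by auto
  ultimately show ?thesis by (simp add: card_cartesian_product)
qed

lemma W_eq: "W = range A \<union> range B \<union> (\<Union>i. q i ` {1..m})"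
proof -
  have "{0..m + 1} = {0, m + 1} \<union> {1..m}" by auto
  then have "W = (\<Union>i. {q i 0, q i (m + 1)} \<union> q i ` {1..m})" unfolding W_def by (simp only: image_Un image_insert image_empty)
  also have "\<dots> = (\<Union>i. {q i 0}) \<union> (\<Union>i. {q i (m + 1)}) \<union> (\<Union>i. q i ` {1..m})" by auto
  also have "(\<Union>i. {q i 0}) = range A" by (auto simp: A_q)
  also have "(\<Union>i. {q i (m + 1)}) = range B"
  proof -
    have "q i (m + 1) \<in> range B" for i using B_q[of "i + 1"] by (auto intro: range_eqI[of _ _ "i + 1"])
    then show ?thesis using B_q by auto
  qed
  finally show ?thesis .
qed

lemma cupola_hull:
  assumes "schoenhardt_position A B"
  shows "cupola m (convex hull W) A B q"
  unfolding cupola_def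
proof (intro conjI allI ballI)
  show "three_polytope (convex hull W)" by (rule three_polytope_hull)
  show "q i 0 = A i" for i by (simp add: A_q)
  show "q i (m + 1) = B (i + 1)" for i using B_q[of "i + 1"] by simp
  show "vertices (convex hull W) = range A \<union> range B \<union> (\<Union>i. q i ` {1..m})"
    unfolding vertices_hull by (rule W_eq)
  show "card (vertices (convex hull W)) = 3 * m + 6" unfolding vertices_hull by (rule card_W)
  show "schoenhardt_position A B" by fact
  show "{G. G facet_of convex hull W} = {convex hull range A, convex hull range B} \<union>
      (\<Union>i. \<Union>k\<in>{0..m}. {convex hull {B i, q i k, q i (k + 1)}, convex hull {A (i + 1), q i k, q i (k + 1)}})"
    unfolding facets image_labels facet_verts.simps ..
  show "opposite_side (B i) (A (i + 1)) (B (i + 2)) (q i k) (B (i + 1))" if "k \<in> {1..m}" for i k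
    unfolding q_def using that s_third[of k] s_bounds[of k] by (intro opposite_side_vtx) auto
qed

end

subsection \<open>The Schoenhardt polytope\<close>

lemma in_closure_of_segment:
  fixes x c :: "'a::real_normed_vector"
  assumes "\<And>t. 0 < t \<Longrightarrow> t \<le> 1 \<Longrightarrow> (1 - t) *\<^sub>R x + t *\<^sub>R c \<in> S"
  shows "x \<in> closure S"
  unfolding closure_approachable
proof (intro allI impI)
  fix e :: real assume e: "e > 0"
  define t where "t = min 1 (e / (2 * (norm (c - x) + 1)))"
  have n: "norm (c - x) + 1 > 0" by (simp add: add_nonneg_pos)
  then have t: "0 < t" "t \<le> 1" "t \<le> e / (2 * (norm (c - x) + 1))" unfolding t_def using e by auto
  have "t * norm (c - x) \<le> e / (2 * (norm (c - x) + 1)) * (norm (c - x) + 1)"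
    using t by (intro mult_mono) auto
  also have "\<dots> = e / 2" using n by (simp add: field_simps)
  also have "\<dots> < e" using e by simp
  finally have "t * norm (c - x) < e" .
  moreover have "(1 - t) *\<^sub>R x + t *\<^sub>R c - x = t *\<^sub>R (c - x)" by (simp add: algebra_simps)
  ultimately have "dist ((1 - t) *\<^sub>R x + t *\<^sub>R c) x < e" using t by (simp add: dist_norm)
  then show "\<exists>y\<in>S. dist y x < e" using assms t by blast
qed

context cupola_frame
begin

lemma lin_rotate: "lin (i + 1) u0 u1 u2 w = lin i u2 u0 u1 w" "lin (i + 2) u0 u1 u2 w = lin i u1 u2 u0 w"
  by (simp_all add: lin_def fun_eq_iff)

text \<open>
  The planes \<open>A i, B i, A (i + 1)\<close> and \<open>B i, A (i + 1), B (i + 1)\<close> are the zero sets of \<open>floor_fun i\<close>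
  and \<open>X (i + 2)\<close>; they meet in the reflex edge, which turns the conjunction of their inequalities
  into a disjunction.
\<close>

definition floor_fun :: "3 \<Rightarrow> point \<Rightarrow> real" where
  "floor_fun i = lin i \<kappa> 1 (\<kappa>\<^sup>2) (- \<kappa>)"

lemma floor_fun_rotate:
  "floor_fun (i + 1) = lin i (\<kappa>\<^sup>2) \<kappa> 1 (- \<kappa>)" "floor_fun (i + 2) = lin i 1 (\<kappa>\<^sup>2) \<kappa> (- \<kappa>)"
  by (simp_all add: floor_fun_def lin_rotate)

definition Q :: "point set" where
  "Q = {p. 0 \<le> zeta p \<and> zeta p \<le> sigma p \<and> (\<forall>i. 0 \<le> floor_fun i p \<or> 0 \<le> X (i + 2) p)}"

definition Q_open :: "point set" where
  "Q_open = {p. 0 < zeta p \<and> zeta p < sigma p \<and> (\<forall>i. 0 < floor_fun i p \<or> 0 < X (i + 2) p)}"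

lemma Q_iff: "p \<in> Q \<longleftrightarrow> 0 \<le> zeta p \<and> zeta p \<le> sigma p \<and>
    (0 \<le> floor_fun i p \<or> 0 \<le> X (i + 2) p) \<and> (0 \<le> floor_fun (i + 1) p \<or> 0 \<le> X i p) \<and>
    (0 \<le> floor_fun (i + 2) p \<or> 0 \<le> X (i + 1) p)"
  unfolding Q_def mem_Collect_eq all_cyclic3[of _ i] cyclic3 ..

lemma affine_floor_fun: "affine_fun (floor_fun i)"
  unfolding floor_fun_def by (rule affine_lin)

lemmas affine_all = affine_floor_fun affine_lin affine_X affine_zeta affine_sigma

lemma kappa_facts: "\<kappa> > 0" "\<kappa> - 1 > 0" "\<kappa>\<^sup>2 > \<kappa>" "\<kappa> ^ 3 > 1" "\<kappa> * \<kappa> > \<kappa>"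
proof -
  show "\<kappa> > 0" "\<kappa> - 1 > 0" using kappa by auto
  then show "\<kappa> * \<kappa> > \<kappa>" using mult_strict_right_mono[of 1 \<kappa> \<kappa>] kappa by simp
  then show "\<kappa>\<^sup>2 > \<kappa>" by (simp add: power2_eq_square)
  show "\<kappa> ^ 3 > 1" using power_strict_mono[of 1 \<kappa> 3] kappa by simp
qed

section \<open>Signs at the six vertices and topology of \<open>Q\<close>\<close>

lemma zeta_AB: "zeta (A i) = 0" "zeta (B i) > 0"
  using kappa_facts weight_01 by (simp_all add: A_def B_def zeta_vtx)

lemma sigma_zeta_AB: "sigma (A i) - zeta (A i) > 0" "sigma (B i) - zeta (B i) = 0"
  using kappa_facts weight_01 by (simp_all add: A_def B_def zeta_vtx sigma_vtx)

lemma X_A: "X i (A i) > 0" "X (i + 1) (A i) = 0" "X (i + 2) (A i) < 0"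
    "X i (A (i + 1)) < 0" "X (i + 1) (A (i + 1)) > 0" "X (i + 2) (A (i + 1)) = 0"
    "X i (A (i + 2)) = 0" "X (i + 1) (A (i + 2)) < 0" "X (i + 2) (A (i + 2)) > 0"
  unfolding lin_X[of i, symmetric] lin_A using kappa_facts weight_01 by simp_all

lemma X_B: "X i (B i) > 0" "X (i + 1) (B i) = 0" "X (i + 2) (B i) = 0"
    "X i (B (i + 1)) = 0" "X (i + 1) (B (i + 1)) > 0" "X (i + 2) (B (i + 1)) = 0"
    "X i (B (i + 2)) = 0" "X (i + 1) (B (i + 2)) = 0" "X (i + 2) (B (i + 2)) > 0"
  unfolding lin_X[of i, symmetric] lin_B using kappa_facts weight_01 by simp_all

lemma floor_A: "floor_fun i (A i) = 0" "floor_fun i (A (i + 1)) = 0" "floor_fun i (A (i + 2)) > 0"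
  "floor_fun (i + 1) (A i) > 0" "floor_fun (i + 1) (A (i + 1)) = 0" "floor_fun (i + 1) (A (i + 2)) = 0"
  "floor_fun (i + 2) (A i) = 0" "floor_fun (i + 2) (A (i + 1)) > 0" "floor_fun (i + 2) (A (i + 2)) = 0"
  unfolding floor_fun_rotate unfolding floor_fun_def lin_A using kappa_facts weight_01
  by (simp_all add: power2_eq_square power3_eq_cube)

lemma floor_B: "floor_fun i (B i) = 0" "floor_fun i (B (i + 1)) < 0" "floor_fun i (B (i + 2)) > 0"
  "floor_fun (i + 1) (B i) > 0" "floor_fun (i + 1) (B (i + 1)) = 0" "floor_fun (i + 1) (B (i + 2)) < 0"
  "floor_fun (i + 2) (B i) < 0" "floor_fun (i + 2) (B (i + 1)) > 0" "floor_fun (i + 2) (B (i + 2)) = 0"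
  unfolding floor_fun_rotate unfolding floor_fun_def lin_B using kappa_facts weight_01
  by (simp_all add: divide_neg_pos mult_neg_pos)

text \<open>The mean of the six vertices works: each function is negative at no more than one
  vertex, and another vertex outweighs it. Positivity of both alternatives of every disjunction, not
  just of one, makes the centre see all of \<open>Q\<close>.\<close>

lemma center_exists:
  "\<exists>c. zeta c > 0 \<and> sigma c - zeta c > 0 \<and> (\<forall>i. floor_fun i c > 0) \<and> (\<forall>i. X i c > 0)"
proof -
  define r where "r x = (1 / 6 :: real)" for x :: "bool \<times> 3"
  define y where "y x = (if fst x then A (snd x) else B (snd x))" for x
  define c where "c = (\<Sum>x\<in>UNIV. r x *\<^sub>R y x)"
  have "sum r UNIV = 1" unfolding r_def by simp
  then have c: "f c = (\<Sum>x\<in>UNIV. r x * f (y x))" if "affine_fun f" for f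
    unfolding c_def using affine_fun_sum[OF that] by blast
  have *: "f c = 1 / 6 * (f (A i) + f (A (i + 1)) + f (A (i + 2)) + f (B i) + f (B (i + 1)) + f (B (i + 2)))"
    if "affine_fun f" for f i
  proof -
    have "f c = (\<Sum>b\<in>UNIV. \<Sum>j\<in>UNIV. r (b, j) * f (y (b, j)))"
      unfolding c[OF that] sum.cartesian_product UNIV_Times_UNIV by simp
    also have "\<dots> = (\<Sum>j\<in>UNIV. 1 / 6 * f (A j)) + (\<Sum>j\<in>UNIV. 1 / 6 * f (B j))"
      by (simp add: UNIV_bool r_def y_def)
    finally show ?thesis unfolding sum_cyclic3[of _ i] by (simp add: algebra_simps)
  qed
  show ?thesis
  proof (intro exI conjI allI)
    show "zeta c > 0" using zeta_AB unfolding *[OF affine_zeta, of 0] by (simp add: add_pos_pos)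
    have "lin 0 1 1 1 (- 1) c > 0" using sigma_zeta_AB
      unfolding *[OF affine_lin, of _ _ _ _ _ 0] lin_eq_sigma_zeta by (simp add: add_pos_pos)
    then show "sigma c - zeta c > 0" by (simp add: lin_eq_sigma_zeta)
    have k: "\<kappa> - 1 > 0" "\<kappa> * (\<kappa> * \<kappa>) > 1" "(\<kappa> - 1) * (\<kappa> - 1) * (\<kappa> - 1) > 0" using kappa_facts
      by (auto simp: power3_eq_cube)
    show "X i c > 0" for i
    proof -
      have "X i (A i) + X i (A (i + 1)) = (\<kappa> - 1) / weight 0"
        unfolding lin_X(1)[symmetric] lin_A by (simp add: diff_divide_distrib)
      then have "X i (A i) + X i (A (i + 1)) > 0" using k(1) weight_01 by simp
      then show ?thesis using X_A[of i] X_B[of i] unfolding *[OF affine_X, of _ i] by simp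
    qed
    show "floor_fun i c > 0" for i
    proof -
      have "floor_fun i (B (i + 1)) + floor_fun i (B (i + 2)) = (\<kappa> - 1) * (\<kappa> - 1) * (\<kappa> - 1) / weight 1"
        unfolding floor_fun_def lin_B add_divide_distrib[symmetric] by (simp add: algebra_simps power2_eq_square)
      then have "floor_fun i (B (i + 1)) + floor_fun i (B (i + 2)) > 0" using k(3) weight_01 by simp
      then show ?thesis using floor_A[of i] floor_B[of i] unfolding *[OF affine_floor_fun, of _ i] by simp
    qed
  qed
qed

lemma open_Q_open: "open Q_open"
proof -
  have "Q_open = {p. 0 < zeta p} \<inter> {p. 0 < lin 0 1 1 1 (- 1) p} \<inter>
      (\<Inter>i\<in>UNIV. {p. 0 < floor_fun i p} \<union> {p. 0 < X (i + 2) p})"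
    unfolding Q_open_def lin_eq_sigma_zeta by auto
  then show ?thesis
    by (auto intro!: open_Int open_Un open_INT open_affine_fun_pos affine_all)
qed

lemma Q_open_subset: "Q_open \<subseteq> Q"
  unfolding Q_def Q_open_def using less_imp_le by blast

lemma closed_Q: "closed Q"
proof -
  have c: "closed {p. 0 \<le> f p}" if "affine_fun f" for f
    using closed_Collect_le[OF continuous_on_const affine_fun_continuous_on[OF that]] .
  have "Q = {p. 0 \<le> zeta p} \<inter> {p. 0 \<le> lin 0 1 1 1 (- 1) p} \<inter>
      (\<Inter>i\<in>UNIV. {p. 0 \<le> floor_fun i p} \<union> {p. 0 \<le> X (i + 2) p})"
    unfolding Q_def lin_eq_sigma_zeta by auto
  then show ?thesis
    by (auto intro!: closed_Int closed_Un closed_INT c affine_all)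
qed

text \<open>\<open>Q\<close> is star-shaped: moving towards the centre increases all defining functions.\<close>

lemma Q_open_dense: "p \<in> Q \<Longrightarrow> p \<in> closure Q_open"
proof -
  assume p: "p \<in> Q"
  obtain c where c: "zeta c > 0" "sigma c - zeta c > 0" "\<And>i. floor_fun i c > 0" "\<And>i. X i c > 0"
    using center_exists by metis
  show ?thesis
  proof (rule in_closure_of_segment[of _ c])
    fix t :: real assume t: "0 < t" "t \<le> 1"
    have pos: "f ((1 - t) *\<^sub>R p + t *\<^sub>R c) > 0" if "affine_fun f" "f p \<ge> 0" "f c > 0" for f
    proof -
      have "f ((1 - t) *\<^sub>R p + t *\<^sub>R c) = (1 - t) * f p + t * f c" by (rule affine_fun_comb[OF that(1)]) simp
      moreover have "(1 - t) * f p \<ge> 0" "t * f c > 0" using t that by auto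
      ultimately show ?thesis by linarith
    qed
    have "lin 0 1 1 1 (- 1) ((1 - t) *\<^sub>R p + t *\<^sub>R c) > 0"
      by (rule pos[OF affine_lin]) (use p c(2) in \<open>auto simp: lin_eq_sigma_zeta Q_def\<close>)
    moreover have "zeta ((1 - t) *\<^sub>R p + t *\<^sub>R c) > 0"
      by (rule pos[OF affine_zeta]) (use p c(1) in \<open>auto simp: Q_def\<close>)
    moreover have "0 < floor_fun i ((1 - t) *\<^sub>R p + t *\<^sub>R c) \<or> 0 < X (i + 2) ((1 - t) *\<^sub>R p + t *\<^sub>R c)" for i
    proof -
      have "0 \<le> floor_fun i p \<or> 0 \<le> X (i + 2) p" using p by (simp add: Q_def)
      then show ?thesis using pos[OF affine_X _ c(4)] pos[OF affine_floor_fun _ c(3)] by (elim disjE) simp_all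
    qed
    ultimately show "(1 - t) *\<^sub>R p + t *\<^sub>R c \<in> Q_open"
      unfolding Q_open_def lin_eq_sigma_zeta by simp
  qed
qed

lemma interior_Q: "interior Q = Q_open"
proof
  show "Q_open \<subseteq> interior Q" using open_Q_open Q_open_subset by (simp add: interior_maximal)
  show "interior Q \<subseteq> Q_open"
  proof (rule ccontr)
    assume "\<not> interior Q \<subseteq> Q_open"
    then obtain p where p: "p \<in> interior Q" "p \<notin> Q_open" by auto
    obtain c where c: "zeta c > 0" "sigma c - zeta c > 0" "\<And>i. floor_fun i c > 0" "\<And>i. X i c > 0"
      using center_exists by metis
    obtain e where e: "e > 0" "ball p e \<subseteq> Q" using p(1) by (auto simp: mem_interior)
    define t where "t = e / (2 * (norm (p - c) + 1))"
    have n: "norm (p - c) + 1 > 0" by (simp add: add_nonneg_pos)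
    then have t: "t > 0" unfolding t_def using e by auto
    \<comment> \<open>Slightly beyond \<open>p\<close> as seen from the centre, every function that
      is at most 0 at \<open>p\<close> becomes negative, so \<open>y\<close> violates a defining
      condition of \<open>Q\<close>.\<close>
    define y where "y = (1 + t) *\<^sub>R p + (- t) *\<^sub>R c"
    have "y - p = t *\<^sub>R (p - c)" unfolding y_def by (simp add: algebra_simps)
    then have "norm (y - p) = t * norm (p - c)" using t by simp
    also have "\<dots> \<le> t * (norm (p - c) + 1)" using t by simp
    also have "\<dots> = e / 2" unfolding t_def using n by (simp add: field_simps)
    finally have "y \<in> ball p e" using e by (simp add: dist_norm norm_minus_commute)
    then have y: "y \<in> Q" using e by auto
    have neg: "f y < 0" if "affine_fun f" "f p \<le> 0" "f c > 0" for f
    proof -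
      have "f y = (1 + t) * f p + (- t) * f c" unfolding y_def by (rule affine_fun_comb[OF that(1)]) simp
      moreover have "(1 + t) * f p \<le> 0" "t * f c > 0" using t that by (auto simp: mult_nonneg_nonpos)
      ultimately show ?thesis by simp
    qed
    consider "zeta p \<le> 0" | "lin 0 1 1 1 (- 1) p \<le> 0" | i where "floor_fun i p \<le> 0" "X (i + 2) p \<le> 0"
      using p(2) by (auto simp: Q_open_def lin_eq_sigma_zeta not_less)
    then show False
    proof cases
      case 1
      then show False using neg[OF affine_zeta] c y unfolding Q_def by fastforce
    next
      case 2
      then have "lin 0 1 1 1 (- 1) y < 0" by (intro neg[OF affine_lin]) (use c(2) in \<open>auto simp: lin_eq_sigma_zeta\<close>)
      then show False using y unfolding Q_def lin_eq_sigma_zeta by auto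
    next
      case 3
      then have "floor_fun i y < 0" "X (i + 2) y < 0" using neg[OF affine_floor_fun] neg[OF affine_X] c by auto
      moreover have "0 \<le> floor_fun i y \<or> 0 \<le> X (i + 2) y" using y unfolding Q_def by blast
      ultimately show False by linarith
    qed
  qed
qed

lemma closure_interior_Q: "closure (interior Q) = Q"
  unfolding interior_Q
  using Q_open_dense closure_minimal[OF Q_open_subset closed_Q] by auto

lemma frontier_Q: "frontier Q = Q - Q_open"
  unfolding frontier_def interior_Q using closed_Q by simp

text \<open>\<open>Q\<close> lies above the bottom triangle. Were floor form \<open>i\<close>
  negative, \<open>X (i + 2)\<close> would be nonnegative and one of the other two coordinates
  negative. The disjunction for that coordinate makes another floor form nonnegative, and up to
  positive factors adding a nonnegative multiple of \<open>x2\<close> or of \<open>- x1\<close>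
  turns it into form \<open>i\<close>.\<close>

lemma Q_floor_nonneg:
  assumes "p \<in> Q" shows "lin i \<kappa> 1 (\<kappa>\<^sup>2) 0 p \<ge> 0"
proof (rule ccontr)
  define x0 x1 x2 z where "x0 = X i p" and "x1 = X (i + 1) p" and "x2 = X (i + 2) p" and "z = zeta p"
  note x = x0_def[symmetric] x1_def[symmetric] x2_def[symmetric] z_def[symmetric]
  note k = kappa_facts
  assume "\<not> lin i \<kappa> 1 (\<kappa>\<^sup>2) 0 p \<ge> 0"
  then have neg: "\<kappa> * x0 + x1 + \<kappa>\<^sup>2 * x2 < 0" unfolding lin_def x by simp
  have z: "\<kappa> * z \<ge> 0" using assms k unfolding Q_def by (simp add: x)
  have 0: "0 \<le> \<kappa> * x0 + x1 + \<kappa>\<^sup>2 * x2 - \<kappa> * z \<or> 0 \<le> x2"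
    and 1: "0 \<le> \<kappa>\<^sup>2 * x0 + \<kappa> * x1 + x2 - \<kappa> * z \<or> 0 \<le> x0"
    and 2: "0 \<le> x0 + \<kappa>\<^sup>2 * x1 + \<kappa> * x2 - \<kappa> * z \<or> 0 \<le> x1"
    using assms unfolding Q_iff[of p i] floor_fun_rotate unfolding floor_fun_def lin_def x by auto
  have x2: "x2 \<ge> 0" using 0 neg z by linarith
  then have k2: "\<kappa>\<^sup>2 * x2 \<ge> 0" by simp
  show False
  proof (cases "x0 < 0")
    case True
    then have "\<kappa>\<^sup>2 * x0 + \<kappa> * x1 + x2 \<ge> 0" using 1 z by linarith
    moreover have "(\<kappa> ^ 3 - 1) * x2 \<ge> 0" using k x2 by simp
    ultimately have "(\<kappa>\<^sup>2 * x0 + \<kappa> * x1 + x2) + (\<kappa> ^ 3 - 1) * x2 \<ge> 0" by linarith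
    also have "(\<kappa>\<^sup>2 * x0 + \<kappa> * x1 + x2) + (\<kappa> ^ 3 - 1) * x2 = \<kappa> * (\<kappa> * x0 + x1 + \<kappa>\<^sup>2 * x2)"
      by (simp add: algebra_simps power2_eq_square power3_eq_cube)
    finally show False using neg k by (simp add: zero_le_mult_iff)
  next
    case False
    then have "\<kappa> * x0 \<ge> 0" using k by simp
    then have x1: "x1 < 0" using neg k2 by linarith
    then have "\<kappa> * (x0 + \<kappa>\<^sup>2 * x1 + \<kappa> * x2) \<ge> 0" using 2 z k by auto
    moreover have "(\<kappa> ^ 3 - 1) * (- x1) \<ge> 0" using k x1 by (intro mult_nonneg_nonneg) auto
    ultimately have "\<kappa> * (x0 + \<kappa>\<^sup>2 * x1 + \<kappa> * x2) + (\<kappa> ^ 3 - 1) * (- x1) \<ge> 0" by linarith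
    also have "\<kappa> * (x0 + \<kappa>\<^sup>2 * x1 + \<kappa> * x2) + (\<kappa> ^ 3 - 1) * (- x1) = \<kappa> * x0 + x1 + \<kappa>\<^sup>2 * x2"
      by (simp add: algebra_simps power2_eq_square power3_eq_cube)
    finally show False using neg by simp
  qed
qed

section \<open>The boundary triangles\<close>

definition F_tri :: "3 \<Rightarrow> point set" where "F_tri i = {A i, B i, A (i + 1)}"
definition W_tri :: "3 \<Rightarrow> point set" where "W_tri i = {B i, A (i + 1), B (i + 1)}"

lemma nonneg_all_A:
  "f (A i) \<ge> 0 \<Longrightarrow> f (A (i + 1)) \<ge> 0 \<Longrightarrow> f (A (i + 2)) \<ge> 0 \<Longrightarrow> x \<in> range A \<Longrightarrow> f x \<ge> (0::real)"
  unfolding range_cyclic3[of A i] by auto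

lemma hull_range_A: "p \<in> convex hull (range A) \<Longrightarrow> zeta p = 0 \<and> p \<in> Q"
proof -
  assume p: "p \<in> convex hull (range A)"
  have "zeta p \<ge> 0" using p affine_zeta by (rule affine_fun_nonneg_hull[rotated 2]) (auto simp: zeta_AB)
  moreover have "- 1 * zeta p \<ge> 0"
    by (rule affine_fun_nonneg_hull[OF affine_fun_scale[OF affine_zeta] _ p]) (auto simp: zeta_AB)
  ultimately have z: "zeta p = 0" by simp
  have "lin 0 1 1 1 (- 1) p \<ge> 0"
    by (rule affine_fun_nonneg_hull[OF affine_lin _ p]) (use sigma_zeta_AB(1) in \<open>auto simp: lin_eq_sigma_zeta less_imp_le\<close>)
  moreover have "floor_fun i p \<ge> 0" for i
    using affine_fun_nonneg_hull[OF affine_floor_fun _ p, of i] nonneg_all_A[of "floor_fun i" i] floor_A[of i]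
    by (metis less_imp_le order_refl)
  ultimately show ?thesis using z unfolding Q_def lin_eq_sigma_zeta by auto
qed

lemma hull_range_B: "p \<in> convex hull (range B) \<Longrightarrow> zeta p = sigma p \<and> p \<in> Q"
proof -
  assume p: "p \<in> convex hull (range B)"
  have "zeta p \<ge> 0"
    by (rule affine_fun_nonneg_hull[OF affine_zeta _ p]) (use zeta_AB(2) in \<open>auto intro: less_imp_le\<close>)
  moreover have "lin 0 1 1 1 (- 1) p \<ge> 0"
    by (rule affine_fun_nonneg_hull[OF affine_lin _ p]) (use sigma_zeta_AB(2) in \<open>auto simp: lin_eq_sigma_zeta\<close>)
  moreover have "- 1 * lin 0 1 1 1 (- 1) p \<ge> 0"
    by (rule affine_fun_nonneg_hull[OF affine_fun_scale[OF affine_lin] _ p])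
      (use sigma_zeta_AB(2) in \<open>auto simp: lin_eq_sigma_zeta\<close>)
  moreover have "X i p \<ge> 0" for i
  proof (rule affine_fun_nonneg_hull[OF affine_X _ p])
    fix w assume "w \<in> range B"
    then have "w \<in> {B i, B (i + 1), B (i + 2)}" unfolding range_cyclic3[of B i] .
    then show "X i w \<ge> 0" using X_B[of i] by auto
  qed
  ultimately show ?thesis unfolding Q_def lin_eq_sigma_zeta by auto
qed

lemma zeta_AB_nonneg: "zeta (A i) \<ge> 0" "zeta (B i) \<ge> 0"
  "lin j 1 1 1 (- 1) (A i) \<ge> 0" "lin j 1 1 1 (- 1) (B i) \<ge> 0"
  using zeta_AB[of i] sigma_zeta_AB[of i] by (auto simp: lin_eq_sigma_zeta)

lemma hull_F_tri:
  assumes p: "p \<in> convex hull (F_tri i)"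
  shows "p \<in> Q" "floor_fun i p = 0" "X (i + 2) p \<le> 0"
proof -
  have nn: "f p \<ge> 0" if "affine_fun f" "f (A i) \<ge> 0" "f (B i) \<ge> 0" "f (A (i + 1)) \<ge> 0" for f
    by (rule affine_fun_nonneg_hull[OF that(1) _ p]) (use that in \<open>auto simp: F_tri_def\<close>)
  have "zeta p \<ge> 0" by (rule nn[OF affine_zeta]) (rule zeta_AB_nonneg)+
  moreover have "lin 0 1 1 1 (- 1) p \<ge> 0" by (rule nn[OF affine_lin]) (rule zeta_AB_nonneg)+
  moreover have "floor_fun i p \<ge> 0" by (rule nn[OF affine_floor_fun]) (simp_all add: floor_A floor_B)
  moreover have "- 1 * floor_fun i p \<ge> 0"
    by (rule nn[OF affine_fun_scale[OF affine_floor_fun]]) (simp_all add: floor_A floor_B)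
  moreover have "floor_fun (i + 1) p \<ge> 0"
    by (rule nn[OF affine_floor_fun]) (use floor_A[of i] floor_B[of i] in simp_all)
  moreover have "X (i + 1) p \<ge> 0" by (rule nn[OF affine_X]) (use X_A[of i] X_B[of i] in simp_all)
  moreover have "- 1 * X (i + 2) p \<ge> 0"
    by (rule nn[OF affine_fun_scale[OF affine_X]]) (use X_A[of i] X_B[of i] in simp_all)
  ultimately show "p \<in> Q" "floor_fun i p = 0" "X (i + 2) p \<le> 0"
    unfolding Q_iff[of p i] lin_eq_sigma_zeta by auto
qed

lemma hull_W_tri:
  assumes p: "p \<in> convex hull (W_tri i)"
  shows "p \<in> Q" "floor_fun i p \<le> 0" "X (i + 2) p = 0"
proof -
  have nn: "f p \<ge> 0" if "affine_fun f" "f (B i) \<ge> 0" "f (A (i + 1)) \<ge> 0" "f (B (i + 1)) \<ge> 0" for f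
    by (rule affine_fun_nonneg_hull[OF that(1) _ p]) (use that in \<open>auto simp: W_tri_def\<close>)
  have "zeta p \<ge> 0" by (rule nn[OF affine_zeta]) (rule zeta_AB_nonneg)+
  moreover have "lin 0 1 1 1 (- 1) p \<ge> 0" by (rule nn[OF affine_lin]) (rule zeta_AB_nonneg)+
  moreover have "X (i + 2) p \<ge> 0" by (rule nn[OF affine_X]) (use X_A[of i] X_B[of i] in simp_all)
  moreover have "- 1 * X (i + 2) p \<ge> 0"
    by (rule nn[OF affine_fun_scale[OF affine_X]]) (use X_A[of i] X_B[of i] in simp_all)
  moreover have "- 1 * floor_fun i p \<ge> 0"
    by (rule nn[OF affine_fun_scale[OF affine_floor_fun]]) (use floor_A[of i] floor_B[of i] in simp_all)
  moreover have "floor_fun (i + 1) p \<ge> 0"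
    by (rule nn[OF affine_floor_fun]) (use floor_A[of i] floor_B[of i] in simp_all)
  moreover have "X (i + 1) p \<ge> 0" by (rule nn[OF affine_X]) (use X_A[of i] X_B[of i] in simp_all)
  ultimately show "p \<in> Q" "floor_fun i p \<le> 0" "X (i + 2) p = 0"
    unfolding Q_iff[of p i] lin_eq_sigma_zeta by auto
qed

context
  fixes p i and x0 x1 x2 z :: real
  assumes p: "p \<in> Q" and x: "X i p = x0" "X (i + 1) p = x1" "X (i + 2) p = x2" "zeta p = z"
begin

lemma Q_coords:
  "0 \<le> z" "z \<le> x0 + x1 + x2"
  "0 \<le> \<kappa> * x0 + x1 + \<kappa>\<^sup>2 * x2 - \<kappa> * z \<or> 0 \<le> x2"
  "0 \<le> \<kappa>\<^sup>2 * x0 + \<kappa> * x1 + x2 - \<kappa> * z \<or> 0 \<le> x0"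
  "0 \<le> x0 + \<kappa>\<^sup>2 * x1 + \<kappa> * x2 - \<kappa> * z \<or> 0 \<le> x1"
  using p unfolding Q_iff[of p i] floor_fun_rotate unfolding floor_fun_def lin_def sigma_cyclic[of p i] x by auto

lemma floor_fun_coords: "floor_fun i p = \<kappa> * x0 + x1 + \<kappa>\<^sup>2 * x2 - \<kappa> * z"
  unfolding floor_fun_def lin_def x by simp

lemma Q_top:
  assumes "zeta p = sigma p" "x2 < 0" shows "x1 < 0"
proof -
  have z: "z = x0 + x1 + x2" using assms(1) unfolding sigma_cyclic[of p i] x .
  have "0 \<le> \<kappa> * x0 + x1 + \<kappa>\<^sup>2 * x2 - \<kappa> * z" using Q_coords(3) assms(2) by linarith
  also have "\<dots> = (\<kappa> - 1) * (\<kappa> * x2 - x1)" unfolding z by (simp add: algebra_simps power2_eq_square)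
  finally have "\<kappa> * x2 - x1 \<ge> 0" using kappa_facts by (simp add: zero_le_mult_iff)
  moreover have "\<kappa> * x2 < 0" using kappa_facts assms by (simp add: mult_pos_neg)
  ultimately show ?thesis by linarith
qed

lemma Q_floor_triangle:
  assumes fl: "floor_fun i p = 0" and x2: "x2 \<le> 0" shows "p \<in> convex hull (F_tri i)"
proof -
  have F0: "\<kappa> * x0 + x1 + \<kappa>\<^sup>2 * x2 = \<kappa> * z" using fl unfolding floor_fun_coords by simp
  have "\<kappa> * z \<ge> 0" using Q_coords(1) kappa_facts by simp
  have x1: "x1 \<ge> 0"
  proof (rule ccontr)
    assume "\<not> x1 \<ge> 0"
    then have neg: "x1 < 0" by simp
    then have 2: "x0 + \<kappa>\<^sup>2 * x1 + \<kappa> * x2 \<ge> \<kappa> * z" using Q_coords(5) by linarith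
    then have "0 \<le> (x0 + \<kappa>\<^sup>2 * x1 + \<kappa> * x2) - (\<kappa> * x0 + x1 + \<kappa>\<^sup>2 * x2)" using F0 by linarith
    also have "\<dots> = (\<kappa> - 1) * ((\<kappa> + 1) * x1 - (x0 + \<kappa> * x2))" by (simp add: algebra_simps power2_eq_square)
    finally have "(\<kappa> + 1) * x1 - (x0 + \<kappa> * x2) \<ge> 0" using kappa_facts by (simp add: zero_le_mult_iff)
    moreover have "(\<kappa> + 1) * x1 < 0" "\<kappa>\<^sup>2 * x1 < 0" using neg kappa_facts by (simp_all add: mult_pos_neg)
    ultimately show False using 2 \<open>\<kappa> * z \<ge> 0\<close> by linarith
  qed
  \<comment> \<open>Only \<open>A i\<close> contributes to \<open>x2\<close>, only
    \<open>B i\<close> to \<open>z\<close> and only \<open>A (i + 1)\<close> to \<open>x1\<close>,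
    which gives the coefficients; agreement in \<open>x0\<close> is the equation of the
    plane.\<close>
  have "in_cone (F_tri i) i ((- x2) *\<^sub>R (\<kappa>, 0, - 1, 0) + (z / (\<kappa> - 1)) *\<^sub>R (\<kappa> - 1, 0, 0, \<kappa> - 1) +
      (x1 / \<kappa>) *\<^sub>R (- 1, \<kappa>, 0, 0))"
    using x1 x2 Q_coords(1) kappa_facts
    by (intro in_cone_add in_cone_scale in_cone_A in_cone_B) (auto simp: F_tri_def)
  moreover have "- (x2 * \<kappa>) + z - x1 / \<kappa> = x0"
    using F0 kappa_facts by (simp add: field_simps power2_eq_square)
  ultimately have "in_cone (F_tri i) i (x0, x1, x2, z)" using kappa_facts by simp
  then show ?thesis using in_cone_self[of "F_tri i" i p] unfolding x by blast
qed

lemma Q_wall_triangle: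
  assumes fl: "floor_fun i p \<le> 0" and x2: "x2 = 0" shows "p \<in> convex hull (W_tri i)"
proof -
  \<comment> \<open>The coefficient of \<open>A (i + 1)\<close>, since \<open>sigma - zeta\<close>
    is zero at the other two corners.\<close>
  define c where "c = (x0 + x1 - z) / (\<kappa> - 1)"
  have zc: "z = x0 + x1 - (\<kappa> - 1) * c" unfolding c_def using kappa_facts by simp
  have c: "c \<ge> 0" unfolding c_def using Q_coords(2) x2 kappa_facts by simp
  have "0 \<le> \<kappa> * z - (\<kappa> * x0 + x1)" using fl unfolding floor_fun_coords x2 by simp
  also have "\<dots> = (\<kappa> - 1) * (x1 - \<kappa> * c)" unfolding zc by (simp add: algebra_simps power2_eq_square)
  finally have t: "x1 - \<kappa> * c \<ge> 0" using kappa_facts by (simp add: zero_le_mult_iff)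
  have b: "x0 + c \<ge> 0"
  proof (cases "x0 \<ge> 0")
    case False
    then have "0 \<le> \<kappa>\<^sup>2 * x0 + \<kappa> * x1 + x2 - \<kappa> * z" using Q_coords(4) by linarith
    also have "\<dots> = \<kappa> * (\<kappa> - 1) * (x0 + c)" unfolding zc x2 by (simp add: algebra_simps power2_eq_square)
    finally have "0 \<le> \<kappa> * (\<kappa> - 1) * (x0 + c)" .
    moreover have "\<kappa> * (\<kappa> - 1) > 0" using kappa_facts by simp
    ultimately show ?thesis using mult_le_cancel_left_pos[of "\<kappa> * (\<kappa> - 1)" 0 "x0 + c"] by simp
  qed (use c in simp)
  have "in_cone (W_tri i) i (((x0 + c) / (\<kappa> - 1)) *\<^sub>R (\<kappa> - 1, 0, 0, \<kappa> - 1) + c *\<^sub>R (- 1, \<kappa>, 0, 0) +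
      ((x1 - \<kappa> * c) / (\<kappa> - 1)) *\<^sub>R (0, \<kappa> - 1, 0, \<kappa> - 1))"
    using b c t kappa_facts
    by (intro in_cone_add in_cone_scale in_cone_A in_cone_B) (auto simp: W_tri_def)
  moreover have "x0 + c + (x1 - \<kappa> * c) = z" unfolding zc by (simp add: algebra_simps)
  moreover have "c * \<kappa> + (x1 - \<kappa> * c) = x1" by simp
  ultimately have "in_cone (W_tri i) i (x0, x1, x2, z)" using kappa_facts x2 by simp
  then show ?thesis using in_cone_self[of "W_tri i" i p] unfolding x by blast
qed

end

lemma Q_bottom_triangle: assumes "p \<in> Q" "zeta p = 0" shows "p \<in> convex hull (range A)"
proof (rule in_cone_self)
  show "in_cone (range A) 0 (X 0 p, X (0 + 1) p, X (0 + 2) p, zeta p)"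
    unfolding assms(2) by (rule in_cone_bottom) (use Q_floor_nonneg[OF assms(1)] in auto)
qed

lemma Q_top_triangle: assumes p: "p \<in> Q" and eq: "zeta p = sigma p" shows "p \<in> convex hull (range B)"
proof (rule in_cone_self)
  \<comment> \<open>A negative coordinate would spread around the cycle and make
    \<open>sigma\<close> negative.\<close>
  have step: "X (i + 1) p < 0" if "X (i + 2) p < 0" for i
    using Q_top[OF p refl refl refl refl eq that] .
  have "X j p \<ge> 0" for j
  proof (rule ccontr)
    assume "\<not> X j p \<ge> 0"
    then have j: "X j p < 0" by simp
    then have "X (j + 2) p < 0" using step[of "j + 1"] by simp
    moreover from this have "X (j + 1) p < 0" by (rule step)
    ultimately have "sigma p < 0" unfolding sigma_cyclic[of p j] using j by linarith
    then show False using p eq unfolding Q_def by simp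
  qed
  then show "in_cone (range B) 0 (X 0 p, X (0 + 1) p, X (0 + 2) p, zeta p)"
    unfolding eq by (intro in_cone_top) auto
qed

lemma schoenhardt_triangles_eq:
  "schoenhardt_triangles A B = {range A, range B} \<union> (\<Union>i. {F_tri i, W_tri i})"
  unfolding schoenhardt_triangles_def F_tri_def W_tri_def ..

lemma frontier_Q_triangles: "frontier Q = (\<Union>t\<in>schoenhardt_triangles A B. convex hull t)"
proof
  show "frontier Q \<subseteq> (\<Union>t\<in>schoenhardt_triangles A B. convex hull t)"
  proof
    fix p assume "p \<in> frontier Q"
    then have p: "p \<in> Q" "p \<notin> Q_open" by (auto simp: frontier_Q)
    have "zeta p \<ge> 0" "zeta p \<le> sigma p" using p(1) unfolding Q_def by auto
    then consider "zeta p = 0" | "zeta p = sigma p"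
      | i where "floor_fun i p \<le> 0" "X (i + 2) p \<le> 0"
      using p(2) by (auto simp: Q_open_def not_less)
    then show "p \<in> (\<Union>t\<in>schoenhardt_triangles A B. convex hull t)"
    proof cases
      case 1
      then show ?thesis using Q_bottom_triangle[OF p(1)] by (auto simp: schoenhardt_triangles_eq)
    next
      case 2
      then show ?thesis using Q_top_triangle[OF p(1)] by (auto simp: schoenhardt_triangles_eq)
    next
      case (3 i)
      have "0 \<le> floor_fun i p \<or> 0 \<le> X (i + 2) p" using p(1) unfolding Q_def by simp
      then show ?thesis
        using 3 Q_floor_triangle[OF p(1) refl refl refl refl] Q_wall_triangle[OF p(1) refl refl refl refl]
        by (fastforce simp: schoenhardt_triangles_eq)
    qed
  qed
  show "(\<Union>t\<in>schoenhardt_triangles A B. convex hull t) \<subseteq> frontier Q"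
  proof (rule UN_least)
    fix t assume "t \<in> schoenhardt_triangles A B"
    then consider "t = range A" | "t = range B" | i where "t = F_tri i" | i where "t = W_tri i"
      by (auto simp: schoenhardt_triangles_eq)
    then show "convex hull t \<subseteq> frontier Q"
    proof cases
      case 1
      then show ?thesis using hull_range_A unfolding frontier_Q Q_open_def by fastforce
    next
      case 2
      then show ?thesis using hull_range_B unfolding frontier_Q Q_open_def by fastforce
    next
      case (3 i)
      show ?thesis
      proof
        fix p assume "p \<in> convex hull t"
        then have "p \<in> Q" "floor_fun i p = 0" "X (i + 2) p \<le> 0" using hull_F_tri unfolding 3 by auto
        then show "p \<in> frontier Q" unfolding frontier_Q by (auto simp: Q_open_def not_less intro!: exI[of _ i])
      qed
    next
      case (4 i)
      show ?thesis
      proof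
        fix p assume "p \<in> convex hull t"
        then have "p \<in> Q" "floor_fun i p \<le> 0" "X (i + 2) p = 0" using hull_W_tri unfolding 4 by auto
        then show "p \<in> frontier Q" unfolding frontier_Q by (auto simp: Q_open_def not_less intro!: exI[of _ i])
      qed
    qed
  qed
qed

text \<open>Both summands of \<open>normalised\<close> are nonnegative on \<open>Q\<close>, which
  bounds \<open>sigma\<close>. The floor forms are nonnegative with sum
  \<open>(\<kappa>\<^sup>2 + \<kappa> + 1) * sigma\<close>, so each is bounded, and inverting the
  circulant matrix bounds the coordinates.\<close>

lemma bounded_Q: "bounded Q"
proof -
  define K where "K = \<kappa> ^ 3 - 1"
  have K: "K > 0" using kappa_facts unfolding K_def by simp
  define R where "R = (\<kappa>\<^sup>2 + \<kappa> + 1) * (a + b)"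
  define M where "M = (\<kappa> + 1) * R / K"
  have X_bound: "\<bar>X i p\<bar> \<le> M" if p: "p \<in> Q" for i p
  proof -
    have z: "0 \<le> zeta p" "zeta p \<le> sigma p" using p unfolding Q_def by auto
    then have "zeta p / b \<ge> 0" "(sigma p - zeta p) / a \<ge> 0" using a b by auto
    then have "zeta p / b \<le> 1" "(sigma p - zeta p) / a \<le> 1" using normalised[of p] by linarith+
    then have "sigma p \<le> a + b" using a b by (simp add: field_simps)
    define F where "F j = lin j \<kappa> 1 (\<kappa>\<^sup>2) 0 p" for j
    have F: "F j \<ge> 0" for j unfolding F_def by (rule Q_floor_nonneg[OF p])
    have "F i + F (i + 1) + F (i + 2) = (\<kappa>\<^sup>2 + \<kappa> + 1) * sigma p"
      unfolding F_def lin_rotate unfolding lin_def sigma_cyclic[of p i] by (simp add: algebra_simps)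
    also have "\<dots> \<le> R" unfolding R_def using \<open>sigma p \<le> a + b\<close> kappa_facts
      by (intro mult_left_mono) (auto intro: add_nonneg_nonneg)
    finally have F1: "F (i + 1) \<le> R" and F2: "F (i + 2) \<le> R" using F[of i] F[of "i + 1"] F[of "i + 2"] by linarith+
    have "K * X i p = \<kappa> * F (i + 1) - F (i + 2)"
      unfolding F_def lin_rotate unfolding lin_def K_def by (simp add: algebra_simps power2_eq_square power3_eq_cube)
    moreover have "\<kappa> * F (i + 1) \<le> \<kappa> * R" "0 \<le> \<kappa> * F (i + 1)"
      using F1 F[of "i + 1"] kappa_facts by simp_all
    ultimately have "\<bar>K * X i p\<bar> \<le> \<kappa> * R + R" using F2 F[of "i + 2"] by linarith
    then show ?thesis unfolding M_def using K by (simp add: abs_mult field_simps)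
  qed
  have "norm p \<le> norm v + (\<Sum>j\<in>UNIV. M * norm (d j))" if p: "p \<in> Q" for p
  proof -
    have "norm p \<le> norm v + norm (\<Sum>j\<in>UNIV. X j p *\<^sub>R d j)"
      using norm_triangle_ineq[of v "\<Sum>j\<in>UNIV. X j p *\<^sub>R d j"] unfolding point_X .
    also have "norm (\<Sum>j\<in>UNIV. X j p *\<^sub>R d j) \<le> (\<Sum>j\<in>UNIV. M * norm (d j))"
      by (rule sum_norm_le) (simp add: X_bound[OF p] mult_right_mono)
    finally show ?thesis by simp
  qed
  then show ?thesis unfolding bounded_iff by blast
qed

lemma compact_Q: "compact Q"
  using closed_Q bounded_Q compact_eq_bounded_closed by blast

lemma triangles_indep:
  assumes "t \<in> schoenhardt_triangles A B" shows "\<not> affine_dependent t" "card t = 3"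
proof -
  have F: "\<not> affine_dependent {B i, A (i + 1), A i}" "card {B i, A (i + 1), A i} = 3" for i
    using zeta_AB(1) zeta_AB(2)[of i] X_A[of i] not_affine_dependent_triangular[OF affine_zeta affine_X[of "i + 1"], of "B i" "A (i + 1)" "A i"]
    by simp_all
  have W: "\<not> affine_dependent {A (i + 1), B i, B (i + 1)}" "card {A (i + 1), B i, B (i + 1)} = 3" for i
    using sigma_zeta_AB[of i] sigma_zeta_AB[of "i + 1"] X_B[of i] 
      not_affine_dependent_triangular[OF affine_lin[of i 1 1 1 "- 1"] affine_X[of i], of "A (i + 1)" "B i" "B (i + 1)"]
    by (simp_all add: lin_eq_sigma_zeta)
  have eq: "F_tri i = {B i, A (i + 1), A i}" "W_tri i = {A (i + 1), B i, B (i + 1)}" for i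
    unfolding F_tri_def W_tri_def by blast+
  have "\<not> affine_dependent t \<and> card t = 3"
    using assms A_triangle B_triangle F W unfolding schoenhardt_triangles_eq eq[symmetric] by auto
  then show "\<not> affine_dependent t" "card t = 3" by auto
qed

section \<open>Pairwise intersections of the boundary triangles\<close>

definition meets_face :: "point set \<Rightarrow> point set \<Rightarrow> bool" where
  "meets_face s t \<longleftrightarrow> convex hull s \<inter> convex hull t = convex hull (s \<inter> t)"

lemma meets_face_sym: "meets_face s t \<Longrightarrow> meets_face t s"
  unfolding meets_face_def by (simp add: Int_commute)

lemma meets_face_F:
  assumes "affine_fun f" "f (A i) \<ge> 0" "f (B i) \<ge> 0" "f (A (i + 1)) \<ge> 0" "\<And>x. x \<in> t \<Longrightarrow> f x \<le> 0"
    "f (A i) = 0 \<Longrightarrow> A i \<in> t" "f (B i) = 0 \<Longrightarrow> B i \<in> t" "f (A (i + 1)) = 0 \<Longrightarrow> A (i + 1) \<in> t"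
  shows "meets_face (F_tri i) t"
  unfolding meets_face_def
  by (rule hull_Int_separated[OF assms(1)]) (use assms in \<open>auto simp: F_tri_def\<close>)

lemma meets_face_W:
  assumes "affine_fun f" "f (B i) \<ge> 0" "f (A (i + 1)) \<ge> 0" "f (B (i + 1)) \<ge> 0" "\<And>x. x \<in> t \<Longrightarrow> f x \<le> 0"
    "f (B i) = 0 \<Longrightarrow> B i \<in> t" "f (A (i + 1)) = 0 \<Longrightarrow> A (i + 1) \<in> t" "f (B (i + 1)) = 0 \<Longrightarrow> B (i + 1) \<in> t"
  shows "meets_face (W_tri i) t"
  unfolding meets_face_def
  by (rule hull_Int_separated[OF assms(1)]) (use assms in \<open>auto simp: W_tri_def\<close>)

lemma meets_face_caps:
  "meets_face (range B) (range A)" "meets_face (F_tri i) (range A)" "meets_face (F_tri i) (range B)"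
  "meets_face (W_tri i) (range A)" "meets_face (W_tri i) (range B)"
proof -
  show "meets_face (range B) (range A)" unfolding meets_face_def
    by (rule hull_Int_separated[OF affine_zeta]) (use zeta_AB in \<open>auto simp: less_le\<close>)
  show "meets_face (F_tri i) (range A)"
    by (rule meets_face_F[OF affine_zeta]) (use zeta_AB in \<open>auto simp: less_le\<close>)
  show "meets_face (F_tri i) (range B)"
    by (rule meets_face_F[OF affine_lin[of i 1 1 1 "- 1"]])
      (use sigma_zeta_AB(1)[of i] sigma_zeta_AB(1)[of "i + 1"] sigma_zeta_AB(2) in \<open>auto simp: lin_eq_sigma_zeta\<close>)
  show "meets_face (W_tri i) (range A)"
    by (rule meets_face_W[OF affine_zeta]) (use zeta_AB in \<open>auto simp: less_le\<close>)
  show "meets_face (W_tri i) (range B)"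
    by (rule meets_face_W[OF affine_lin[of i 1 1 1 "- 1"]])
      (use sigma_zeta_AB(1)[of "i + 1"] sigma_zeta_AB(2) in \<open>auto simp: lin_eq_sigma_zeta\<close>)
qed

lemma meets_face_F_W:
  "meets_face (F_tri i) (W_tri i)" "meets_face (F_tri i) (W_tri (i + 1))" "meets_face (F_tri i) (W_tri (i + 2))"
proof -
  show "meets_face (F_tri i) (W_tri i)"
    by (rule meets_face_F[OF affine_fun_scale[OF affine_X[of "i + 2"], of "- 1"]])
      (use X_A[of i] X_B[of i] in \<open>auto simp: W_tri_def\<close>)
  show "meets_face (F_tri i) (W_tri (i + 2))"
    by (rule meets_face_F[OF affine_X[of "i + 1"]])
      (use X_A[of i] X_B[of i] in \<open>auto simp: W_tri_def\<close>)
  \<comment> \<open>These two triangles are disjoint. The separating form is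
    \<open>floor_fun (i + 1)\<close> with the coefficient of \<open>X i\<close> lowered by
    \<open>\<kappa> - 1\<close>: this turns the plane about the line through
    \<open>B (i + 1)\<close> and \<open>A (i + 2)\<close>, where \<open>X i = 0\<close>, and lifts
    \<open>A (i + 1)\<close> off it.\<close>
  let ?f = "lin i (\<kappa>\<^sup>2 - \<kappa> + 1) \<kappa> 1 (- \<kappa>)"
  have "(\<kappa>\<^sup>2 - \<kappa> + 1) * \<kappa> > 1 * 1" using kappa_facts kappa by (intro mult_strict_mono) auto
  moreover have "\<kappa>\<^sup>2 - \<kappa> + 1 - \<kappa> = (\<kappa> - 1) * (\<kappa> - 1)" by (simp add: algebra_simps power2_eq_square)
  then have "(\<kappa>\<^sup>2 - \<kappa> + 1 + - \<kappa>) * (\<kappa> - 1) > 0" using kappa_facts by (simp add: mult_pos_pos)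
  moreover have "\<kappa> * \<kappa> - (\<kappa>\<^sup>2 - \<kappa> + 1) = \<kappa> - 1" by (simp add: power2_eq_square)
  then have "\<kappa> * \<kappa> - (\<kappa>\<^sup>2 - \<kappa> + 1) > 0" using kappa_facts by simp
  ultimately have "?f (A i) > 0" "?f (B i) > 0" "?f (A (i + 1)) > 0"
    unfolding lin_A lin_B using weight_01 by simp_all
  moreover have "?f (B (i + 1)) \<le> 0" "?f (A (i + 2)) \<le> 0" "?f (B (i + 2)) \<le> 0"
    unfolding lin_A lin_B using weight_01 kappa_facts by (simp_all add: mult_nonpos_nonneg divide_nonpos_pos)
  ultimately show "meets_face (F_tri i) (W_tri (i + 1))"
    by (intro meets_face_F[OF affine_lin[of i "\<kappa>\<^sup>2 - \<kappa> + 1" \<kappa> 1 "- \<kappa>"]]) (auto simp: W_tri_def)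
qed

lemma meets_face_F_F: "meets_face (F_tri i) (F_tri (i + 1))"
proof -
  \<comment> \<open>A plane through the common corner \<open>A (i + 1)\<close> and through
    \<open>B (i + 1)\<close>.\<close>
  let ?f = "lin i \<kappa> 1 0 (- 1)"
  have "?f (A i) > 0" "?f (B i) > 0" "?f (A (i + 1)) = 0"
    "?f (B (i + 1)) = 0" "?f (A (i + 2)) < 0"
    unfolding lin_A lin_B using weight_01 kappa_facts by simp_all
  then show ?thesis
    by (intro meets_face_F[OF affine_lin[of i \<kappa> 1 0 "- 1"]]) (auto simp: F_tri_def)
qed

lemma meets_face_W_W: "meets_face (W_tri (i + 1)) (W_tri i)"
  by (rule meets_face_W[OF affine_X[of "i + 2"]])
    (use X_A[of i] X_B[of i] in \<open>auto simp: W_tri_def\<close>)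

lemma schoenhardt_triangles_cases:
  assumes "t \<in> schoenhardt_triangles A B"
  obtains "t = range A" | "t = range B" | i where "t = F_tri i" | i where "t = W_tri i"
  using assms unfolding schoenhardt_triangles_eq by auto

lemma triangles_meet:
  assumes "s \<in> schoenhardt_triangles A B" "t \<in> schoenhardt_triangles A B"
  shows "meets_face s t"
proof -
  have refl: "meets_face s s" for s unfolding meets_face_def by simp
  have FF: "meets_face (F_tri i) (F_tri j)" for i j
    using cyclic3_cases[of j i]
  proof (elim disjE)
    assume "j = i + 2"
    then show ?thesis using meets_face_sym[OF meets_face_F_F[of "i + 2"]] by simp
  qed (use refl meets_face_F_F in simp_all)
  have WW: "meets_face (W_tri i) (W_tri j)" for i j
    using cyclic3_cases[of j i]
  proof (elim disjE)
    assume "j = i + 2"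
    then show ?thesis using meets_face_W_W[of "i + 2"] by simp
  qed (use refl meets_face_sym[OF meets_face_W_W] in simp_all)
  have FW: "meets_face (F_tri i) (W_tri j)" for i j
    using cyclic3_cases[of j i] by (elim disjE) (simp_all add: meets_face_F_W)
  note caps = meets_face_caps meets_face_caps[THEN meets_face_sym]
  have *: "meets_face p t" if p: "meets_face p (range A)" "meets_face p (range B)"
    "\<And>i. meets_face p (F_tri i)" "\<And>i. meets_face p (W_tri i)" for p
    using assms(2) by (cases rule: schoenhardt_triangles_cases) (simp_all only: p)
  from assms(1) show ?thesis
  proof (cases rule: schoenhardt_triangles_cases)
    case 1
    show ?thesis unfolding 1 by (rule *; rule refl caps)
  next
    case 2
    show ?thesis unfolding 2 by (rule *; rule refl caps)
  next
    case (3 i)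
    show ?thesis unfolding 3 by (rule *; rule FF FW caps)
  next
    case (4 i)
    show ?thesis unfolding 4 by (rule *; rule WW meets_face_sym[OF FW] caps)
  qed
qed

lemma polytope_bounded_by_Q: "polytope_bounded_by Q (schoenhardt_triangles A B)"
  unfolding polytope_bounded_by_def
proof (intro conjI ballI)
  show "card t = 3" "\<not> affine_dependent t" if "t \<in> schoenhardt_triangles A B" for t
    using triangles_indep that by auto
  show "convex hull s \<inter> convex hull t = convex hull (s \<inter> t)"
    if "s \<in> schoenhardt_triangles A B" "t \<in> schoenhardt_triangles A B" for s t
    using triangles_meet[OF that] unfolding meets_face_def .
qed (rule compact_Q closure_interior_Q frontier_Q_triangles)+

text \<open>The segment from \<open>A 0\<close> to \<open>B 1\<close>, which is the other diagonal
  to the reflex edge from \<open>B 0\<close> to \<open>A 1\<close>, has its midpoint outside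
  \<open>Q\<close>.\<close>

lemma not_convex_Q: "\<not> convex Q"
proof
  assume "convex Q"
  have "F_tri 0 \<subseteq> Q" "W_tri 0 \<subseteq> Q"
    using hull_F_tri(1) hull_W_tri(1) hull_subset by (meson order_trans subsetI)+
  then have "A 0 \<in> Q" "B (0 + 1) \<in> Q" by (auto simp: F_tri_def W_tri_def)
  then have y: "(1 / 2) *\<^sub>R A 0 + (1 / 2) *\<^sub>R B (0 + 1) \<in> Q" (is "?y \<in> Q")
    by (rule convexD[OF \<open>convex Q\<close>]) auto
  have "floor_fun 0 ?y < 0" "X (0 + 2) ?y < 0"
    using X_A(3)[of 0] X_B(6)[of 0] floor_A(1)[of 0] floor_B(2)[of 0]
    by (simp_all add: affine_fun_comb affine_X affine_floor_fun)
  moreover have "0 \<le> floor_fun 0 ?y \<or> 0 \<le> X (0 + 2) ?y" using y unfolding Q_def by blast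
  ultimately show False by linarith
qed

section \<open>Dihedral angles of \<open>Q\<close>\<close>

lemma midpoint_fun: "affine_fun f \<Longrightarrow> f (midpoint x y) = (f x + f y) / 2"
  using affine_fun_comb[of f "1 / 2" "1 / 2" x y]
  by (simp add: midpoint_def scaleR_right_distrib)

lemma eventually_pos_along:
  assumes "affine_fun f" "f x + f y > 0"
  shows "\<forall>\<^sub>F t in at_right 0. f (midpoint x y + t *\<^sub>R e) > 0"
  by (rule eventually_affine_fun_pos[OF assms(1)]) (use assms(2) in \<open>simp only: midpoint_fun[OF assms(1)] zero_less_divide_iff, simp\<close>)

lemma eventually_moving:
  assumes "affine_fun f" "f x = 0" "f y = 0" "r > 0" "c > 0"
    "\<forall>z t. f (z + t *\<^sub>R e) = f z + t * (r * c)"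
  shows "\<forall>\<^sub>F t in at_right 0. f (midpoint x y + t *\<^sub>R e) > 0"
  using eventually_at_right_less[of 0]
  by eventually_elim (use assms midpoint_fun[OF assms(1), of x y] in simp)

text \<open>Both functions of the reflex edge vanish along it and decrease along the bisector, so
  both alternatives of the disjunction fail.\<close>

lemma angle_diagonal: "interior_dihedral_angle Q (B i) (A (i + 1)) (A i) (B (i + 1)) > pi"
proof (rule interior_dihedral_angle_greater_pi[OF affine_floor_fun[of i] _ _ _ _ affine_X[of "i + 2"]])
  show "floor_fun i (B i) = 0" "floor_fun i (A (i + 1)) = 0" "floor_fun i (A i) = 0" "floor_fun i (B (i + 1)) \<noteq> 0"
    using floor_A[of i] floor_B[of i] by auto
  show "X (i + 2) (B i) = 0" "X (i + 2) (A (i + 1)) = 0" "X (i + 2) (B (i + 1)) = 0" "X (i + 2) (A i) \<noteq> 0"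
    using X_A[of i] X_B[of i] by auto
  fix e assume "dihedral_direction (floor_fun i) (X (i + 2)) (A i) (B (i + 1)) e"
  then obtain r s where rs: "r > 0" "s > 0"
    "\<forall>y t. floor_fun i (y + t *\<^sub>R e) = floor_fun i y + t * (r * floor_fun i (B (i + 1)))"
    "\<forall>y t. X (i + 2) (y + t *\<^sub>R e) = X (i + 2) y + t * (s * X (i + 2) (A i))"
    unfolding dihedral_direction_def by blast
  have m: "floor_fun i (midpoint (B i) (A (i + 1))) = 0" "X (i + 2) (midpoint (B i) (A (i + 1))) = 0"
    using floor_A[of i] floor_B[of i] X_A[of i] X_B[of i] by (simp_all add: midpoint_fun affine_X affine_floor_fun)
  have neg: "r * floor_fun i (B (i + 1)) < 0" "s * X (i + 2) (A i) < 0"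
    using rs floor_B(2) X_A(3) by (simp_all add: mult_pos_neg)
  show "\<forall>\<^sub>F t in at_right 0. midpoint (B i) (A (i + 1)) + t *\<^sub>R e \<notin> Q"
    using eventually_at_right_less[of 0]
  proof eventually_elim
    case (elim t)
    then have "floor_fun i (midpoint (B i) (A (i + 1)) + t *\<^sub>R e) < 0" "X (i + 2) (midpoint (B i) (A (i + 1)) + t *\<^sub>R e) < 0"
      using rs(3,4) m neg by (simp_all add: mult_pos_neg)
    then show ?case unfolding Q_iff[of _ i] by auto
  qed
qed

text \<open>Along the bisector the two functions that vanish on the edge become positive, and the
  others used are positive at the midpoint already; for each disjunction one alternative is enough.
  The remaining convex edges follow the same scheme.\<close>

lemma angle_bottom: "interior_dihedral_angle Q (A i) (A (i + 1)) (A (i + 2)) (B i) < pi"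
proof (rule interior_dihedral_angle_less_pi[OF affine_zeta _ _ _ _ affine_floor_fun[of i]])
  show "zeta (A i) = 0" "zeta (A (i + 1)) = 0" "zeta (A (i + 2)) = 0" "zeta (B i) \<noteq> 0"
    using zeta_AB(1) zeta_AB(2)[of i] by auto
  show "floor_fun i (A i) = 0" "floor_fun i (A (i + 1)) = 0" "floor_fun i (B i) = 0" "floor_fun i (A (i + 2)) \<noteq> 0"
    using floor_A[of i] floor_B[of i] by auto
  fix e assume "dihedral_direction zeta (floor_fun i) (A (i + 2)) (B i) e"
  then obtain r s where rs: "r > 0" "s > 0"
    "\<forall>y t. zeta (y + t *\<^sub>R e) = zeta y + t * (r * zeta (B i))"
    "\<forall>y t. floor_fun i (y + t *\<^sub>R e) = floor_fun i y + t * (s * floor_fun i (A (i + 2)))"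
    unfolding dihedral_direction_def by blast
  have "\<forall>\<^sub>F t in at_right 0. zeta (midpoint (A i) (A (i + 1)) + t *\<^sub>R e) > 0"
    by (rule eventually_moving[OF affine_zeta zeta_AB(1) zeta_AB(1) rs(1) zeta_AB(2) rs(3)])
  moreover have "\<forall>\<^sub>F t in at_right 0. floor_fun i (midpoint (A i) (A (i + 1)) + t *\<^sub>R e) > 0"
    by (rule eventually_moving[OF affine_floor_fun floor_A(1) floor_A(2) rs(2) floor_A(3) rs(4)])
  moreover have "\<forall>\<^sub>F t in at_right 0. lin i 1 1 1 (- 1) (midpoint (A i) (A (i + 1)) + t *\<^sub>R e) > 0"
    by (rule eventually_pos_along[OF affine_lin])
      (use sigma_zeta_AB(1)[of i] sigma_zeta_AB(1)[of "i + 1"] in \<open>simp add: lin_eq_sigma_zeta\<close>)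
  moreover have "\<forall>\<^sub>F t in at_right 0. floor_fun (i + 1) (midpoint (A i) (A (i + 1)) + t *\<^sub>R e) > 0"
    by (rule eventually_pos_along[OF affine_floor_fun]) (use floor_A[of i] in simp)
  moreover have "\<forall>\<^sub>F t in at_right 0. floor_fun (i + 2) (midpoint (A i) (A (i + 1)) + t *\<^sub>R e) > 0"
    by (rule eventually_pos_along[OF affine_floor_fun]) (use floor_A[of i] in simp)
  ultimately show "\<forall>\<^sub>F t in at_right 0. midpoint (A i) (A (i + 1)) + t *\<^sub>R e \<in> Q"
    by eventually_elim (auto simp: Q_iff[of _ i] lin_eq_sigma_zeta)
qed

lemma angle_top: "interior_dihedral_angle Q (B i) (B (i + 1)) (B (i + 2)) (A (i + 1)) < pi"
proof (rule interior_dihedral_angle_less_pi[OF affine_lin[of i 1 1 1 "- 1"] _ _ _ _ affine_X[of "i + 2"]])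
  let ?f = "lin i 1 1 1 (- 1)"
  have f: "?f (B j) = 0" "?f (A j) > 0" for j using sigma_zeta_AB[of j] by (simp_all add: lin_eq_sigma_zeta)
  show "?f (B i) = 0" "?f (B (i + 1)) = 0" "?f (B (i + 2)) = 0" "?f (A (i + 1)) \<noteq> 0"
    using f less_imp_neq[OF f(2)] by auto
  show "X (i + 2) (B i) = 0" "X (i + 2) (B (i + 1)) = 0" "X (i + 2) (A (i + 1)) = 0" "X (i + 2) (B (i + 2)) \<noteq> 0"
    using X_A[of i] X_B[of i] by auto
  fix e assume "dihedral_direction ?f (X (i + 2)) (B (i + 2)) (A (i + 1)) e"
  then obtain r s where rs: "r > 0" "s > 0"
    "\<forall>y t. ?f (y + t *\<^sub>R e) = ?f y + t * (r * ?f (A (i + 1)))"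
    "\<forall>y t. X (i + 2) (y + t *\<^sub>R e) = X (i + 2) y + t * (s * X (i + 2) (B (i + 2)))"
    unfolding dihedral_direction_def by blast
  have "\<forall>\<^sub>F t in at_right 0. ?f (midpoint (B i) (B (i + 1)) + t *\<^sub>R e) > 0"
    by (rule eventually_moving[OF affine_lin f(1) f(1) rs(1) f(2) rs(3)])
  moreover have "\<forall>\<^sub>F t in at_right 0. X (i + 2) (midpoint (B i) (B (i + 1)) + t *\<^sub>R e) > 0"
    by (rule eventually_moving[OF affine_X X_B(3) X_B(6) rs(2) X_B(9) rs(4)])
  moreover have "\<forall>\<^sub>F t in at_right 0. zeta (midpoint (B i) (B (i + 1)) + t *\<^sub>R e) > 0"
    by (rule eventually_pos_along[OF affine_zeta]) (use zeta_AB(2)[of i] zeta_AB(2)[of "i + 1"] in simp)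
  moreover have "\<forall>\<^sub>F t in at_right 0. X i (midpoint (B i) (B (i + 1)) + t *\<^sub>R e) > 0"
    by (rule eventually_pos_along[OF affine_X]) (use X_B[of i] in simp)
  moreover have "\<forall>\<^sub>F t in at_right 0. X (i + 1) (midpoint (B i) (B (i + 1)) + t *\<^sub>R e) > 0"
    by (rule eventually_pos_along[OF affine_X]) (use X_B[of i] in simp)
  ultimately show "\<forall>\<^sub>F t in at_right 0. midpoint (B i) (B (i + 1)) + t *\<^sub>R e \<in> Q"
    by eventually_elim (auto simp: Q_iff[of _ i] lin_eq_sigma_zeta)
qed

lemma angle_side: "interior_dihedral_angle Q (A i) (B i) (A (i + 1)) (B (i + 2)) < pi"
proof (rule interior_dihedral_angle_less_pi[OF affine_floor_fun[of i] _ _ _ _ affine_X[of "i + 1"]])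
  show "floor_fun i (A i) = 0" "floor_fun i (B i) = 0" "floor_fun i (A (i + 1)) = 0" "floor_fun i (B (i + 2)) \<noteq> 0"
    using floor_A[of i] floor_B[of i] by auto
  show "X (i + 1) (A i) = 0" "X (i + 1) (B i) = 0" "X (i + 1) (B (i + 2)) = 0" "X (i + 1) (A (i + 1)) \<noteq> 0"
    using X_A[of i] X_B[of i] by auto
  fix e assume "dihedral_direction (floor_fun i) (X (i + 1)) (A (i + 1)) (B (i + 2)) e"
  then obtain r s where rs: "r > 0" "s > 0"
    "\<forall>y t. floor_fun i (y + t *\<^sub>R e) = floor_fun i y + t * (r * floor_fun i (B (i + 2)))"
    "\<forall>y t. X (i + 1) (y + t *\<^sub>R e) = X (i + 1) y + t * (s * X (i + 1) (A (i + 1)))"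
    unfolding dihedral_direction_def by blast
  have "\<forall>\<^sub>F t in at_right 0. floor_fun i (midpoint (A i) (B i) + t *\<^sub>R e) > 0"
    by (rule eventually_moving[OF affine_floor_fun floor_A(1) floor_B(1) rs(1) floor_B(3) rs(3)])
  moreover have "\<forall>\<^sub>F t in at_right 0. X (i + 1) (midpoint (A i) (B i) + t *\<^sub>R e) > 0"
    by (rule eventually_moving[OF affine_X X_A(2) X_B(2) rs(2) X_A(5) rs(4)])
  moreover have "\<forall>\<^sub>F t in at_right 0. zeta (midpoint (A i) (B i) + t *\<^sub>R e) > 0"
    by (rule eventually_pos_along[OF affine_zeta]) (use zeta_AB(1)[of i] zeta_AB(2)[of i] in simp)
  moreover have "\<forall>\<^sub>F t in at_right 0. lin i 1 1 1 (- 1) (midpoint (A i) (B i) + t *\<^sub>R e) > 0"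
    by (rule eventually_pos_along[OF affine_lin])
      (use sigma_zeta_AB[of i] in \<open>simp add: lin_eq_sigma_zeta\<close>)
  moreover have "\<forall>\<^sub>F t in at_right 0. X i (midpoint (A i) (B i) + t *\<^sub>R e) > 0"
    by (rule eventually_pos_along[OF affine_X]) (use X_A[of i] X_B[of i] in simp)
  ultimately show "\<forall>\<^sub>F t in at_right 0. midpoint (A i) (B i) + t *\<^sub>R e \<in> Q"
    by eventually_elim (auto simp: Q_iff[of _ i] lin_eq_sigma_zeta)
qed

lemma inj_A: "inj A" and inj_B: "inj B" and ranges_disjoint: "range A \<inter> range B = {}"
proof -
  show "inj A" unfolding A_def by (rule injI) (use vtx_inject[of _ 0 _ 0] in simp)
  show "inj B"
  proof (rule injI)
    fix i j assume "B i = B j"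
    then have "i + 2 = j + 2" using vtx_inject[of "i + 2" 1 "j + 2" 1] unfolding B_def by simp
    then have "i + 2 + 1 = j + 2 + 1" by (rule arg_cong)
    then show "i = j" unfolding cyclic3 .
  qed
  show "range A \<inter> range B = {}"
    unfolding A_def B_def using vtx_inject[of _ 0 _ 1] by auto
qed

lemma schoenhardt_position: "schoenhardt_position A B"
  unfolding schoenhardt_position_def schoenhardt_polytope_def
  using inj_A inj_B ranges_disjoint polytope_bounded_by_Q not_convex_Q angle_diagonal angle_bottom angle_top angle_side
  by blast

end

subsection \<open>Position relative to the given polytope\<close>

lemma polytope_eq_hull_vertices: "polytope P \<Longrightarrow> P = convex hull (vertices P)"
  unfolding vertices_def using Krein_Milman_Minkowski[of P] polytope_imp_compact polytope_imp_convex by blast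

text \<open>For \<open>sg = 1\<close> the polytope is on the side of the plane of \<open>F\<close>
  containing the apex, for \<open>sg = - 1\<close> on the other; the levels \<open>a\<close> and
  \<open>b\<close> are on the side away from \<open>P\<close>. Inequalities of other facets are
  controlled after scaling by \<open>r\<close>, since they are determined only up to a positive
  factor.\<close>

locale placed_cupola = cupola_config +
  fixes P F :: "point set" and R sg :: real
  assumes R: "R \<ge> 1" and sg: "sg = 1 \<or> sg = - 1"
    and kappa_eq: "\<kappa> = 4 * R\<^sup>2"
    and a_eq: "a = 1 + sg * (1 / (16 * R\<^sup>2))"
    and b_eq: "b = 1 + sg * (1 / (16 * R\<^sup>2) + 1 / (256 * \<kappa>\<^sup>2 * R ^ 3))"
    and polytope_P: "polytope P"
    and P_side: "\<And>p. p \<in> P \<Longrightarrow> sg * (1 - sigma p) \<ge> 0"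
    and X_vertices: "\<And>p j. p \<in> vertices P \<Longrightarrow> \<bar>X j p\<bar> \<le> R"
    and inequality_F: "\<And>G e c. facet_inequality P G e c \<Longrightarrow> F \<subseteq> G \<Longrightarrow>
      \<exists>r>0. \<forall>x. c - e \<bullet> x = r * (sg * (1 - sigma x))"
    and inequality_other: "\<And>G e c. facet_inequality P G e c \<Longrightarrow> \<not> F \<subseteq> G \<Longrightarrow>
      \<exists>r>0. \<forall>j. 1 / R \<le> r * (c - e \<bullet> (v + d j)) \<and> r * (c - e \<bullet> (v + d j)) \<le> R \<and> \<bar>r * (e \<bullet> d j)\<bar> \<le> R"
begin

lemma step_bounds: "0 < 1 / (16 * R\<^sup>2)" "1 / (16 * R\<^sup>2) \<le> 1 / 16"
  "0 < 1 / (256 * \<kappa>\<^sup>2 * R ^ 3)" "1 / (256 * \<kappa>\<^sup>2 * R ^ 3) = 1 / (16 * R\<^sup>2) / (16 * \<kappa>\<^sup>2 * R)"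
  "1 / (256 * \<kappa>\<^sup>2 * R ^ 3) \<le> 1 / (16 * R\<^sup>2)"
proof -
  have R2: "R\<^sup>2 \<ge> 1" "R > 0" using R by (auto simp: one_le_power)
  then show 1: "0 < 1 / (16 * R\<^sup>2)" "1 / (16 * R\<^sup>2) \<le> 1 / 16" by auto
  show "0 < 1 / (256 * \<kappa>\<^sup>2 * R ^ 3)" using R2 kappa by simp
  show eq: "1 / (256 * \<kappa>\<^sup>2 * R ^ 3) = 1 / (16 * R\<^sup>2) / (16 * \<kappa>\<^sup>2 * R)"
    by (simp add: power2_eq_square power3_eq_cube)
  have "\<kappa>\<^sup>2 \<ge> 1" using kappa by (simp add: one_le_power)
  then have "\<kappa>\<^sup>2 * R \<ge> 1 * 1" using R by (intro mult_mono) auto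
  then have "1 / (16 * R\<^sup>2) / (16 * \<kappa>\<^sup>2 * R) \<le> 1 / (16 * R\<^sup>2) / 1"
    using 1(1) \<open>\<kappa>\<^sup>2 * R \<ge> 1 * 1\<close> by (intro divide_left_mono) (auto simp: mult.assoc)
  then show "1 / (256 * \<kappa>\<^sup>2 * R ^ 3) \<le> 1 / (16 * R\<^sup>2)" unfolding eq by simp
qed

lemma vtx_levels:
  assumes "0 \<le> t" "t \<le> 1"
  shows "sg * (sigma (vtx i t) - a) \<ge> 0" "sg * (b - sigma (vtx i t)) \<ge> 0"
proof -
  let ?s = "sigma (vtx i t)"
  have w: "weight t > 0" and k: "\<kappa> - 1 > 0" and bb: "0 \<le> bump t" "bump t \<le> 1"
    using weight_pos[OF assms] kappa bump_bounds[OF assms] by auto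
  have z: "zeta (vtx i t) \<ge> 0" unfolding zeta_vtx[OF assms] using w k bb by simp
  have sz: "?s - zeta (vtx i t) = (\<kappa> - 1) * (1 - bump t) / weight t"
    unfolding zeta_vtx[OF assms] sigma_vtx by (simp add: right_diff_distrib diff_divide_distrib)
  have "?s - zeta (vtx i t) \<ge> 0" unfolding sz using w k bb by simp
  moreover have "?s - zeta (vtx i t) = a * (b - ?s) / (b - a)"
    unfolding zeta_def using ab by (simp add: field_simps)
  ultimately have *: "a * (b - ?s) / (b - a) \<ge> 0" by simp
  have **: "b * (?s - a) / (b - a) \<ge> 0" using z unfolding zeta_def .
  have sgba: "sg * (b - a) > 0" unfolding a_eq b_eq using sg step_bounds(3) by auto
  have "sg * (?s - a) = (b * (?s - a) / (b - a)) * (sg * (b - a)) / b" using b ab by simp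
  moreover have "(b * (?s - a) / (b - a)) * (sg * (b - a)) / b \<ge> 0"
    by (rule divide_nonneg_pos[OF mult_nonneg_nonneg[OF ** less_imp_le[OF sgba]] b])
  ultimately show "sg * (?s - a) \<ge> 0" by simp
  have "sg * (b - ?s) = (a * (b - ?s) / (b - a)) * (sg * (b - a)) / a" using a ab by simp
  moreover have "(a * (b - ?s) / (b - a)) * (sg * (b - a)) / a \<ge> 0"
    by (rule divide_nonneg_pos[OF mult_nonneg_nonneg[OF * less_imp_le[OF sgba]] a])
  ultimately show "sg * (b - ?s) \<ge> 0" by simp
qed

lemma vtx_level_bounds:
  assumes "0 \<le> t" "t \<le> 1"
  shows "sg * (sigma (vtx i t) - 1) > 0" "\<bar>sigma (vtx i t) - 1\<bar> \<le> 1 / (8 * R\<^sup>2)"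
proof -
  define x where "x = 1 / (16 * R\<^sup>2)"
  define y where "y = 1 / (256 * \<kappa>\<^sup>2 * R ^ 3)"
  define u where "u = sigma (vtx i t)"
  have e: "1 / (8 * R\<^sup>2) = x + x" unfolding x_def using R by (simp add: field_simps)
  have xy: "0 < x" "0 < y" "y \<le> x" unfolding x_def y_def by (rule step_bounds)+
  have l: "0 \<le> sg * (u - (1 + sg * x))" "0 \<le> sg * (1 + sg * (x + y) - u)"
    using vtx_levels[OF assms, of i] a_eq b_eq unfolding u_def x_def y_def by simp_all
  have "sg * (u - 1) > 0 \<and> \<bar>u - 1\<bar> \<le> x + x"
    using sg l xy by (elim disjE) auto
  then show "sg * (sigma (vtx i t) - 1) > 0" "\<bar>sigma (vtx i t) - 1\<bar> \<le> 1 / (8 * R\<^sup>2)"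
    unfolding e u_def by auto
qed

text \<open>Projected from the apex to the plane of \<open>F\<close>, the vertex has barycentric
  coordinates \<open>m0\<close>, \<open>t\<close>, \<open>- m2\<close> with respect to the corners
  \<open>v + d j\<close>. The choice of \<open>\<kappa>\<close> makes \<open>m2\<close> at most
  \<open>1 / (3 * R\<^sup>2)\<close>, so the slack \<open>Y\<close> there is at least
  \<open>2 / 3 * (1 / R)\<close>. Moving back to the level \<open>u\<close> changes it by at most
  \<open>3 / 8 * (1 / R)\<close>, which is less.\<close>

lemma vtx_inside:
  assumes t: "0 \<le> t" "t \<le> 1"
    and r: "\<And>j. 1 / R \<le> c - e \<bullet> (v + d j)" "\<And>j. c - e \<bullet> (v + d j) \<le> R" "\<And>j. \<bar>e \<bullet> d j\<bar> \<le> R"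
  shows "e \<bullet> vtx i t < c"
proof -
  define y where "y j = c - e \<bullet> (v + d j)" for j
  define z where "z j = e \<bullet> d j" for j
  define u where "u = sigma (vtx i t)"
  have w: "weight t > 0" and k: "\<kappa> - 1 > 0" using weight_pos[OF t] kappa by auto
  have u: "u = (\<kappa> - 1) / weight t" unfolding u_def by (rule sigma_vtx)
  have X: "X i (vtx i t) = u * ((1 - t) * \<kappa> / (\<kappa> - 1))" "X (i + 1) (vtx i t) = u * t"
    "X (i + 2) (vtx i t) = u * (- (1 - t) / (\<kappa> - 1))"
    unfolding X_vtx_cyclic u using k by simp_all
  define m0 m2 where "m0 = (1 - t) * \<kappa> / (\<kappa> - 1)" and "m2 = (1 - t) / (\<kappa> - 1)"
  have msum: "m0 + t - m2 = 1"
  proof -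
    have "m0 - m2 = ((1 - t) * \<kappa> - (1 - t)) / (\<kappa> - 1)"
      unfolding m0_def m2_def by (simp add: diff_divide_distrib)
    also have "(1 - t) * \<kappa> - (1 - t) = (1 - t) * (\<kappa> - 1)" by (simp add: algebra_simps)
    finally have "m0 - m2 = (1 - t) * (\<kappa> - 1) / (\<kappa> - 1)" .
    then show ?thesis using k by simp
  qed
  have m: "m0 \<ge> 0" "m2 \<ge> 0" "m2 \<le> 1" unfolding m0_def m2_def using t k kappa by (auto simp: field_simps)
  have m2le: "m2 * R \<le> (1 - t) * (1 / (3 * R))"
  proof -
    have "R\<^sup>2 \<ge> 1" using R by (simp add: one_le_power)
    then have "\<kappa> - 1 \<ge> 3 * R * R" unfolding kappa_eq by (simp add: power2_eq_square)
    then have "R / (\<kappa> - 1) \<le> R / (3 * R * R)" using R k by (intro divide_left_mono) auto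
    also have "\<dots> = 1 / (3 * R)" using R by simp
    finally have "(1 - t) * (R / (\<kappa> - 1)) \<le> (1 - t) * (1 / (3 * R))" using t by (intro mult_left_mono) auto
    then show ?thesis unfolding m2_def by simp
  qed
  define Y where "Y = m0 * y i + t * y (i + 1) - m2 * y (i + 2)"
  define Z where "Z = m0 * z i + t * z (i + 1) - m2 * z (i + 2)"
  have m0: "m0 = (1 - t) + m2" using msum by simp
  have "Y \<ge> (1 - t) * (1 / R) + t * (1 / R) - m2 * R"
  proof -
    have yy: "1 / R \<le> y j" "y j \<le> R" "0 \<le> y j" for j
    proof -
      show "1 / R \<le> y j" "y j \<le> R" using r unfolding y_def by auto
      moreover have "1 / R > 0" using R by simp
      ultimately show "0 \<le> y j" by linarith
    qed
    have "(1 - t) * (1 / R) \<le> (1 - t) * y i" "t * (1 / R) \<le> t * y (i + 1)"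
      "m2 * y (i + 2) \<le> m2 * R" "0 \<le> m2 * y i"
      using t m yy by (auto intro!: mult_left_mono simp del: times_divide_eq_right)
    then show ?thesis unfolding Y_def m0 distrib_right by linarith
  qed
  moreover have "(1 - t) * (1 / R) + t * (1 / R) = 1 / R" by (simp add: left_diff_distrib diff_divide_distrib)
  ultimately have "Y \<ge> 1 / R - m2 * R" by simp
  moreover have "(1 - t) * (1 / (3 * R)) \<le> 1 * (1 / (3 * R))" using t R by (intro mult_right_mono) auto
  then have "m2 * R \<le> 1 / R / 3" using m2le by simp
  moreover have "y \<ge> 2 / 3 * r" if "y \<ge> r - x" "x \<le> r / 3" for x y r :: real using that by simp
  ultimately have Y: "Y \<ge> 2 / 3 * (1 / R)" by blast
  have Z: "\<bar>Z\<bar> \<le> 3 * R"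
  proof -
    have zz: "\<bar>z j\<bar> \<le> R" for j using r unfolding z_def by auto
    have "\<bar>m0 * z i\<bar> \<le> m0 * R" "\<bar>t * z (i + 1)\<bar> \<le> t * R" "\<bar>m2 * z (i + 2)\<bar> \<le> m2 * R"
      unfolding abs_mult using m t zz by (auto intro!: mult_mono)
    then have "\<bar>Z\<bar> \<le> (m0 + t + m2) * R" unfolding Z_def by (simp add: algebra_simps)
    also have "\<dots> \<le> 3 * R" using msum m R by (intro mult_right_mono) auto
    finally show ?thesis .
  qed
  have "c - e \<bullet> vtx i t = Y + (1 - u) * Z"
  proof -
    have "e \<bullet> (v + (\<Sum>j\<in>UNIV. X j (vtx i t) *\<^sub>R d j)) =
        e \<bullet> v + (X i (vtx i t) * z i + X (i + 1) (vtx i t) * z (i + 1) + X (i + 2) (vtx i t) * z (i + 2))"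
      unfolding sum_cyclic3[of _ i] inner_add_right inner_scaleR_right z_def ..
    then have "e \<bullet> vtx i t = e \<bullet> v + (X i (vtx i t) * z i + X (i + 1) (vtx i t) * z (i + 1) + X (i + 2) (vtx i t) * z (i + 2))"
      unfolding point_X .
    also have "X i (vtx i t) * z i + X (i + 1) (vtx i t) * z (i + 1) + X (i + 2) (vtx i t) * z (i + 2) = u * Z"
      unfolding X m0_def[symmetric] minus_divide_left[symmetric] m2_def[symmetric] Z_def by (simp add: algebra_simps)
    finally have 1: "e \<bullet> vtx i t = e \<bullet> v + u * Z" .
    have "Y = (m0 + t - m2) * (c - e \<bullet> v) - Z"
      unfolding Y_def Z_def y_def z_def by (simp add: algebra_simps inner_add_right)
    then show ?thesis unfolding 1 msum by (simp add: algebra_simps)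
  qed
  moreover have "\<bar>(1 - u) * Z\<bar> \<le> 3 / 8 * (1 / R)"
  proof -
    have "\<bar>1 - u\<bar> * \<bar>Z\<bar> \<le> 1 / (8 * R\<^sup>2) * (3 * R)"
      using vtx_level_bounds(2)[OF t, of i] Z unfolding u_def
      by (intro mult_mono) (auto simp: abs_minus_commute)
    also have "\<dots> = 3 / 8 * (1 / R)" using R by (simp add: power2_eq_square)
    finally show ?thesis by (simp add: abs_mult)
  qed
  moreover have "1 / R > 0" using R by simp
  ultimately show ?thesis using Y by linarith
qed

lemma W_vtx: "w \<in> W \<Longrightarrow> \<exists>i t. w = vtx i t \<and> 0 \<le> t \<and> t \<le> 1"
  unfolding W_def q_def using s_bounds by fastforce

lemma hull_beyond_F: "set_beyond (convex hull W) P F"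
  unfolding set_beyond_def beyond_region_def
proof (rule subset_trans[OF _ closure_subset], rule subsetI, unfold mem_Collect_eq point_beyond_def, intro allI impI)
  fix x G e c assume x: "x \<in> convex hull W" and G: "facet_inequality P G e c"
  show "if F \<subseteq> G then c < e \<bullet> x else e \<bullet> x < c"
  proof (cases "F \<subseteq> G")
    case True
    then obtain r where r: "r > 0" "\<forall>x. c - e \<bullet> x = r * (sg * (1 - sigma x))" using inequality_F G by blast
    have "e \<bullet> w - c > 0" if "w \<in> W" for w
    proof -
      obtain i t where "w = vtx i t" "0 \<le> t" "t \<le> 1" using W_vtx \<open>w \<in> W\<close> by blast
      then have "sg * (sigma w - 1) > 0" using vtx_level_bounds(1) by blast
      then have "r * (sg * (sigma w - 1)) > 0" using r(1) by (rule mult_pos_pos[rotated])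
      moreover have "e \<bullet> w - c = - (c - e \<bullet> w)" by simp
      then have "e \<bullet> w - c = r * (sg * (sigma w - 1))" unfolding r(2)[rule_format] by (simp add: algebra_simps)
      ultimately show ?thesis by simp
    qed
    then have "e \<bullet> x - c > 0"
      by (rule affine_fun_pos_hull[OF affine_fun_diff[OF affine_fun_inner affine_fun_const] _ x])
    then show ?thesis using True by simp
  next
    case False
    then obtain r where r: "r > 0" "\<forall>j. 1 / R \<le> r * (c - e \<bullet> (v + d j)) \<and> r * (c - e \<bullet> (v + d j)) \<le> R \<and> \<bar>r * (e \<bullet> d j)\<bar> \<le> R"
      using inequality_other G by blast
    have "c - e \<bullet> w > 0" if "w \<in> W" for w
    proof -
      obtain i t where it: "w = vtx i t" "0 \<le> t" "t \<le> 1" using W_vtx \<open>w \<in> W\<close> by blast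
      have "(r *\<^sub>R e) \<bullet> vtx i t < r * c"
        by (rule vtx_inside[OF it(2,3)]) (use r(2) in \<open>simp_all add: right_diff_distrib\<close>)
      then show ?thesis unfolding it using r(1) by simp
    qed
    then have "c - e \<bullet> x > 0"
      by (rule affine_fun_pos_hull[OF affine_fun_diff[OF affine_fun_const affine_fun_inner] _ x])
    then show ?thesis using False by simp
  qed
qed

text \<open>On \<open>P\<close> the difference of \<open>sigma\<close> from \<open>a\<close> is at
  least \<open>1 / (16 * R\<^sup>2)\<close>, which is \<open>16 * \<kappa>\<^sup>2 * R\<close> times
  the gap between the levels; the factor \<open>b \<ge> 1 / 2\<close> leaves half of this.\<close>

lemma zeta_P:
  assumes "p \<in> P" shows "zeta p \<le> - (8 * \<kappa>\<^sup>2 * R)"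
proof -
  let ?e = "1 / (16 * R\<^sup>2)" and ?f = "1 / (256 * \<kappa>\<^sup>2 * R ^ 3)"
  have s: "sg * (1 - sigma p) \<ge> 0" using P_side assms .
  have "zeta p = b * ((sg * (sigma p - a)) / (sg * (b - a)))" unfolding zeta_def using sg by auto
  also have "sg * (b - a) = ?f" unfolding a_eq b_eq using sg by auto
  also have "sg * (sigma p - a) = - (sg * (1 - sigma p)) - ?e" unfolding a_eq using sg by auto
  finally have z: "zeta p = - (b * ((sg * (1 - sigma p) + ?e) / ?f))" by (simp add: algebra_simps)
  have bh: "b \<ge> 1 / 2"
  proof -
    have "1 + x * (y + z) \<ge> 1 / 2" if "x = 1 \<or> x = - 1" "0 < y" "y \<le> 1 / 16" "0 < z" "z \<le> y" for x y z :: real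
      using that by auto
    then show ?thesis unfolding b_eq using sg step_bounds(1,2,3,5) by blast
  qed
  have "?e / ?f \<le> (sg * (1 - sigma p) + ?e) / ?f" using s step_bounds(3) by (intro divide_right_mono) auto
  moreover have "?e / ?f = 16 * \<kappa>\<^sup>2 * R" using step_bounds(1) unfolding step_bounds(4) by simp
  ultimately have "16 * \<kappa>\<^sup>2 * R \<le> (sg * (1 - sigma p) + ?e) / ?f" by simp
  then have "1 / 2 * (16 * \<kappa>\<^sup>2 * R) \<le> b * ((sg * (1 - sigma p) + ?e) / ?f)"
    using bh R by (intro mult_mono) auto
  then show ?thesis unfolding z by simp
qed

text \<open>The coefficients of the coordinates in a roof function have absolute sum at most
  \<open>7 * \<kappa>\<^sup>2\<close>, so their part is at least
  \<open>- (7 * \<kappa>\<^sup>2 * R)\<close>, while \<open>- zeta\<close> contributes at least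
  \<open>8 * \<kappa>\<^sup>2 * R\<close>.\<close>

lemma roof_P:
  assumes g: "g \<in> labels" "g \<noteq> Bottom" and p: "p \<in> vertices P" "p \<in> P" shows "facet_fun g p > 0"
proof -
  have z: "zeta p \<le> - (8 * \<kappa>\<^sup>2 * R)" using zeta_P p(2) .
  have *: "lin i u0 u1 u2 (- 1) p > 0" if "\<bar>u0\<bar> + \<bar>u1\<bar> + \<bar>u2\<bar> \<le> 7 * \<kappa>\<^sup>2" for i u0 u1 u2
  proof -
    have "\<bar>u0 * X i p\<bar> \<le> \<bar>u0\<bar> * R" "\<bar>u1 * X (i + 1) p\<bar> \<le> \<bar>u1\<bar> * R" "\<bar>u2 * X (i + 2) p\<bar> \<le> \<bar>u2\<bar> * R"
      unfolding abs_mult using X_vertices[OF p(1)] by (auto intro!: mult_left_mono)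
    moreover have "(\<bar>u0\<bar> + \<bar>u1\<bar> + \<bar>u2\<bar>) * R \<le> 7 * \<kappa>\<^sup>2 * R" using that R by (intro mult_right_mono) auto
    moreover have "\<kappa>\<^sup>2 * R > 0" using kappa R by simp
    ultimately show ?thesis using z unfolding lin_def distrib_right by linarith
  qed
  have k2: "\<kappa>\<^sup>2 \<ge> 2 * \<kappa>" using kappa unfolding power2_eq_square by (intro mult_right_mono) auto
  from g(1) show ?thesis
  proof (cases rule: labels_cases)
    case 1
    then show ?thesis using g(2) by simp
  next
    case 2
    show ?thesis unfolding 2 facet_fun.simps by (rule *) (use k2 kappa in simp)
  next
    case (3 i k)
    note b = lo_hi_bounds[OF 3(1)]
    have "0 \<le> lo k * (\<kappa> - 1)" "lo k * (\<kappa> - 1) \<le> 1 * (\<kappa> - 1)" using b kappa by (auto intro!: mult_right_mono)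
    moreover have "\<bar>1\<bar> + \<bar>h\<bar> + \<bar>\<kappa> - y\<bar> \<le> 7 * z"
      if "0 \<le> y" "y \<le> 1 * (\<kappa> - 1)" "1 \<le> h" "h \<le> 3 / 2" "2 * \<kappa> \<le> z" for y h z :: real
      using that kappa by simp
    ultimately have "\<bar>1\<bar> + \<bar>hi k\<bar> + \<bar>\<kappa> - lo k * (\<kappa> - 1)\<bar> \<le> 7 * \<kappa>\<^sup>2" using b(3,4) k2 by blast
    then show ?thesis unfolding 3 facet_fun.simps by (rule *)
  next
    case (4 i k)
    note b = lo_hi_bounds[OF 4(1)]
    have l: "0 \<le> lo k * (\<kappa> - 1)" "lo k * (\<kappa> - 1) \<le> 1 * (\<kappa> - 1)" using b kappa by (auto intro!: mult_right_mono)
    have h: "hi k * \<kappa> \<le> 3 / 2 * \<kappa>" "hi k * \<kappa>\<^sup>2 \<le> 3 / 2 * \<kappa>\<^sup>2" "0 \<le> hi k * \<kappa>" "0 \<le> hi k * \<kappa>\<^sup>2"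
      using b kappa by (auto intro!: mult_right_mono)
    have "\<bar>p\<bar> + \<bar>h\<bar> + \<bar>q - y\<bar> \<le> 7 * z"
      if "0 \<le> y" "y \<le> 1 * (\<kappa> - 1)" "p \<le> 3 / 2 * \<kappa>" "q \<le> 3 / 2 * z" "0 \<le> p" "0 \<le> q"
        "1 \<le> h" "h \<le> 3 / 2" "2 * \<kappa> \<le> z" for p q y h z :: real
      using that kappa by simp
    then have "\<bar>hi k * \<kappa>\<bar> + \<bar>hi k\<bar> + \<bar>hi k * \<kappa>\<^sup>2 - lo k * (\<kappa> - 1)\<bar> \<le> 7 * \<kappa>\<^sup>2"
      using l h b(3,4) k2 by blast
    then show ?thesis unfolding 4 facet_fun.simps by (rule *)
  qed
qed

lemma P_beyond_bottom: "set_beyond P (convex hull W) (convex hull (range A))"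
  unfolding set_beyond_def beyond_region_def
proof (rule subset_trans[OF _ closure_subset], rule subsetI, unfold mem_Collect_eq point_beyond_def, intro allI impI)
  fix p G e c assume p: "p \<in> P" and G: "facet_inequality (convex hull W) G e c"
  obtain g l where g: "g \<in> labels" "G = convex hull (facet_verts g)" "l > 0"
    and "\<forall>x. c - e \<bullet> x = l * facet_fun g x"
    by (rule facet_inequality_positive_multiple[OF G])
  then have eq: "c - e \<bullet> x = l * facet_fun g x" for x by blast
  show "if convex hull range A \<subseteq> G then c < e \<bullet> p else e \<bullet> p < c"
  proof (cases "g = Bottom")
    case True
    have "\<kappa>\<^sup>2 * R > 0" using kappa R by simp
    then have "zeta p < 0" using zeta_P[OF p] by simp
    then have "l * facet_fun g p < 0" using g(3) unfolding True facet_fun_Bottom by (simp add: mult_pos_neg)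
    then show ?thesis using eq[of p] g(2) True by simp
  next
    case False
    have P: "P = convex hull (vertices P)" using polytope_eq_hull_vertices[OF polytope_P] .
    have "facet_fun g p > 0"
    proof (rule affine_fun_pos_hull[OF affine_facet_fun])
      show "p \<in> convex hull (vertices P)" using p P by simp
      show "facet_fun g w > 0" if "w \<in> vertices P" for w
      proof -
        have "w \<in> P" using that unfolding vertices_def extreme_point_of_def by simp
        then show ?thesis using roof_P[OF g(1) False that] by simp
      qed
    qed
    then have "l * facet_fun g p > 0" using g(3) by simp
    \<comment> \<open>Each other facet misses some \<open>A i\<close>.\<close>
    moreover have "\<not> convex hull range A \<subseteq> G"
    proof
      assume sub: "convex hull range A \<subseteq> G"
      have "facet_fun g w = 0" if "w \<in> range A" for w
        using that sub hull_subset[of "range A" convex] face_eq[OF g(1)] unfolding g(2) by blast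
      then have A0: "facet_fun g (A i) = 0" for i by blast
      from g(1) show False
      proof (cases rule: labels_cases)
        case 1
        then show False using False by simp
      next
        case 2
        then show False using A0[of 0] kappa weight_01 by (simp only: facet_fun.simps lin_A) simp
      next
        case (3 i k)
        have "facet_fun g (vtx (i + 1) 0) > 0" unfolding 3 by (rule side_B_1) (use 3 in auto)
        then show False using A0[of "i + 1"] by (simp add: A_def)
      next
        case (4 i k)
        have "facet_fun g (vtx (i + 2) 0) > 0" unfolding 4 by (rule side_A_2) (use 4 in auto)
        then show False using A0[of "i + 2"] by (simp add: A_def)
      qed
    qed
    ultimately show ?thesis using eq[of p] by simp
  qed
qed

end

subsection \<open>Coordinates of the given cone\<close>

lemma facet_of_subset_eq:
  assumes "F facet_of P" "G facet_of P" "F \<subseteq> G" shows "F = G"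
proof -
  have "F face_of G" using assms face_of_subset[of F P G] facet_of_imp_face_of face_of_imp_subset by metis
  moreover have "aff_dim F = aff_dim G" using assms unfolding facet_of_def by simp
  moreover have "convex G" using assms(2) facet_of_imp_face_of face_of_imp_convex by blast
  ultimately show ?thesis using face_of_aff_dim_lt[of G F] by force
qed

text \<open>Facet inequalities may carry arbitrary real factors. The cross product from three
  vertices is a normal whose size is controlled by the vertices; the sign of \<open>r\<close> is
  left open because it depends on their order.\<close>

lemma facet_vertices_normal:
  assumes P: "three_polytope P" and G: "G facet_of P"
  shows "\<exists>u1\<in>vertices P. \<exists>u2\<in>vertices P. \<exists>u3\<in>vertices P.
    u1 \<in> G \<and> cross3 (u2 - u1) (u3 - u1) \<noteq> 0 \<and>
    (\<forall>e c. facet_inequality P G e c \<longrightarrow>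
      (\<exists>r. r \<noteq> 0 \<and> (\<forall>x. c - e \<bullet> x = r * (cross3 (u2 - u1) (u3 - u1) \<bullet> (x - u1)))))"
proof -
  have poly: "polytope P" and dim: "aff_dim P = 3" using P unfolding three_polytope_def by auto
  have Gf: "G face_of P" using G by (rule facet_of_imp_face_of)
  have Gp: "polytope G" using face_of_polytope_polytope[OF poly Gf] .
  have Gd: "aff_dim G = 2" using G dim unfolding facet_of_def by simp
  have hull: "G = convex hull (vertices G)" by (rule polytope_eq_hull_vertices[OF Gp])
  obtain S where S: "S \<subseteq> vertices G" "\<not> affine_dependent S" "affine hull (vertices G) = affine hull S"
    using affine_basis_exists[of "vertices G"] by metis
  have "aff_dim S = aff_dim G"
    by (metis S(3) aff_dim_affine_hull aff_dim_convex_hull hull)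
  then have "card S = 3" using aff_dim_affine_independent[OF S(2)] Gd by simp
  then obtain u1 u2 u3 where u: "S = {u1, u2, u3}" "u1 \<noteq> u2" "u1 \<noteq> u3" "u2 \<noteq> u3"
    by (auto simp: card_3_iff)
  have vG: "vertices G \<subseteq> vertices P"
    unfolding vertices_def using extreme_point_of_face[OF Gf] by auto
  have uP: "u1 \<in> vertices P" "u2 \<in> vertices P" "u3 \<in> vertices P" using S(1) vG u by auto
  have uG: "u1 \<in> G" "u2 \<in> G" "u3 \<in> G"
    using S(1) u unfolding vertices_def extreme_point_of_def by auto
  define n where "n = cross3 (u2 - u1) (u3 - u1)"
  have "\<not> collinear {u1, u2, u3}"
    using S(2) u collinear_3_eq_affine_dependent by blast
  then have "n \<noteq> 0"
  proof -
    have "\<not> collinear {0, u2 - u1, u3 - u1}"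
      using \<open>\<not> collinear {u1, u2, u3}\<close> collinear_3[of u2 u1 u3] by (simp add: insert_commute)
    then show ?thesis unfolding n_def cross_eq_0 .
  qed
  moreover have "\<exists>r. r \<noteq> 0 \<and> (\<forall>x. c - e \<bullet> x = r * (n \<bullet> (x - u1)))" if "facet_inequality P G e c" for e c
  proof -
    have *: "P \<subseteq> {x. e \<bullet> x \<le> c}" "G = P \<inter> {x. e \<bullet> x = c}" using that unfolding facet_inequality_def by auto
    have e0: "e \<noteq> 0"
    proof
      assume "e = 0"
      then have "G = P \<or> G = {}" using * by auto
      then show False using Gd dim by auto
    qed
    have u0: "c - e \<bullet> u1 = 0" "c - e \<bullet> u2 = 0" "c - e \<bullet> u3 = 0" using uG *(2) by auto
    have "n \<bullet> (x - u1) * (c - e \<bullet> y) = n \<bullet> (y - u1) * (c - e \<bullet> x)" for x y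
      using plane_side_proportional[OF _ u0, of x y] unfolding plane_side_def n_def[symmetric]
      by (simp add: affine_fun_diff)
    from this[of _ "u1 + n"] have eq: "(n \<bullet> n) * (c - e \<bullet> x) = (c - e \<bullet> (u1 + n)) * (n \<bullet> (x - u1))" for x
      by (simp add: mult.commute)
    define r where "r = (c - e \<bullet> (u1 + n)) / (n \<bullet> n)"
    have r: "c - e \<bullet> x = r * (n \<bullet> (x - u1))" for x
      unfolding r_def using eq[of x] \<open>n \<noteq> 0\<close> by (simp add: field_simps)
    have "r \<noteq> 0"
    proof
      assume "r = 0"
      then have c: "e \<bullet> x = c" for x using r[of x] by simp
      have "e \<bullet> e = 0" using c[of 0] c[of e] by simp
      then show False using e0 by simp
    qed
    then show ?thesis using r by blast
  qed
  ultimately show ?thesis using uP uG unfolding n_def by blast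
qed

lemma facet_inequality_exists:
  assumes "polytope P" "G facet_of P" shows "\<exists>e c. facet_inequality P G e c"
  using facet_of_polyhedron[OF polytope_imp_polyhedron[OF assms(1)] assms(2)] assms(2)
  unfolding facet_inequality_def by metis

section \<open>The dual basis of the cone normals\<close>

locale cone_dual =
  fixes a :: "3 \<Rightarrow> point" and b :: "3 \<Rightarrow> real"
  assumes unique: "\<exists>!x. \<forall>i. a i \<bullet> x = b i"
begin

lemma kernel_trivial: "(\<And>i. a i \<bullet> y = 0) \<Longrightarrow> y = 0"
proof -
  assume y: "\<And>i. a i \<bullet> y = 0"
  obtain x where x: "\<forall>i. a i \<bullet> x = b i" using unique by blast
  then have "\<forall>i. a i \<bullet> (x + y) = b i" using y by (simp add: inner_add_right)
  then have "x + y = x" using unique x by blast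
  then show "y = 0" by simp
qed

text \<open>Cramer's rule for the basis dual to \<open>a\<close>; the explicit formula allows its
  size to be bounded.\<close>

definition g :: "3 \<Rightarrow> point" where
  "g j = (1 / (a j \<bullet> cross3 (a (j + 1)) (a (j + 2)))) *\<^sub>R cross3 (a (j + 1)) (a (j + 2))"

lemma a_g: "a k \<bullet> g j = (if k = j then 1 else 0)"
proof -
  define c where "c = cross3 (a (j + 1)) (a (j + 2))"
  have c0: "a (j + 1) \<bullet> c = 0" "a (j + 2) \<bullet> c = 0" unfolding c_def by (simp_all add: dot_cross_self)
  have "c \<noteq> 0"
  proof -
    define f :: "point \<Rightarrow> point" where "f x = (\<chi> i. a i \<bullet> x)" for x
    have lin: "linear f" unfolding f_def
      by (rule linearI) (simp_all add: vec_eq_iff inner_add_right)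
    have "inj f"
      unfolding linear_injective_0[OF lin]
      using kernel_trivial by (auto simp: f_def vec_eq_iff)
    then have "surj f" using linear_injective_imp_surjective[OF lin] by blast
    \<comment> \<open>With these preimages, \<open>c \<bullet> cross3 p q\<close> is the determinant
      of the 2 by 2 identity matrix.\<close>
    then obtain p q where "f p = axis (j + 1) 1" "f q = axis (j + 2) 1" by (metis surjD)
    then have "\<And>i. a i \<bullet> p = axis (j + 1) 1 $ i" "\<And>i. a i \<bullet> q = axis (j + 2) 1 $ i"
      unfolding f_def by (metis vec_lambda_beta)+
    then have "c \<bullet> cross3 p q = 1" unfolding c_def dot_cross by (simp add: axis_def)
    then show ?thesis by auto
  qed
  have "a j \<bullet> c \<noteq> 0"
  proof
    assume "a j \<bullet> c = 0"
    then have "a i \<bullet> c = 0" for i using c0 cyclic3_cases[of i j] by auto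
    then show False using kernel_trivial \<open>c \<noteq> 0\<close> by blast
  qed
  then show ?thesis
    unfolding g_def c_def[symmetric] using c0 cyclic3_cases[of k j] by auto
qed

definition v :: point where "v = (\<Sum>j\<in>UNIV. b j *\<^sub>R g j)"

lemma a_sum_g: "a k \<bullet> (\<Sum>j\<in>UNIV. y j *\<^sub>R g j) = y k"
  by (simp add: inner_sum_right a_g if_distrib[of "\<lambda>x. _ * x"] cong: if_cong)

lemma a_v: "a k \<bullet> v = b k"
  unfolding v_def by (rule a_sum_g)

lemma expand: "p - v = (\<Sum>j\<in>UNIV. (a j \<bullet> p - b j) *\<^sub>R g j)"
proof -
  have "p - v - (\<Sum>j\<in>UNIV. (a j \<bullet> p - b j) *\<^sub>R g j) = 0"
    by (rule kernel_trivial) (simp add: inner_diff_right a_v a_sum_g[where y = "\<lambda>j. a j \<bullet> p - b j"])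
  then show ?thesis by simp
qed

end

section \<open>The cone relative to the facet\<close>

locale cone_setup = cone_dual +
  fixes P F V :: "point set" and u1 u2 u3 :: point
  assumes P: "three_polytope P" and F: "F facet_of P"
    and V_eq: "V = {x. \<forall>i. a i \<bullet> x \<le> b i}"
    and triangle: "is_triangle (F \<inter> V)" and inside: "F \<inter> V \<subseteq> rel_interior F"
    and u_vertices: "u1 \<in> vertices P" "u2 \<in> vertices P" "u3 \<in> vertices P" "u1 \<in> F"
    and normal_nonzero: "cross3 (u2 - u1) (u3 - u1) \<noteq> 0"
    and normal_F: "\<And>e c. facet_inequality P F e c \<Longrightarrow>
      \<exists>r. r \<noteq> 0 \<and> (\<forall>x. c - e \<bullet> x = r * (cross3 (u2 - u1) (u3 - u1) \<bullet> (x - u1)))"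
begin

definition n :: point where "n = cross3 (u2 - u1) (u3 - u1)"
definition h :: real where "h = n \<bullet> u1 - n \<bullet> v"
definition H :: "point set" where "H = {x. n \<bullet> x = n \<bullet> u1}"

lemma polytope_P: "polytope P" using P unfolding three_polytope_def by simp

lemma F_subset_P: "F \<subseteq> P" using F facet_of_imp_subset by blast

lemma F_plane: "F \<subseteq> H" "affine hull F = H"
proof -
  obtain e c where ec: "facet_inequality P F e c" using facet_inequality_exists[OF polytope_P F] by blast
  obtain r where r: "r \<noteq> 0" "\<forall>x. c - e \<bullet> x = r * (n \<bullet> (x - u1))" using normal_F[OF ec] unfolding n_def by blast
  show sub: "F \<subseteq> H"
  proof
    fix x assume "x \<in> F"
    then have "c - e \<bullet> x = 0" using ec unfolding facet_inequality_def by auto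
    then show "x \<in> H" using r by (simp add: H_def inner_diff_right)
  qed
  have "aff_dim F = 2" using F P unfolding facet_of_def three_polytope_def by simp
  moreover have "aff_dim H = 2" unfolding H_def using aff_dim_hyperplane[of n] normal_nonzero unfolding n_def by simp
  moreover have "affine H" unfolding H_def by (rule affine_hyperplane)
  moreover from this have "affine hull F \<subseteq> H" using sub by (intro hull_minimal)
  ultimately show "affine hull F = H"
    using u_vertices(4) hull_subset[of F affine] by (intro affine_dim_equal) auto
qed

text \<open>The section \<open>V \<inter> H\<close> is connected. Its part in \<open>F\<close> is
  nonempty and closed, and it is relatively open because it avoids the relative boundary of
  \<open>F\<close>; hence it is everything.\<close>

lemma V_plane: "V \<inter> H \<subseteq> rel_interior F"
proof -
  let ?T = "V \<inter> H"
  have "convex V" unfolding V_eq Collect_all_eq by (intro convex_INT convex_halfspace_le)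
  moreover have "convex H" unfolding H_def by (rule convex_hyperplane)
  ultimately have conn: "connected ?T" by (intro convex_connected convex_Int)
  have eq: "?T \<inter> F = ?T \<inter> rel_interior F" using inside F_plane(1) rel_interior_subset[of F] by blast
  have "closed F" using face_of_polytope_polytope[OF polytope_P facet_of_imp_face_of[OF F]] polytope_imp_closed by blast
  then have "closedin (top_of_set ?T) (?T \<inter> F)" by (rule closedin_closed_Int)
  moreover have "openin (top_of_set ?T) (?T \<inter> F)"
  proof -
    obtain U where U: "open U" "rel_interior F = H \<inter> U"
      using openin_rel_interior[of F] unfolding F_plane(2) openin_open by blast
    then have "?T \<inter> F = ?T \<inter> U" unfolding eq by blast
    then show ?thesis using U(1) by (simp add: openin_open_Int)
  qed
  moreover have "?T \<inter> F \<noteq> {}"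
  proof -
    obtain x y z where "F \<inter> V = convex hull {x, y, z}" using triangle unfolding is_triangle_def by blast
    then have "F \<inter> V \<noteq> {}" by auto
    then show ?thesis using F_plane(1) by blast
  qed
  ultimately have "?T \<inter> F = ?T" using conn unfolding connected_clopen by blast
  then show ?thesis using eq by blast
qed

lemma F_Int_V: "F \<inter> V = V \<inter> H"
  using V_plane F_plane(1) rel_interior_subset[of F] by blast

text \<open>Otherwise \<open>V \<inter> H\<close> would contain a ray, although it lies in the
  bounded set \<open>F\<close>.\<close>

lemma no_recession:
  assumes "\<And>i. a i \<bullet> y \<le> 0" "n \<bullet> y = 0" shows "y = 0"
proof (rule ccontr)
  assume "y \<noteq> 0"
  obtain x y' z where "F \<inter> V = convex hull {x, y', z}" using triangle unfolding is_triangle_def by blast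
  then have x: "x \<in> V \<inter> H" unfolding F_Int_V[symmetric] by (simp add: hull_inc)
  have "bounded F" using bounded_subset[OF polytope_imp_bounded[OF polytope_P] F_subset_P] .
  then obtain M where M: "\<And>z. z \<in> F \<Longrightarrow> norm z \<le> M" unfolding bounded_iff by blast
  define t where "t = (M + norm x + 1) / norm y"
  have "M \<ge> 0" using M[of u1] u_vertices(4) norm_ge_zero[of u1] by linarith
  then have t: "t \<ge> 0" "t * norm y = M + norm x + 1" unfolding t_def using \<open>y \<noteq> 0\<close> by auto
  have "a i \<bullet> (x + t *\<^sub>R y) \<le> b i" for i
  proof -
    have "t * (a i \<bullet> y) \<le> 0" using assms(1) t(1) by (intro mult_nonneg_nonpos)
    moreover have "a i \<bullet> x \<le> b i" using x unfolding V_eq by blast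
    ultimately show ?thesis by (simp add: inner_add_right)
  qed
  then have "x + t *\<^sub>R y \<in> V \<inter> H"
    using x assms(2) unfolding V_eq H_def by (simp add: inner_add_right)
  then have "norm (x + t *\<^sub>R y) \<le> M" using M unfolding F_Int_V[symmetric] by blast
  moreover have "norm (t *\<^sub>R y) \<le> norm (x + t *\<^sub>R y) + norm x"
    using norm_triangle_ineq4[of "x + t *\<^sub>R y" x] by simp
  moreover have "norm (t *\<^sub>R y) = M + norm x + 1" using t by simp
  ultimately show False by linarith
qed

text \<open>If the apex were in the plane of \<open>F\<close>, each corner of the triangle would
  differ from it by a recession direction of the section, so all three would coincide with the
  apex.\<close>

lemma h_nonzero: "h \<noteq> 0"
proof
  assume h0: "h = 0"
  obtain x y z where T: "\<not> collinear {x, y, z}" "F \<inter> V = convex hull {x, y, z}"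
    using triangle unfolding is_triangle_def by blast
  have eq: "w = v" if "w \<in> {x, y, z}" for w
  proof -
    have "w \<in> V \<inter> H" using that T(2) unfolding F_Int_V[symmetric] by (simp add: hull_inc)
    then have "a i \<bullet> (w - v) \<le> 0" "n \<bullet> (w - v) = 0" for i
      using h0 unfolding h_def V_eq H_def by (auto simp: inner_diff_right a_v)
    then have "w - v = 0" by (rule no_recession)
    then show ?thesis by simp
  qed
  then have "x = v" "y = v" "z = v" by auto
  then show False using T(1) by simp
qed

text \<open>The edge of \<open>V\<close> in the direction \<open>- g j\<close> meets the plane of
  \<open>F\<close> at parameter \<open>t j\<close>.\<close>

definition t :: "3 \<Rightarrow> real" where "t j = h / (- (n \<bullet> g j))"

lemma ratio_pos: "- (n \<bullet> g k) / h > 0"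
proof (rule ccontr)
  assume k: "\<not> - (n \<bullet> g k) / h > 0"
  define r where "r j = - (n \<bullet> g j) / h" for j
  have ng: "n \<bullet> g j = - (r j * h)" for j unfolding r_def using h_nonzero by simp
  obtain x y z where "F \<inter> V = convex hull {x, y, z}" using triangle unfolding is_triangle_def by blast
  then have x: "x \<in> V \<inter> H" unfolding F_Int_V[symmetric] by (simp add: hull_inc)
  have "h = n \<bullet> (x - v)" using x unfolding h_def H_def by (simp add: inner_diff_right)
  also have "\<dots> = (\<Sum>j\<in>UNIV. (b j - a j \<bullet> x) * r j) * h"
    unfolding expand inner_sum_right inner_scaleR_right ng sum_distrib_right
    by (rule sum.cong) (auto simp: algebra_simps)
  finally have sum1: "(\<Sum>j\<in>UNIV. (b j - a j \<bullet> x) * r j) = 1" using h_nonzero by simp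
  have "\<exists>j. r j > 0"
  proof (rule ccontr)
    assume "\<not> (\<exists>j. r j > 0)"
    then have "(\<Sum>j\<in>UNIV. (b j - a j \<bullet> x) * r j) \<le> 0"
      using x unfolding V_eq by (intro sum_nonpos mult_nonneg_nonpos) (auto simp: not_less)
    then show False using sum1 by simp
  qed
  then obtain j where j: "r j > 0" by blast
  have rk: "r k \<le> 0" using k unfolding r_def by simp
  then have jk: "j \<noteq> k" using j by auto
  \<comment> \<open>Edge \<open>j\<close> approaches the plane and edge \<open>k\<close> does not,
    so a nonnegative combination of them is parallel to it: a nonzero recession direction of the
    section.\<close>
  define y where "y = - g k + (r k / r j) *\<^sub>R g j"
  have "a i \<bullet> y \<le> 0" for i
    unfolding y_def inner_add_right inner_minus_right inner_scaleR_right a_g using j rk jk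
    by (auto simp: divide_nonpos_pos)
  moreover have "n \<bullet> y = 0"
    unfolding y_def inner_add_right inner_minus_right inner_scaleR_right ng using j by simp
  ultimately have "y = 0" by (rule no_recession)
  then have "a k \<bullet> y = 0" by simp
  then show False unfolding y_def inner_add_right inner_minus_right inner_scaleR_right a_g using jk by simp
qed

lemma t_pos: "t k > 0"
proof -
  have "t k = 1 / (- (n \<bullet> g k) / h)" unfolding t_def by simp
  then show ?thesis using ratio_pos[of k] by (simp only: zero_less_divide_1_iff)
qed

definition d :: "3 \<Rightarrow> point" where "d j = - (t j) *\<^sub>R g j"
definition X :: "3 \<Rightarrow> point \<Rightarrow> real" where "X j p = (b j - a j \<bullet> p) / t j"

lemma frame: "affine_frame v d X"
proof
  show "affine_fun (X k)" for k
  proof -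
    have "X k = (\<lambda>p. (1 / t k) * (b k - a k \<bullet> p))" unfolding X_def by auto
    moreover have "affine_fun (\<lambda>p. (1 / t k) * (b k - a k \<bullet> p))"
      by (intro affine_fun_scale affine_fun_diff affine_fun_const affine_fun_inner)
    ultimately show ?thesis by simp
  qed
  show "X k (v + (\<Sum>j\<in>UNIV. y j *\<^sub>R d j)) = y k" for k y
  proof -
    have "(\<Sum>j\<in>UNIV. y j *\<^sub>R d j) = (\<Sum>j\<in>UNIV. (- (y j * t j)) *\<^sub>R g j)"
      unfolding d_def by (simp add: scaleR_scaleR)
    then show ?thesis
      unfolding X_def inner_add_right a_v using a_sum_g[of k "\<lambda>j. - (y j * t j)"] t_pos[of k] by simp
  qed
  show "v + (\<Sum>j\<in>UNIV. X j p *\<^sub>R d j) = p" for p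
  proof -
    have "(\<Sum>j\<in>UNIV. X j p *\<^sub>R d j) = (\<Sum>j\<in>UNIV. (a j \<bullet> p - b j) *\<^sub>R g j)"
    proof (rule sum.cong)
      fix j
      have "X j p * (- t j) = a j \<bullet> p - b j" unfolding X_def using t_pos[of j] by simp
      then show "X j p *\<^sub>R d j = (a j \<bullet> p - b j) *\<^sub>R g j" unfolding d_def scaleR_scaleR by simp
    qed simp
    then show ?thesis unfolding expand[of p, symmetric] by simp
  qed
qed

lemma V_X: "V = {p. \<forall>i. X i p \<ge> 0}"
  unfolding V_eq X_def using t_pos by (auto simp: zero_le_divide_iff less_le_not_le)

lemma sum_X: "(\<Sum>j\<in>UNIV. X j p) = 1 - (n \<bullet> u1 - n \<bullet> p) / h"
proof -
  have "n \<bullet> (p - v) = (\<Sum>j\<in>UNIV. X j p * h)"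
    unfolding expand inner_sum_right inner_scaleR_right
  proof (rule sum.cong)
    fix j
    have "n \<bullet> g j \<noteq> 0" using ratio_pos[of j] by auto
    then show "(a j \<bullet> p - b j) * (n \<bullet> g j) = X j p * h"
      unfolding X_def t_def using h_nonzero by (simp add: field_simps)
  qed simp
  then have "n \<bullet> p - n \<bullet> v = (\<Sum>j\<in>UNIV. X j p) * h" by (simp add: inner_diff_right sum_distrib_right)
  then have "(\<Sum>j\<in>UNIV. X j p) = (n \<bullet> p - n \<bullet> v) / h" using h_nonzero by simp
  also have "\<dots> = (h - (n \<bullet> u1 - n \<bullet> p)) / h" unfolding h_def by simp
  finally show ?thesis using h_nonzero by (simp add: diff_divide_distrib)
qed

lemma corner_inside: "v + d j \<in> rel_interior F"
proof -
  interpret affine_frame v d X by (rule frame)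
  have eq: "v + d j = v + (\<Sum>i\<in>UNIV. (if i = j then 1 else 0) *\<^sub>R d i)"
    by (simp add: if_distrib[of "\<lambda>x. x *\<^sub>R _"] cong: if_cong)
  have X: "X i (v + d j) = (if i = j then 1 else 0)" for i unfolding eq by (rule X_point)
  have "(\<Sum>i\<in>UNIV. X i (v + d j)) = 1" unfolding X by simp
  then have "v + d j \<in> H" unfolding sum_X H_def using h_nonzero by simp
  moreover have "v + d j \<in> V" unfolding V_X by (simp add: X)
  ultimately show ?thesis using V_plane by blast
qed

end

subsection \<open>The construction and its size\<close>

lemma finite_power2_bound:
  assumes "finite (A :: real set)"
  shows "\<exists>N. \<forall>r\<in>A. \<bar>r\<bar> \<le> 2 ^ N \<and> (r \<noteq> 0 \<longrightarrow> 1 / 2 ^ N \<le> \<bar>r\<bar>)"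
  using assms
proof induction
  case (insert x A)
  then obtain N where N: "\<forall>r\<in>A. \<bar>r\<bar> \<le> 2 ^ N \<and> (r \<noteq> 0 \<longrightarrow> 1 / 2 ^ N \<le> \<bar>r\<bar>)" by blast
  obtain k where k: "\<bar>x\<bar> < 2 ^ k" using real_arch_pow[of 2 "\<bar>x\<bar>"] by auto
  obtain l where l: "1 / \<bar>x\<bar> < 2 ^ l" using real_arch_pow[of 2 "1 / \<bar>x\<bar>"] by auto
  define M where "M = N + k + l"
  have pow: "(2 :: real) ^ N \<le> 2 ^ M" "(2 :: real) ^ k \<le> 2 ^ M" "(2 :: real) ^ l \<le> 2 ^ M"
    unfolding M_def by (auto intro!: power_increasing)
  have "\<bar>r\<bar> \<le> 2 ^ M \<and> (r \<noteq> 0 \<longrightarrow> 1 / 2 ^ M \<le> \<bar>r\<bar>)" if r: "r \<in> insert x A" for r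
  proof (cases "r = x")
    case True
    have "1 / 2 ^ M \<le> \<bar>x\<bar>" if "x \<noteq> 0"
    proof -
      have "1 / \<bar>x\<bar> \<le> 2 ^ M" using l pow by linarith
      then show ?thesis using that by (simp add: field_simps)
    qed
    moreover have "\<bar>x\<bar> \<le> 2 ^ M" using k pow by linarith
    ultimately show ?thesis using True by blast
  next
    case False
    then have r: "\<bar>r\<bar> \<le> 2 ^ N" "r \<noteq> 0 \<longrightarrow> 1 / 2 ^ N \<le> \<bar>r\<bar>" using N r by auto
    have "(1 :: real) / 2 ^ M \<le> 1 / 2 ^ N" using pow by (intro divide_left_mono) auto
    then show ?thesis using r pow by linarith
  qed
  then show ?case by blast
qed simp

context placed_cupola
begin

lemma W_size:
  assumes "S \<ge> 1" and N: "R = 2 ^ N" "N \<le> 1800 * S" and m: "m \<le> S" "m > 0"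
    and s: "\<And>k. s k = (if k = m + 1 then 1 else real k / real (3 * m))"
    and vd: "size_bound.szv S 83 v" "\<And>j. size_bound.szv S 480 (d j)" and w: "w \<in> W"
  shows "size_bound.szv S 83000 w"
proof -
  interpret size_bound S by standard fact
  have R1: "sz 1800 R" unfolding N(1) by (rule sz_power2) (rule N(2))
  have num: "sz 2 4" "sz 4 16" "sz 8 256" "sz 1 2" "sz 2 3"
  proof -
    show "sz 2 4" "sz 4 16" "sz 8 256" "sz 1 2"
      using sz_power2[of 2 2] sz_power2[of 4 4] sz_power2[of 8 8] sz_power2[of 1 1] S by auto
    have "(2 :: nat) ^ 2 \<le> 2 ^ (2 * S)" using S by (intro power_increasing) auto
    then show "sz 2 3" using sz_of_nat[of 3 2] by simp
  qed
  have R2: "sz 3600 (R\<^sup>2)" unfolding power2_eq_square by (rule sz_mono[OF sz_mult[OF R1 R1]]) simp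
  have k: "sz 3602 \<kappa>" unfolding kappa_eq by (rule sz_mono[OF sz_mult[OF num(1) R2]]) simp
  have k1: "sz 3604 (\<kappa> - 1)" by (rule sz_mono[OF sz_diff[OF k sz_1]]) simp
  have e: "sz 3605 (1 / (16 * R\<^sup>2))" by (rule sz_mono[OF sz_divide[OF sz_1 sz_mult[OF num(2) R2]]]) simp
  have sgn: "sz 1 sg" using sg sz_1 sz_minus[OF sz_1] by auto
  have a: "sz 3608 a" unfolding a_eq by (rule sz_mono[OF sz_add[OF sz_1 sz_mult[OF sgn e]]]) simp
  have k2: "sz 7204 (\<kappa>\<^sup>2)" unfolding power2_eq_square by (rule sz_mono[OF sz_mult[OF k k]]) simp
  have R3: "sz 5400 (R ^ 3)"
  proof -
    have "R ^ 3 = R\<^sup>2 * R" by (simp add: power2_eq_square power3_eq_cube)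
    then show ?thesis using sz_mono[OF sz_mult[OF R2 R1]] by simp
  qed
  have f: "sz 12613 (1 / (256 * \<kappa>\<^sup>2 * R ^ 3))"
    by (rule sz_mono[OF sz_divide[OF sz_1 sz_mult[OF sz_mult[OF num(3) k2] R3]]]) simp
  have b: "sz 16222 b" unfolding b_eq by (rule sz_mono[OF sz_add[OF sz_1 sz_mult[OF sgn sz_add[OF e f]]]]) simp
  obtain i l where il: "w = q i l" "l \<le> m + 1" using w unfolding W_def by auto
  have pow: "S < 2 ^ (1 * S)" "3 * S \<le> 2 ^ (2 * S)"
  proof -
    show "S < 2 ^ (1 * S)" by simp
    have "3 * S \<le> 4 ^ S"
    proof (induction S)
      case (Suc S)
      have "(1 :: nat) \<le> 4 ^ S" by simp
      then show ?case using Suc unfolding power_Suc mult_Suc_right by linarith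
    qed simp
    then show "3 * S \<le> 2 ^ (2 * S)" by (simp add: power_mult)
  qed
  have t: "sz 3 (s l)"
  proof (cases "l = m + 1")
    case True
    then show ?thesis unfolding s using sz_mono[OF sz_1, of 3] by simp
  next
    case False
    have "sz 1 (real l)" by (rule sz_of_nat) (use il m False pow in linarith)
    moreover have "sz 2 (real (3 * m))" by (rule sz_of_nat) (use m pow in linarith)
    ultimately have "sz 3 (real l / real (3 * m))" by (rule sz_mono[OF sz_divide]) simp
    then show ?thesis unfolding s using False by simp
  qed
  have t1: "sz 5 (1 - s l)" by (rule sz_mono[OF sz_diff[OF sz_1 t]]) simp
  have bu: "sz 10 (bump (s l))" unfolding bump_def
    by (rule sz_mono[OF sz_divide[OF sz_mult[OF t sz_diff[OF num(5) t]] num(4)]]) simp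
  have we: "sz 23457 (weight (s l))" unfolding weight_def
    by (rule sz_mono[OF sz_mult[OF k1 sz_add[OF sz_divide[OF sz_diff[OF sz_1 bu] a] sz_divide[OF bu b]]]]) simp
  have c: "sz 27064 (vtx_coord i (s l) j)" for j
  proof -
    have "sz 3607 (if j = i then (1 - s l) * \<kappa> else if j = i + 1 then (\<kappa> - 1) * s l else - (1 - s l))"
      using sz_mono[OF sz_mult[OF t1 k], of 3607] sz_mono[OF sz_mult[OF k1 t], of 3607]
        sz_mono[OF sz_minus[OF t1], of 3607] by simp
    then show ?thesis unfolding vtx_coord_def by (rule sz_mono[OF sz_divide[OF _ we]]) simp
  qed
  have summand: "szv 27544 (vtx_coord i (s l) j *\<^sub>R d j)" for j
    by (rule szv_mono[OF szv_scale[OF c vd(2)]]) simp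
  \<comment> \<open>Three summands of 27544 units, \<open>v\<close> with 83 and one unit per
    addition total 82718.\<close>
  show ?thesis unfolding il(1) q_def vtx_def sum_cyclic3[of _ i]
    by (rule szv_mono[OF szv_add[OF vd(1) szv_add[OF szv_add[OF summand summand] summand]]]) simp
qed

end

context cone_setup
begin

text \<open>The numbers that \<open>R\<close> has to bound from both sides. All triples of vertices
  occur, so that no triple has to be selected per facet; degenerate ones yield 0, which
  \<open>good\<close> exempts from the lower bound.\<close>

definition quantities :: "real set" where
  "quantities = (\<Union>p1\<in>vertices P. \<Union>p2\<in>vertices P. \<Union>p3\<in>vertices P. \<Union>j.
     {cross3 (p2 - p1) (p3 - p1) \<bullet> (v + d j - p1), cross3 (p2 - p1) (p3 - p1) \<bullet> d j}) \<union>
     (\<Union>p\<in>vertices P. \<Union>j. {X j p})"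

definition good :: "nat \<Rightarrow> bool" where
  "good N \<longleftrightarrow> (\<forall>r\<in>quantities. \<bar>r\<bar> \<le> 2 ^ N \<and> (r \<noteq> 0 \<longrightarrow> 1 / 2 ^ N \<le> \<bar>r\<bar>))"

lemma finite_vertices: "finite (vertices P)"
  unfolding vertices_def using finite_polyhedron_extreme_points[OF polytope_imp_polyhedron[OF polytope_P]] .

lemma good_exists: "\<exists>N. good N"
  unfolding good_def
  by (rule finite_power2_bound) (use finite_vertices in \<open>auto simp: quantities_def\<close>)

lemma sizes:
  assumes "S \<ge> 1" and a1: "\<And>i. size_bound.szv S 1 (a i)" and b1: "\<And>i. size_bound.sz S 1 (b i)"
    and p1: "\<And>p. p \<in> vertices P \<Longrightarrow> size_bound.szv S 1 p"
  shows "size_bound.szv S 83 v" "size_bound.szv S 480 (d j)" "good (1800 * S)"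
proof -
  interpret size_bound S by standard fact
  have cr: "szv 5 (cross3 (a (j + 1)) (a (j + 2)))" for j
    by (rule szv_mono[OF szv_cross3[OF a1 a1]]) simp
  have g: "szv 26 (g j)" for j
    unfolding g_def by (rule szv_mono[OF szv_scale[OF sz_divide[OF sz_1 sz_inner[OF a1 cr]] cr]]) simp
  have bg: "szv 27 (b j *\<^sub>R g j)" for j by (rule szv_mono[OF szv_scale[OF b1 g]]) simp
  show v: "szv 83 v" unfolding v_def sum_cyclic3[of _ 0]
    by (rule szv_mono[OF szv_add[OF szv_add[OF bg bg] bg]]) simp
  have nn: "szv 13 (cross3 (p2 - p1) (p3 - p1))" if "p1 \<in> vertices P" "p2 \<in> vertices P" "p3 \<in> vertices P" for p1 p2 p3
    by (rule szv_mono[OF szv_cross3[OF szv_diff[OF p1 p1] szv_diff[OF p1 p1]]]) (use that in simp_all)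
  have n: "szv 13 n" unfolding n_def by (rule nn) (rule u_vertices)+
  have h: "sz 335 h" unfolding h_def
    by (rule sz_mono[OF sz_diff[OF sz_inner[OF n p1] sz_inner[OF n v]]]) (use u_vertices in simp_all)
  have t: "sz 454 (t j)" for j unfolding t_def
    by (rule sz_mono[OF sz_divide[OF h sz_minus[OF sz_inner[OF n g]]]]) simp
  show d: "szv 480 (d j)" for j unfolding d_def
    by (rule szv_mono[OF szv_scale[OF sz_minus[OF t] g]]) simp
  have X: "sz 464 (X j p)" if "p \<in> vertices P" for j p unfolding X_def
    by (rule sz_mono[OF sz_divide[OF sz_diff[OF b1 sz_inner[OF a1 p1]] t]]) (use that in simp_all)
  have "sz 1800 r" if r: "r \<in> quantities" for r
  proof -
    consider p1 p2 p3 j where "p1 \<in> vertices P" "p2 \<in> vertices P" "p3 \<in> vertices P"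
        "r = cross3 (p2 - p1) (p3 - p1) \<bullet> (v + d j - p1) \<or> r = cross3 (p2 - p1) (p3 - p1) \<bullet> d j"
      | p j where "p \<in> vertices P" "r = X j p"
      using r unfolding quantities_def by blast
    then show ?thesis
    proof cases
      case 1
      have "sz 1800 (cross3 (p2 - p1) (p3 - p1) \<bullet> (v + d j - p1))"
        \<comment> \<open>The largest size that occurs,
          \<open>3 * (13 + 566) + 2 = 1739\<close>.\<close>
        by (rule sz_mono[OF sz_inner[OF nn szv_diff[OF szv_add[OF v d] p1]]]) (use 1 in simp_all)
      moreover have "sz 1800 (cross3 (p2 - p1) (p3 - p1) \<bullet> d j)"
        by (rule sz_mono[OF sz_inner[OF nn d]]) (use 1 in simp_all)
      ultimately show ?thesis using 1(4) by auto
    next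
      case 2
      then show ?thesis using sz_mono[OF X] by simp
    qed
  qed
  then show "good (1800 * S)"
    unfolding good_def sz_def using bounded_rat_abs_le bounded_rat_abs_ge by blast
qed

lemma normal_scaled: "r * (n \<bullet> (x - u1)) = (- (r * h)) * ((n \<bullet> u1 - n \<bullet> x) / h)"
  using h_nonzero by (simp add: inner_diff_right field_simps)

text \<open>The size claim is carried along for all admissible \<open>S\<close>, so the same objects
  serve real input, where merely some \<open>N\<close> is good, and rational input, where
  \<open>N = 1800 * S\<close> is.\<close>

lemma construction:
  assumes N: "good N" and m: "m > 0"
  shows "\<exists>C A B q. cupola m C A B q \<and> set_beyond C P F \<and> set_beyond P C (convex hull (range A)) \<and>
    visibility_cone A B = V \<and>
    (\<forall>S. S \<ge> 1 \<longrightarrow> N \<le> 1800 * S \<longrightarrow> m \<le> S \<longrightarrow> size_bound.szv S 83 v \<longrightarrow> (\<forall>j. size_bound.szv S 480 (d j)) \<longrightarrow>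
      (\<forall>x\<in>vertices C. size_bound.szv S 83000 x))"
proof -
  define R :: real where "R = 2 ^ N"
  have R: "R \<ge> 1" unfolding R_def by simp
  define \<kappa> where "\<kappa> = 4 * R\<^sup>2"
  obtain e0 c0 where ec0: "facet_inequality P F e0 c0" using facet_inequality_exists[OF polytope_P F] by blast
  obtain r0 where r0: "r0 \<noteq> 0" "\<forall>x. c0 - e0 \<bullet> x = r0 * (n \<bullet> (x - u1))" using normal_F[OF ec0] unfolding n_def by blast
  \<comment> \<open>On \<open>P\<close> the nonnegative slack of \<open>F\<close> is
    \<open>- (r0 * h)\<close> times \<open>1 - sigma\<close>, so this sign tells on which side
    \<open>P\<close> lies.\<close>
  define sg :: real where "sg = (if - (r0 * h) > 0 then 1 else - 1)"
  have sg: "sg = 1 \<or> sg = - 1" unfolding sg_def by simp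
  define aa where "aa = 1 + sg * (1 / (16 * R\<^sup>2))"
  define bb where "bb = 1 + sg * (1 / (16 * R\<^sup>2) + 1 / (256 * \<kappa>\<^sup>2 * R ^ 3))"
  \<comment> \<open>Equidistant nodes up to \<open>s m = 1 / 3\<close>, then one jump to 1.\<close>
  define s :: "nat \<Rightarrow> real" where "s k = (if k = m + 1 then 1 else real k / real (3 * m))" for k
  have R2: "R\<^sup>2 \<ge> 1" using R by (simp add: one_le_power)
  have kappa: "\<kappa> \<ge> 2" unfolding \<kappa>_def using R2 by simp
  have e: "0 < 1 / (16 * R\<^sup>2)" "1 / (16 * R\<^sup>2) \<le> 1 / 16"
    using R2 frac_le[of 1 1 16 "16 * R\<^sup>2"] by auto
  have f: "0 < 1 / (256 * \<kappa>\<^sup>2 * R ^ 3)" "1 / (256 * \<kappa>\<^sup>2 * R ^ 3) \<le> 1 / 256"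
  proof -
    have "\<kappa>\<^sup>2 \<ge> 1" "R ^ 3 \<ge> 1" using kappa R by (auto simp: one_le_power)
    then have "256 * \<kappa>\<^sup>2 * R ^ 3 \<ge> 256 * 1 * 1" by (intro mult_mono) auto
    then show "1 / (256 * \<kappa>\<^sup>2 * R ^ 3) \<le> 1 / 256"
      using frac_le[of 1 1 256 "256 * \<kappa>\<^sup>2 * R ^ 3"] by simp
    show "0 < 1 / (256 * \<kappa>\<^sup>2 * R ^ 3)" using kappa R by (intro divide_pos_pos mult_pos_pos zero_less_power) auto
  qed
  have s_less: "s k < s l" if "k < l" "l \<le> m + 1" for k l
  proof -
    have "real k / real (3 * m) \<le> 1 / 3" using that m by (simp add: field_simps)
    then show ?thesis using that m unfolding s_def by (auto simp: divide_strict_right_mono)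
  qed
  have fr: "affine_frame v d X" by (rule frame)
  interpret K: cupola_config v d X \<kappa> aa bb m s
  proof -
    interpret affine_frame v d X by (rule fr)
    show "cupola_config v d X \<kappa> aa bb m s"
    proof unfold_locales
      show "2 \<le> \<kappa>" by fact
      have "0 < 1 + x * y \<and> 0 < 1 + x * (y + z) \<and> 1 + x * y \<noteq> 1 + x * (y + z)"
        if "x = 1 \<or> x = - 1" "0 < y" "y \<le> 1 / 16" "0 < z" "z \<le> 1 / 256" for x y z :: real
        using that by auto
      from this[OF sg e f] show "0 < aa" "0 < bb" "aa \<noteq> bb" unfolding aa_def bb_def by blast+
      show "s 0 = 0" "s (m + 1) = 1" using m by (simp_all add: s_def)
      show "s k < s l" if "k < l" "l \<le> m + 1" for k l using s_less that .
      show "s k \<le> 1 / 3" if "k \<le> m" for k using that m unfolding s_def by (simp add: field_simps)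
    qed
  qed
  have sigma: "1 - K.sigma p = (n \<bullet> u1 - n \<bullet> p) / h" for p unfolding K.sigma_def sum_X by simp
  have ineq: "\<exists>r. r \<noteq> 0 \<and> (\<forall>x. c - e \<bullet> x = r * (1 - K.sigma x))" if "facet_inequality P F e c" for e c
  proof -
    note Fe = that
    obtain r where r: "r \<noteq> 0" "\<forall>x. c - e \<bullet> x = r * (n \<bullet> (x - u1))" using normal_F[OF Fe] unfolding n_def by blast
    have "c - e \<bullet> x = (- (r * h)) * (1 - K.sigma x)" for x
      unfolding sigma r(2)[rule_format] by (rule normal_scaled)
    moreover have "- (r * h) \<noteq> 0" using r h_nonzero by simp
    ultimately show ?thesis by blast
  qed
  have rh0: "c0 - e0 \<bullet> x = (- (r0 * h)) * (1 - K.sigma x)" for x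
    unfolding sigma r0(2)[rule_format] by (rule normal_scaled)
  have sgr: "- (r0 * h) = \<bar>r0 * h\<bar> * sg" "\<bar>r0 * h\<bar> > 0" unfolding sg_def using r0(1) h_nonzero by auto
  have side: "sg * (1 - K.sigma p) \<ge> 0" if "p \<in> P" for p
  proof -
    have "c0 - e0 \<bullet> p \<ge> 0" using ec0 that unfolding facet_inequality_def by auto
    then have "\<bar>r0 * h\<bar> * (sg * (1 - K.sigma p)) \<ge> 0" unfolding rh0 sgr(1) by (simp add: mult.assoc)
    then show ?thesis using sgr(2) by (simp only: zero_le_mult_iff) linarith
  qed
  have "\<not> P \<subseteq> F"
    using F P F_subset_P unfolding facet_of_def three_polytope_def by auto
  \<comment> \<open>A point of \<open>P\<close> off \<open>F\<close> fixes the sign of the factor in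
    any inequality defining \<open>F\<close>.\<close>
  then obtain p0 where p0: "p0 \<in> P" "p0 \<notin> F" by blast
  have corner: "v + d j \<in> P" for j using corner_inside[of j] rel_interior_subset[of F] F_subset_P by blast
  interpret L: placed_cupola v d X \<kappa> aa bb m s P F R sg
  proof unfold_locales
    show "1 \<le> R" "sg = 1 \<or> sg = - 1" "polytope P" by (fact R sg polytope_P)+
    show "\<kappa> = 4 * R\<^sup>2" "aa = 1 + sg * (1 / (16 * R\<^sup>2))"
      "bb = 1 + sg * (1 / (16 * R\<^sup>2) + 1 / (256 * \<kappa>\<^sup>2 * R ^ 3))"
      by (simp_all only: \<kappa>_def aa_def bb_def)
    show "0 \<le> sg * (1 - K.sigma p)" if "p \<in> P" for p using side that .
    show "\<bar>X j p\<bar> \<le> R" if "p \<in> vertices P" for p j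
      using N that unfolding good_def R_def quantities_def by blast
    show "\<exists>r>0. \<forall>x. c - e \<bullet> x = r * (sg * (1 - K.sigma x))" if G: "facet_inequality P G e c" "F \<subseteq> G" for G e c
    proof -
      have "G facet_of P" using G(1)[unfolded facet_inequality_def] by (rule conjunct1)
      then have "G = F" using facet_of_subset_eq[OF F _ G(2)] by blast
      then have Fi: "facet_inequality P F e c" using G by simp
      obtain r where r: "r \<noteq> 0" "\<forall>x. c - e \<bullet> x = r * (1 - K.sigma x)" using ineq[OF Fi] by blast
      have "c - e \<bullet> p0 > 0" using Fi p0 unfolding facet_inequality_def by force
      then have "r * (1 - K.sigma p0) > 0" using r(2) by simp
      moreover have "sg * (1 - K.sigma p0) \<ge> 0" using side p0 by simp
      moreover have sg2: "sg * sg = 1" using sg by auto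
      ultimately have "r * sg > 0"
        using sg r(1) by (auto simp: zero_less_mult_iff)
      moreover have "r * (1 - x) = (r * sg) * (sg * (1 - x))" for x using sg2 by (simp add: mult.assoc flip: mult.assoc[of sg sg])
      ultimately show ?thesis using r(2) by metis
    qed
    show "\<exists>r>0. \<forall>j. 1 / R \<le> r * (c - e \<bullet> (v + d j)) \<and> r * (c - e \<bullet> (v + d j)) \<le> R \<and> \<bar>r * (e \<bullet> d j)\<bar> \<le> R"
      if G: "facet_inequality P G e c" "\<not> F \<subseteq> G" for G e c
    proof -
      have Gf: "G facet_of P" using G(1)[unfolded facet_inequality_def] by (rule conjunct1)
      obtain p1 p2 p3 where p: "p1 \<in> vertices P" "p2 \<in> vertices P" "p3 \<in> vertices P"
        and "\<forall>e c. facet_inequality P G e c \<longrightarrow>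
          (\<exists>r. r \<noteq> 0 \<and> (\<forall>x. c - e \<bullet> x = r * (cross3 (p2 - p1) (p3 - p1) \<bullet> (x - p1))))"
        using facet_vertices_normal[OF P Gf] by blast
      then obtain r where r: "r \<noteq> 0" "\<forall>x. c - e \<bullet> x = r * (cross3 (p2 - p1) (p3 - p1) \<bullet> (x - p1))"
        using G(1) by blast
      define k where "k = cross3 (p2 - p1) (p3 - p1)"
      have ed: "e \<bullet> d j = - (r * (k \<bullet> d j))" for j
      proof -
        have "e \<bullet> d j = (c - e \<bullet> v) - (c - e \<bullet> (v + d j))" by (simp add: inner_add_right)
        also have "\<dots> = - (r * (k \<bullet> d j))"
          unfolding r(2)[rule_format] k_def[symmetric] by (simp add: inner_diff_right inner_add_right algebra_simps)
        finally show ?thesis .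
      qed
      have Q: "k \<bullet> (v + d j - p1) \<in> quantities" "k \<bullet> d j \<in> quantities" for j
        unfolding quantities_def k_def using p by blast+
      \<comment> \<open>Scaling by \<open>1 / \<bar>r\<bar>\<close> removes the arbitrary factor and
        leaves absolute values of members of \<open>quantities\<close>.\<close>
      have "1 / R \<le> 1 / \<bar>r\<bar> * (c - e \<bullet> (v + d j)) \<and> 1 / \<bar>r\<bar> * (c - e \<bullet> (v + d j)) \<le> R \<and> \<bar>1 / \<bar>r\<bar> * (e \<bullet> d j)\<bar> \<le> R" for j
      proof -
        \<comment> \<open>A face of \<open>P\<close> that meets the relative interior of
          \<open>F\<close> contains \<open>F\<close>.\<close>
        have "c - e \<bullet> (v + d j) \<noteq> 0"
        proof
          assume "c - e \<bullet> (v + d j) = 0"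
          then have "v + d j \<in> G" using corner[of j] G(1) unfolding facet_inequality_def by auto
          then have "G \<inter> rel_interior F \<noteq> {}" using corner_inside by blast
          then have "F \<subseteq> G" using subset_of_face_of[OF facet_of_imp_face_of[OF Gf] F_subset_P] by blast
          then show False using G(2) by simp
        qed
        moreover have "c - e \<bullet> (v + d j) \<ge> 0" using corner[of j] G(1) unfolding facet_inequality_def by auto
        ultimately have pos: "c - e \<bullet> (v + d j) > 0" by simp
        have eq: "c - e \<bullet> (v + d j) = r * (k \<bullet> (v + d j - p1))" using r(2) unfolding k_def by simp
        have "1 / \<bar>r\<bar> * (c - e \<bullet> (v + d j)) = 1 / \<bar>r\<bar> * \<bar>c - e \<bullet> (v + d j)\<bar>" using pos by simp
        also have "\<dots> = \<bar>k \<bullet> (v + d j - p1)\<bar>" unfolding eq abs_mult using r(1) by simp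
        finally have 1: "1 / \<bar>r\<bar> * (c - e \<bullet> (v + d j)) = \<bar>k \<bullet> (v + d j - p1)\<bar>" .
        have "k \<bullet> (v + d j - p1) \<noteq> 0" using pos eq by auto
        then have "1 / R \<le> \<bar>k \<bullet> (v + d j - p1)\<bar> \<and> \<bar>k \<bullet> (v + d j - p1)\<bar> \<le> R"
          using N Q(1)[of j] unfolding good_def R_def by blast
        moreover have "\<bar>1 / \<bar>r\<bar> * (e \<bullet> d j)\<bar> = \<bar>k \<bullet> d j\<bar>" unfolding ed abs_mult using r(1) by (simp add: abs_mult)
        moreover have "\<bar>k \<bullet> d j\<bar> \<le> R" using N Q(2)[of j] unfolding good_def R_def by blast
        ultimately show ?thesis unfolding 1 by simp
      qed
      then show ?thesis using r(1) by (intro exI[of _ "1 / \<bar>r\<bar>"]) auto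
    qed
  qed
  have "cupola m (convex hull K.W) K.A K.B K.q" by (rule K.cupola_hull[OF K.schoenhardt_position])
  moreover have "set_beyond (convex hull K.W) P F" by (rule L.hull_beyond_F)
  moreover have "set_beyond P (convex hull K.W) (convex hull (range K.A))" by (rule L.P_beyond_bottom)
  moreover have "visibility_cone K.A K.B = V" unfolding K.visibility_cone_eq V_X ..
  moreover have "\<forall>S. S \<ge> 1 \<longrightarrow> N \<le> 1800 * S \<longrightarrow> m \<le> S \<longrightarrow> size_bound.szv S 83 v \<longrightarrow> (\<forall>j. size_bound.szv S 480 (d j)) \<longrightarrow>
      (\<forall>x\<in>vertices (convex hull K.W). size_bound.szv S 83000 x)"
    unfolding K.vertices_hull using L.W_size[OF _ R_def _ _ m s_def] by blast
  ultimately show ?thesis by blast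
qed

end

lemma cone_setup_exists:
  assumes "three_polytope P" "F facet_of P" "cone_description V a b" "is_triangle (F \<inter> V)" "F \<inter> V \<subseteq> rel_interior F"
  shows "\<exists>u1 u2 u3. cone_setup a b P F V u1 u2 u3"
proof -
  obtain u1 u2 u3 where u: "u1 \<in> vertices P" "u2 \<in> vertices P" "u3 \<in> vertices P" "u1 \<in> F"
    "cross3 (u2 - u1) (u3 - u1) \<noteq> 0"
    "\<forall>e c. facet_inequality P F e c \<longrightarrow>
      (\<exists>r. r \<noteq> 0 \<and> (\<forall>x. c - e \<bullet> x = r * (cross3 (u2 - u1) (u3 - u1) \<bullet> (x - u1))))"
    using facet_vertices_normal[OF assms(1,2)] by blast
  have "cone_setup a b P F V u1 u2 u3"
    by unfold_locales (use assms u in \<open>auto simp: cone_description_def\<close>)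
  then show ?thesis by blast
qed

theorem theorem9:
  shows "\<exists>p :: nat poly. \<forall>P F V m.
    three_polytope P \<and> F facet_of P \<and> triangular_cone V \<and>
    is_triangle (F \<inter> V) \<and> F \<inter> V \<subseteq> rel_interior F \<and> m > 0 \<longrightarrow>
    (\<exists>C A B q.
      cupola m C A B q \<and>
      set_beyond C P F \<and>
      set_beyond P C (convex hull (range A)) \<and>
      visibility_cone A B = V \<and>
      (rational_polytope P \<and> rational_cone V \<longrightarrow>
        rational_polytope C \<and>
        polytope_length C \<le> poly p (polytope_length P + cone_length V + m)))"
proof (intro exI[of _ "[:0, 0, 27 * (2 * 83000 + 4):]"] allI impI, elim conjE)
  fix P F V and m :: nat
  assume P: "three_polytope P" and F: "F facet_of P" and V: "triangular_cone V"
    and T: "is_triangle (F \<inter> V)" "F \<inter> V \<subseteq> rel_interior F" and m: "m > 0"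
  define S where "S = polytope_length P + cone_length V + m"
  have Sm: "S \<ge> 1" "m \<le> S" using m unfolding S_def by auto
  interpret size_bound S by standard fact
  show "\<exists>C A B q. cupola m C A B q \<and> set_beyond C P F \<and> set_beyond P C (convex hull (range A)) \<and>
      visibility_cone A B = V \<and>
      (rational_polytope P \<and> rational_cone V \<longrightarrow> rational_polytope C \<and>
        polytope_length C \<le> poly [:0, 0, 27 * (2 * 83000 + 4):] (polytope_length P + cone_length V + m))"
  proof (cases "rational_polytope P \<and> rational_cone V")
    case False
    obtain a b where ab: "cone_description V a b" using V unfolding triangular_cone_def by blast
    obtain u1 u2 u3 where "cone_setup a b P F V u1 u2 u3" using cone_setup_exists[OF P F ab T] by blast
    then interpret cone_setup a b P F V u1 u2 u3 .
    obtain N where "good N" using good_exists by blast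
    from construction[OF this m] show ?thesis using False by blast
  next
    case True
    \<comment> \<open>The minimum in \<open>cone_length\<close> is attained, and the construction
      uses a description attaining it.\<close>
    have "\<exists>l. \<exists>a b. rational_cone_description V a b \<and> l = (\<Sum>i\<in>UNIV. point_length (a i) + real_length (b i))"
      using True unfolding rational_cone_def by blast
    from LeastI_ex[OF this] obtain a b where ab: "rational_cone_description V a b"
      "cone_length V = (\<Sum>i\<in>UNIV. point_length (a i) + real_length (b i))"
      unfolding cone_length_def by blast
    have cd: "cone_description V a b" using ab(1) unfolding rational_cone_description_def by simp
    obtain u1 u2 u3 where "cone_setup a b P F V u1 u2 u3" using cone_setup_exists[OF P F cd T] by blast
    then interpret cone_setup a b P F V u1 u2 u3 .
    have len: "point_length (a i) + real_length (b i) \<le> S" for i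
    proof -
      have "point_length (a i) + real_length (b i) \<le> cone_length V"
        unfolding ab(2) by (rule member_le_sum[of i UNIV "\<lambda>i. point_length (a i) + real_length (b i)"]) auto
      then show ?thesis unfolding S_def by simp
    qed
    have a1: "szv 1 (a i)" and b1: "sz 1 (b i)" for i
    proof -
      have r: "rational_point (a i)" "b i \<in> \<rat>" using ab(1) unfolding rational_cone_description_def by auto
      show "szv 1 (a i)" by (rule point_length_szv[OF r(1)]) (use len[of i] in simp)
      show "sz 1 (b i)" unfolding sz_def by (rule real_length_bounded_rat[OF r(2)]) (use len[of i] in simp)
    qed
    have p1: "szv 1 p" if "p \<in> vertices P" for p
    proof (rule point_length_szv)
      show "rational_point p" using True that unfolding rational_polytope_def by blast
      have "point_length p \<le> polytope_length P"
        unfolding polytope_length_def using that finite_vertices by (intro member_le_sum) auto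
      then show "point_length p \<le> S" unfolding S_def by simp
    qed
    have sizes: "szv 83 v" "szv 480 (d j)" "good (1800 * S)" for j by (rule sizes[OF Sm(1) a1 b1 p1]; assumption)+
    obtain C A B q where C: "cupola m C A B q" "set_beyond C P F" "set_beyond P C (convex hull (range A))"
      "visibility_cone A B = V" and Cs: "\<forall>x\<in>vertices C. szv 83000 x"
      using construction[OF sizes(3) m] Sm sizes(1,2) by blast
    have card: "card (vertices C) = 3 * m + 6" and "polytope C"
      using C(1) unfolding cupola_def three_polytope_def by auto
    then have "rational_polytope C"
      unfolding rational_polytope_def using Cs szv_point_length(1) by blast
    \<comment> \<open>At most \<open>9 * S\<close> vertices, each with three coordinates of length
      at most \<open>(2 * 83000 + 4) * S\<close>, give the quadratic witness.\<close>
    moreover have "polytope_length C \<le> 27 * (2 * 83000 + 4) * S * S"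
    proof -
      have "polytope_length C \<le> (\<Sum>x\<in>vertices C. 3 * (2 * (83000 * S) + 4))"
        unfolding polytope_length_def using Cs szv_point_length(2) by (intro sum_mono) blast
      also have "\<dots> = (3 * m + 6) * (3 * (2 * (83000 * S) + 4))" using card by simp
      also have "\<dots> \<le> (9 * S) * (3 * ((2 * 83000 + 4) * S))"
      proof (rule mult_mono)
        show "3 * m + 6 \<le> 9 * S" using Sm by linarith
        show "3 * (2 * (83000 * S) + 4) \<le> 3 * ((2 * 83000 + 4) * S)" using Sm(1) by simp
      qed auto
      finally show ?thesis by simp
    qed
    ultimately show ?thesis using C unfolding S_def[symmetric] by (intro exI[of _ C] exI[of _ A] exI[of _ B] exI[of _ q]) (simp add: algebra_simps)
  qed
qed

end
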